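(* For every $\nu>0$ there exist a probability space and a $\mu^\nu$-stationary process $\tilde v^\nu=\{\tilde v^\nu(t)\}_{t\in\mathbb R}$ on it whose paths almost surely solve the inviscid unforced shell model $$\frac{du}{dt}(t)+B(u(t),u(t))=0,\qquad t\in\mathbb R$$ (in the sense that $u(t)-u(s)=-\int_s^tB(u(r),u(r))dr$ for all $s<t$), and whose paths belong to $C^\gamma(\mathbb R;H^{-1-\alpha})$ (locally $\gamma$-Hölder) for every $\gamma\in[0,1)$ and every $\alpha>0$.
   Context: Fix $k_0>0$, $\lambda>1$, $a,b\in\mathbb R$, $k_n=k_0\lambda^n$. Sequences $u=(u_n)_{n\ge1}$, $u_n\in\mathbb R^2\cong\mathbb C$; $H^\alpha=\{u:\sum_nk_n^{2\alpha}|u_n|^2<\infty\}$ with norm $(\sum_nk_n^{2\alpha}|u_n|^2)^{1/2}$. $B(u,v)=(B_n(u,v))_{n\ge1}$ with $B_n(u,v)=-i\big(a k_{n+1}\bar u_{n+1}v_{n+2}+bk_n\bar u_{n-1}v_{n+1}+ak_{n-1}u_{n-1}v_{n-2}+bk_{n-1}u_{n-2}v_{n-1}\big)$ ($u_j=v_j=0$ for $j\le0$; SABRA shell model). $\mu^\nu=\bigotimes_n\mu^\nu_n$ on $(\mathbb R^2)^{\mathbb N}$, $\mu^\nu_n(du_n)=\frac\nu{2\pi}e^{-\frac\nu2|u_n|^2}du_n$. A process is $\mu^\nu$-stationary if it is stationary and its law at each time is $\mu^\nu$. *)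

theory Defs
  imports "HOL-Probability.Probability"
begin

definition shell_k :: "real \<Rightarrow> real \<Rightarrow> nat \<Rightarrow> real" where
  "shell_k k0 lam n = k0 * lam ^ n"

text \<open>Sequences u = (u_n)_{n>=1} are functions nat => complex (R^2 = C); the value at
  index 0 is irrelevant. Access with the convention u_j = 0 for j <= 0.\<close>
definition sh :: "(nat \<Rightarrow> complex) \<Rightarrow> int \<Rightarrow> complex" where
  "sh u j = (if 1 \<le> j then u (nat j) else 0)"

definition sabraB :: "real \<Rightarrow> real \<Rightarrow> real \<Rightarrow> real \<Rightarrow>
    (nat \<Rightarrow> complex) \<Rightarrow> (nat \<Rightarrow> complex) \<Rightarrow> nat \<Rightarrow> complex" where
  "sabraB k0 lam a b u v n =
     - \<i> * ( of_real (a * shell_k k0 lam (n + 1)) * cnj (sh u (int n + 1)) * sh v (int n + 2)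
          + of_real (b * shell_k k0 lam n) * cnj (sh u (int n - 1)) * sh v (int n + 1)
          + of_real (a * shell_k k0 lam (n - 1)) * sh u (int n - 1) * sh v (int n - 2)
          + of_real (b * shell_k k0 lam (n - 1)) * sh u (int n - 2) * sh v (int n - 1))"

definition inH :: "real \<Rightarrow> real \<Rightarrow> real \<Rightarrow> (nat \<Rightarrow> complex) \<Rightarrow> bool" where
  "inH k0 lam \<alpha> u \<longleftrightarrow>
     summable (\<lambda>n. shell_k k0 lam (Suc n) powr (2 * \<alpha>) * (cmod (u (Suc n)))\<^sup>2)"

definition normH :: "real \<Rightarrow> real \<Rightarrow> real \<Rightarrow> (nat \<Rightarrow> complex) \<Rightarrow> real" where
  "normH k0 lam \<alpha> u =
     sqrt (\<Sum>n. shell_k k0 lam (Suc n) powr (2 * \<alpha>) * (cmod (u (Suc n)))\<^sup>2)"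

definition loc_holder_H :: "real \<Rightarrow> real \<Rightarrow> real \<Rightarrow> real \<Rightarrow> (real \<Rightarrow> nat \<Rightarrow> complex) \<Rightarrow> bool" where
  "loc_holder_H k0 lam \<gamma> \<beta> u \<longleftrightarrow>
     (\<forall>t. inH k0 lam \<beta> (u t)) \<and>
     (\<forall>t. ((\<lambda>s. normH k0 lam \<beta> (\<lambda>n. u s n - u t n)) \<longlongrightarrow> 0) (at t)) \<and>
     (\<forall>T>0. \<exists>C. \<forall>s\<in>{-T..T}. \<forall>t\<in>{-T..T}.
        normH k0 lam \<beta> (\<lambda>n. u t n - u s n) \<le> C * \<bar>t - s\<bar> powr \<gamma>)"

definition gauss_shell :: "real \<Rightarrow> complex measure" where
  "gauss_shell \<nu> = density lborel (\<lambda>z. ennreal (\<nu> / (2 * pi) * exp (- (\<nu> / 2) * (cmod z)\<^sup>2)))"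

definition mu :: "real \<Rightarrow> (nat \<Rightarrow> complex) measure" where
  "mu \<nu> = PiM {1..} (\<lambda>_. gauss_shell \<nu>)"

definition mu_stationary :: "'w measure \<Rightarrow> real \<Rightarrow> (real \<Rightarrow> 'w \<Rightarrow> nat \<Rightarrow> complex) \<Rightarrow> bool" where
  "mu_stationary M \<nu> X \<longleftrightarrow>
     (\<forall>t. X t \<in> measurable M (mu \<nu>) \<and> distr M (mu \<nu>) (X t) = mu \<nu>) \<and>
     (\<forall>J h. finite J \<longrightarrow>
        distr M (PiM J (\<lambda>_. mu \<nu>)) (\<lambda>\<omega>. \<lambda>t\<in>J. X (t + h) \<omega>) =
        distr M (PiM J (\<lambda>_. mu \<nu>)) (\<lambda>\<omega>. \<lambda>t\<in>J. X t \<omega>))"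

definition solves_inviscid :: "real \<Rightarrow> real \<Rightarrow> real \<Rightarrow> real \<Rightarrow> (real \<Rightarrow> nat \<Rightarrow> complex) \<Rightarrow> bool" where
  "solves_inviscid k0 lam a b u \<longleftrightarrow>
     (\<forall>n\<ge>1. \<forall>s t. s < t \<longrightarrow>
        set_integrable lborel {s..t} (\<lambda>r. sabraB k0 lam a b (u r) (u r) n) \<and>
        u t n - u s n = - (LINT r:{s..t}|lborel. sabraB k0 lam a b (u r) (u r) n))"

end

theory Submission
  imports Defs
begin

text \<open>
  The solution is a limit of stationary discrete dynamics, taken along an ultrafilter. The nonlinearity is
  a sum of two-shell rotations, one for each choice of a triad and of a shell that drives the
  rotation of the other two. The Cayley transform of such a rotation conserves the energy and is a product of shears, so
  it preserves the Gaussian measure. Composing the Cayley transforms of the first \<open>2 * N\<close> rotations with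
  time step \<open>1 / Suc N\<close> gives a map of the infinite sequences that preserves \<open>mu \<nu>\<close>, and whose increments and
  residuals have moments bounded by the Gaussian moments.

  Let \<open>U\<close> be a free ultrafilter on the natural numbers. A sequence of initial data, one for each \<open>N\<close>, is
  distributed according to the Loeb measure of \<open>mu \<nu>\<close> along \<open>U\<close>. Almost surely the moment bounds hold
  for the discrete paths up to a random constant. Hence the limits along \<open>U\<close> of these paths exist, satisfy the
  Hoelder estimates, and are differentiable with the derivative prescribed by the equation.
  Events of the limit process are limits of events of the discrete processes, which are stationary with
  marginal \<open>mu \<nu>\<close>; so no tightness argument is needed.
\<close>

section \<open>Ultrafilters and the Loeb measure\<close>

text \<open>Under \<open>mu \<nu>\<close> the shells are independent with one common law, so a
  typical state has infinite energy and the equation comes with no flow on such states; this is why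
  invariance is secured exactly, at the discrete level. The regularity is dictated by two costs. A
  unit of time moves shell n by an amount of order \<open>k n\<close>, which is the one derivative
  lost in the norm of order -1 - \<alpha>. One random constant for all shells at once comes from
  summing moments with weights 1/n^2; the resulting powers of n are paid for by \<alpha> > 0.
  Moments of order p give the Hoelder exponent 1 - 1/p, hence every \<gamma> < 1. Although the
  number of rotations in a step grows with N, the number of those that move a given shell is bounded
  independently of N, and so are the estimates for that shell. Negative times are reached by
  starting the N-th path at time -(N + 1); invariance of the law makes the starting time
  invisible.\<close>

definition ultra :: "'i filter \<Rightarrow> bool" where
  "ultra U \<longleftrightarrow> U \<noteq> bot \<and> (\<forall>P. eventually P U \<or> eventually (\<lambda>x. \<not> P x) U)"

text \<open>Finer filters are smaller in the order of filters, so ultrafilters are the minimal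
  proper filters and Zorn's lemma is applied downwards.\<close>

lemma ultra_exists:
  assumes "F0 \<noteq> (bot :: 'i filter)"
  shows "\<exists>U. ultra U \<and> U \<le> F0"
proof -
  let ?A = "{F. F \<noteq> bot \<and> F \<le> F0}"
  let ?P = "\<lambda>F G :: 'i filter. G \<le> F"
  have "\<exists>m\<in>?A. \<forall>a\<in>?A. ?P m a \<longrightarrow> a = m"
  proof (rule predicate_Zorn)
    show "partial_order_on ?A (relation_of ?P ?A)"
      by (rule partial_order_on_relation_ofI) auto
  next
    fix C assume C: "C \<in> Chains (relation_of ?P ?A)"
    show "\<exists>u\<in>?A. \<forall>a\<in>C. ?P a u"
    proof (cases "C = {}")
      case True
      then show ?thesis using assms by auto
    next
      case False
      have sub: "C \<subseteq> ?A" and tot: "\<And>F G. F \<in> C \<Longrightarrow> G \<in> C \<Longrightarrow> F \<le> G \<or> G \<le> F"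
        using C unfolding Chains_def relation_of_def by auto
      \<comment> \<open>The infimum over a nonempty chain is directed: what holds eventually for it
        holds eventually for some member, so it is proper.\<close>
      have "eventually P (Inf C) \<longleftrightarrow> (\<exists>b\<in>C. eventually P b)" for P
        by (rule eventually_Inf_base[OF False]) (metis inf.absorb1 inf.absorb2 order_refl tot)
      from this[of "\<lambda>_. False"] have "Inf C \<noteq> bot"
        using sub by (auto simp: trivial_limit_def)
      moreover have "Inf C \<le> F0"
        using False sub by (auto intro: Inf_lower2)
      ultimately show ?thesis by (auto intro!: bexI[of _ "Inf C"] Inf_lower)
    qed
  qed
  then obtain m where m: "m \<noteq> bot" "m \<le> F0" "\<And>a. a \<noteq> bot \<Longrightarrow> a \<le> m \<Longrightarrow> a = m"
    by (auto intro: order_trans)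
  have "eventually P m \<or> eventually (\<lambda>x. \<not> P x) m" for P
  proof (rule ccontr)
    assume n: "\<not> ?thesis"
    \<comment> \<open>Cutting m down to P leaves a proper filter unless the complement of P is
      eventual; minimality then gives m back.\<close>
    let ?G = "inf m (principal {x. P x})"
    have "?G \<noteq> bot"
      using n by (auto simp: trivial_limit_def eventually_inf_principal)
    then have "?G = m" using m(3)[of ?G] by auto
    moreover have "eventually P ?G" by (simp add: eventually_inf_principal)
    ultimately show False using n by simp
  qed
  with m show ?thesis unfolding ultra_def by blast
qed

lemma ultra_tendsto_compact:
  fixes f :: "'i \<Rightarrow> 'a::topological_space"
  assumes U: "ultra U" and K: "compact K" "eventually (\<lambda>x. f x \<in> K) U"
  shows "\<exists>l\<in>K. (f \<longlongrightarrow> l) U"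
proof -
  have "filtermap f U \<noteq> bot" using U by (simp add: ultra_def filtermap_bot_iff)
  moreover have "eventually (\<lambda>x. x \<in> K) (filtermap f U)" using K by (simp add: eventually_filtermap)
  ultimately obtain l where l: "l \<in> K" "inf (nhds l) (filtermap f U) \<noteq> bot"
    using K(1) unfolding compact_filter by blast
  have "eventually (\<lambda>x. f x \<in> S) U" if "open S" "l \<in> S" for S
  proof (rule ccontr)
    assume "\<not> ?thesis"
    then have "eventually (\<lambda>x. f x \<notin> S) U" using U by (auto simp: ultra_def)
    then have "eventually (\<lambda>y. y \<notin> S) (filtermap f U)" by (simp add: eventually_filtermap)
    moreover have "eventually (\<lambda>y. y \<in> S) (nhds l)" using that by (auto simp: eventually_nhds)
    ultimately have "eventually (\<lambda>_. False) (inf (nhds l) (filtermap f U))"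
      by (auto simp: eventually_inf)
    with l(2) show False by (simp add: trivial_limit_def)
  qed
  then show ?thesis using l(1) by (auto simp: tendsto_def)
qed

lemma ultra_tendsto_bounded:
  fixes f :: "'i \<Rightarrow> 'a::heine_borel"
  assumes U: "ultra U" and K: "bounded K" "eventually (\<lambda>x. f x \<in> K) U"
  shows "(f \<longlongrightarrow> Lim U f) U"
proof -
  have "eventually (\<lambda>x. f x \<in> closure K) U"
    using K(2) by eventually_elim (use closure_subset in auto)
  then obtain l where "(f \<longlongrightarrow> l) U"
    using ultra_tendsto_compact[OF U, of "closure K"] K(1) by auto
  then show ?thesis using U by (metis tendsto_Lim ultra_def)
qed

text \<open>\<open>pr N\<close> reads the N-th initial datum off a sample point. Only surjectivity
  onto sequences of data is asked for, so the type of sample points stays free; the theorem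
  prescribes it.\<close>

locale loeb =
  fixes U :: "nat filter" and P :: "nat \<Rightarrow> 'a measure" and pr :: "nat \<Rightarrow> 'w \<Rightarrow> 'a"
  assumes U: "ultra U" and U_seq: "U \<le> sequentially"
    and P: "\<And>N. prob_space (P N)"
    and pr: "\<And>f. \<exists>w. \<forall>N. pr N w = f N"
begin

lemma U_bot [simp]: "U \<noteq> bot"
  using U by (simp add: ultra_def)

lemma ev_not: "\<not> eventually Q U \<longleftrightarrow> eventually (\<lambda>N. \<not> Q N) U"
proof
  assume n: "eventually (\<lambda>N. \<not> Q N) U"
  show "\<not> eventually Q U"
  proof
    assume "eventually Q U"
    with n have "eventually (\<lambda>_. False) U" by eventually_elim simp
    then show False by (simp add: trivial_limit_def[symmetric])
  qed
qed (use U in \<open>auto simp: ultra_def\<close>)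

lemma ev_ge: "eventually (\<lambda>N. k \<le> N) U"
  using U_seq eventually_ge_at_top by (auto simp: le_filter_def)

text \<open>These are the internal sets of the ultraproduct, pulled back along \<open>pr\<close>. By
  the ultrafilter property, passing from A to \<open>iset A\<close> commutes with all finite Boolean
  operations.\<close>

definition iset :: "(nat \<Rightarrow> 'a set) \<Rightarrow> 'w set" where
  "iset A = {w. eventually (\<lambda>N. pr N w \<in> A N) U}"

definition isets :: "'w set set" where
  "isets = iset ` {A. \<forall>N. A N \<in> sets (P N)}"

abbreviation "Om \<equiv> iset (\<lambda>N. space (P N))"

lemma iset_Int: "iset A \<inter> iset B = iset (\<lambda>N. A N \<inter> B N)"
  by (auto simp: iset_def eventually_conj_iff)

lemma iset_Diff: "iset A - iset B = iset (\<lambda>N. A N - B N)"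
  by (simp add: set_eq_iff iset_def ev_not eventually_conj_iff)

lemma iset_Un: "iset A \<union> iset B = iset (\<lambda>N. A N \<union> B N)"
proof -
  have "eventually (\<lambda>N. Q N \<or> R N) U \<longleftrightarrow> eventually Q U \<or> eventually R U" for Q R :: "nat \<Rightarrow> bool"
    using ev_not[of "\<lambda>N. Q N \<or> R N"] ev_not[of Q] ev_not[of R] by (auto simp: eventually_conj_iff)
  then show ?thesis by (auto simp: iset_def)
qed

lemma iset_empty: "iset (\<lambda>_. {}) = {}"
  by (simp add: iset_def)

text \<open>An internal set determines its sections up to U: if inclusion failed for U-almost all N,
  a sample point whose N-th coordinate lies in \<open>A N - B N\<close> for those N, supplied by
  \<open>pr\<close>, would separate the two sets. Hence \<open>cont\<close> below does not depend on
  the representative picked by \<open>SOME\<close>.\<close>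

lemma iset_subset_iff: "iset A \<subseteq> iset B \<longleftrightarrow> eventually (\<lambda>N. A N \<subseteq> B N) U"
proof
  assume "eventually (\<lambda>N. A N \<subseteq> B N) U"
  then show "iset A \<subseteq> iset B"
    unfolding iset_def by (auto elim: eventually_elim2)
next
  assume sub: "iset A \<subseteq> iset B"
  show "eventually (\<lambda>N. A N \<subseteq> B N) U"
  proof (rule ccontr)
    assume "\<not> ?thesis"
    then have ev: "eventually (\<lambda>N. \<not> A N \<subseteq> B N) U" by (simp add: ev_not)
    obtain w where w: "\<And>N. pr N w = (SOME x. x \<in> A N - B N)"
      using pr[of "\<lambda>N. SOME x. x \<in> A N - B N"] by blast
    from ev have "eventually (\<lambda>N. pr N w \<in> A N - B N) U"
    proof eventually_elim
      case (elim N)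
      then have "\<exists>x. x \<in> A N - B N" by auto
      from someI_ex[OF this] show ?case unfolding w .
    qed
    then have "w \<in> iset A - iset B" by (simp add: iset_Diff) (simp add: iset_def)
    with sub show False by blast
  qed
qed

lemma iset_eq_iff: "iset A = iset B \<longleftrightarrow> eventually (\<lambda>N. A N = B N) U"
  by (auto simp: set_eq_subset iset_subset_iff eventually_conj_iff)

lemma isets_algebra: "algebra Om isets"
proof (unfold algebra_iff_Un, intro conjI ballI)
  show "isets \<subseteq> Pow Om"
  proof safe
    fix s w assume "s \<in> isets" "w \<in> s"
    then obtain A where A: "s = iset A" "\<And>N. A N \<in> sets (P N)" by (auto simp: isets_def)
    have "iset A \<subseteq> Om"
      unfolding iset_subset_iff by (rule always_eventually) (use A(2) sets.sets_into_space in blast)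
    with A \<open>w \<in> s\<close> show "w \<in> Om" by blast
  qed
  show "{} \<in> isets" unfolding isets_def using iset_empty by (auto intro!: image_eqI[of _ _ "\<lambda>_. {}"])
  fix a assume "a \<in> isets"
  then obtain A where A: "a = iset A" "\<And>N. A N \<in> sets (P N)" by (auto simp: isets_def)
  then show "Om - a \<in> isets" unfolding isets_def A(1) iset_Diff by (intro imageI) auto
  fix b assume "b \<in> isets"
  then obtain B where B: "b = iset B" "\<And>N. B N \<in> sets (P N)" by (auto simp: isets_def)
  show "a \<union> b \<in> isets" unfolding isets_def A(1) B(1) iset_Un by (intro imageI) (use A B in auto)
qed

lemma isets_Pow: "isets \<subseteq> Pow Om"
  using isets_algebra by (simp add: algebra_iff_Un)

lemma meas_lim:
  "((\<lambda>N. measure (P N) (A N)) \<longlongrightarrow> Lim U (\<lambda>N. measure (P N) (A N))) U"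
proof (rule ultra_tendsto_bounded[OF U, of "{0..1}"])
  show "\<forall>\<^sub>F N in U. measure (P N) (A N) \<in> {0..1}"
    using prob_space.prob_le_1[OF P] by (auto intro!: always_eventually)
qed auto

definition cont :: "'w set \<Rightarrow> ennreal" where
  "cont s = ennreal (Lim U (\<lambda>N. measure (P N) ((SOME A. s = iset A \<and> (\<forall>N. A N \<in> sets (P N))) N)))"

lemma Lim_eventually_cong: "eventually (\<lambda>N. f N = g N) U \<Longrightarrow> Lim U f = Lim U g"
  unfolding Topological_Spaces.Lim_def by (simp only: tendsto_cong)

lemma cont_iset:
  assumes "\<And>N. A N \<in> sets (P N)"
  shows "cont (iset A) = ennreal (Lim U (\<lambda>N. measure (P N) (A N)))"
proof -
  define B where "B = (SOME B. iset A = iset B \<and> (\<forall>N. B N \<in> sets (P N)))"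
  have "iset A = iset B \<and> (\<forall>N. B N \<in> sets (P N))"
    unfolding B_def
    by (rule someI_ex[of "\<lambda>B. iset A = iset B \<and> (\<forall>N. B N \<in> sets (P N))"]) (use assms in blast)
  then have "eventually (\<lambda>N. A N = B N) U" by (simp add: iset_eq_iff)
  then have "eventually (\<lambda>N. measure (P N) (A N) = measure (P N) (B N)) U"
    by eventually_elim simp
  then show ?thesis unfolding cont_def B_def[symmetric] by (simp only: Lim_eventually_cong)
qed

lemma Lim_nonneg: "0 \<le> Lim U (\<lambda>N. measure (P N) (A N))"
  by (rule tendsto_lowerbound[OF meas_lim]) auto

text \<open>Countable saturation: a decreasing sequence of nonempty internal sets has a common point,
  obtained diagonally by choosing in its N-th component a point of as many sets as possible.\<close>
lemma saturation:
  assumes A: "decseq (\<lambda>i. iset (A i))" and ne: "\<And>i. iset (A i) \<noteq> {}"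
  shows "(\<Inter>i. iset (A i)) \<noteq> {}"
proof -
  \<comment> \<open>The sets are known to decrease only after passing to \<open>iset\<close>. Finite
    intersections decrease at every single N and define the same internal sets.\<close>
  let ?C = "\<lambda>i N. \<Inter>j\<le>i. A j N"
  have "iset (?C i) = iset (A i)" for i
  proof (induction i)
    case (Suc i)
    have "iset (?C (Suc i)) = iset (?C i) \<inter> iset (A (Suc i))"
      unfolding iset_Int by (rule arg_cong[of _ _ iset], rule ext) (simp add: atMost_Suc Int_commute)
    also have "\<dots> = iset (A i) \<inter> iset (A (Suc i))"
      by (simp only: Suc)
    also have "\<dots> = iset (A (Suc i))" using A by (auto simp: decseq_Suc_iff)
    finally show ?case .
  qed auto
  then have C: "eventually (\<lambda>N. ?C i N \<noteq> {}) U" for i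
    using ne[of i] iset_eq_iff[of "?C i" "\<lambda>_. {}"] ev_not[of "\<lambda>N. ?C i N = {}"] by (simp add: iset_empty)
  \<comment> \<open>The bound \<open>i \<le> N\<close> keeps the maximum finite and holds for
    U-almost all N at each fixed i, as U refines \<open>sequentially\<close>; the 0 keeps the set
    nonempty.\<close>
  define m where "m N = Max ({0} \<union> {i. i \<le> N \<and> ?C i N \<noteq> {}})" for N
  obtain w where w: "\<And>N. pr N w = (SOME x. x \<in> ?C (m N) N)"
    using pr[of "\<lambda>N. SOME x. x \<in> ?C (m N) N"] by blast
  have "w \<in> iset (A i)" for i
    unfolding iset_def mem_Collect_eq
    using C[of i] ev_ge[of i]
  proof eventually_elim
    case (elim N)
    let ?S = "{0} \<union> {i. i \<le> N \<and> ?C i N \<noteq> {}}"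
    have fin: "finite ?S" by (auto intro: finite_subset[of _ "{..N}"])
    have "i \<in> ?S" using elim by auto
    then have i: "i \<le> m N" unfolding m_def by (intro Max_ge fin)
    have "m N \<in> ?S" unfolding m_def by (rule Max_in[OF fin]) auto
    moreover have "?C 0 N \<noteq> {}" using elim(1) by auto
    ultimately have "?C (m N) N \<noteq> {}" by auto
    then have "\<exists>x. x \<in> ?C (m N) N" by blast
    from someI_ex[OF this] have "pr N w \<in> ?C (m N) N" unfolding w .
    then show ?case using i by auto
  qed
  then show ?thesis by blast
qed

text \<open>Continuity at the empty set, the analytic condition in Caratheodory's theorem, is
  trivial here: by saturation, a decreasing sequence of internal sets with empty intersection is
  already empty from some index on.\<close>

lemma loeb_extension:
  "\<exists>\<mu>. (\<forall>s\<in>isets. \<mu> s = cont s) \<and> measure_space Om (sigma_sets Om isets) \<mu>"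
proof -
  interpret algebra Om isets by (rule isets_algebra)
  have Lim0: "Lim U (\<lambda>_. 0::real) = 0" by (intro tendsto_Lim) auto
  show ?thesis
  proof (rule caratheodory_empty_continuous)
    show "positive isets cont"
      using cont_iset[of "\<lambda>_. {}"] Lim0 by (simp add: positive_def iset_empty)
    show "additive isets cont"
      unfolding additive_def
    proof (intro ballI impI)
      fix x y assume xy: "x \<in> isets" "y \<in> isets" "x \<inter> y = {}"
      then obtain A B where A: "x = iset A" "\<And>N. A N \<in> sets (P N)"
        and B: "y = iset B" "\<And>N. B N \<in> sets (P N)" by (auto simp: isets_def)
      have "eventually (\<lambda>N. A N \<inter> B N = {}) U"
        using xy(3) by (simp add: A B iset_Int iset_eq_iff flip: iset_empty)
      then have "eventually (\<lambda>N. measure (P N) (A N \<union> B N) = measure (P N) (A N) + measure (P N) (B N)) U"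
      proof eventually_elim
        case (elim N)
        interpret prob_space "P N" by (rule P)
        show ?case using elim A B by (simp add: finite_measure_Union)
      qed
      then have "Lim U (\<lambda>N. measure (P N) (A N \<union> B N)) =
          Lim U (\<lambda>N. measure (P N) (A N) + measure (P N) (B N))"
        by (rule Lim_eventually_cong)
      also have "\<dots> = Lim U (\<lambda>N. measure (P N) (A N)) + Lim U (\<lambda>N. measure (P N) (B N))"
        by (intro tendsto_Lim tendsto_add meas_lim) simp
      finally have "Lim U (\<lambda>N. measure (P N) (A N \<union> B N)) =
          Lim U (\<lambda>N. measure (P N) (A N)) + Lim U (\<lambda>N. measure (P N) (B N))" .
      then show "cont (x \<union> y) = cont x + cont y"
        unfolding A(1) B(1) iset_Un using A(2) B(2)
        by (simp add: cont_iset Lim_nonneg ennreal_plus)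
    qed
    show "cont A \<noteq> \<infinity>" for A unfolding cont_def by simp
    fix S :: "nat \<Rightarrow> 'w set"
    assume S: "range S \<subseteq> isets" "decseq S" "(\<Inter>i. S i) = {}"
    have "\<exists>A. S i = iset A" for i using S(1) unfolding isets_def by blast
    then obtain A where "\<And>i. S i = iset (A i)" by metis
    then have "S = (\<lambda>i. iset (A i))" by (rule ext)
    then have "\<exists>i. S i = {}" using saturation[of A] S(2,3) by blast
    then obtain i where "S i = {}" by blast
    then have "S j = {}" if "j \<ge> i" for j using S(2) that by (metis decseqD subset_empty)
    then have "eventually (\<lambda>j. cont (S j) = 0) sequentially"
      using cont_iset[of "\<lambda>_. {}"] Lim0
      by (auto simp: eventually_sequentially iset_empty intro!: exI[of _ i])
    then show "(\<lambda>i. cont (S i)) \<longlonglongrightarrow> 0" by (simp add: tendsto_eventually)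
  qed
qed

definition L :: "'w measure" where
  "L = measure_of Om isets (SOME \<mu>. (\<forall>s\<in>isets. \<mu> s = cont s) \<and> measure_space Om (sigma_sets Om isets) \<mu>)"

lemma space_L: "space L = Om"
  unfolding L_def by (rule space_measure_of[OF isets_Pow])

lemma sets_L: "sets L = sigma_sets Om isets"
  unfolding L_def by (rule sets_measure_of[OF isets_Pow])

lemma iset_sets [intro]: "(\<And>N. A N \<in> sets (P N)) \<Longrightarrow> iset A \<in> sets L"
  unfolding sets_L isets_def by blast

lemma emeasure_L_iset:
  assumes "\<And>N. A N \<in> sets (P N)"
  shows "emeasure L (iset A) = ennreal (Lim U (\<lambda>N. measure (P N) (A N)))"
proof -
  let ?\<mu> = "SOME \<mu>. (\<forall>s\<in>isets. \<mu> s = cont s) \<and> measure_space Om (sigma_sets Om isets) \<mu>"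
  have mu: "(\<forall>s\<in>isets. ?\<mu> s = cont s) \<and> measure_space Om (sigma_sets Om isets) ?\<mu>"
    by (rule someI_ex[OF loeb_extension])
  have "iset A \<in> isets" using assms by (auto simp: isets_def)
  then have "emeasure L (iset A) = ?\<mu> (iset A)"
    using mu by (intro emeasure_measure_of[OF L_def isets_Pow]) (auto simp: measure_space_def sets_L)
  then show ?thesis using mu \<open>iset A \<in> isets\<close> cont_iset[OF assms] by simp
qed

lemma measure_L_iset:
  assumes "\<And>N. A N \<in> sets (P N)"
  shows "measure L (iset A) = Lim U (\<lambda>N. measure (P N) (A N))"
  unfolding measure_def emeasure_L_iset[OF assms] using Lim_nonneg[of A] by (simp add: measure_def)

lemma prob_space_L: "prob_space L"
proof
  have "measure (P N) (space (P N)) = 1" for N using P by (simp add: prob_space.prob_space)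
  then show "emeasure L (space L) = 1"
    unfolding space_L by (subst emeasure_L_iset) (auto simp: tendsto_Lim)
qed

section \<open>Almost sure bounds and limit laws under the Loeb measure\<close>

sublocale L: prob_space L by (rule prob_space_L)

text \<open>Markov's inequality gives the internal events \<open>q N \<le> K + 1\<close> Loeb
  measure at least 1 - C/(K + 1), so their increasing union has measure 1. This is the passage from
  bounds in mean, uniform in N, to bounds along U for almost every sample point.\<close>

lemma AE_bounded:
  fixes q :: "nat \<Rightarrow> 'a \<Rightarrow> ennreal"
  assumes [measurable]: "\<And>N. q N \<in> borel_measurable (P N)"
    and C: "eventually (\<lambda>N. (\<integral>\<^sup>+x. q N x \<partial>P N) \<le> ennreal C) U" and "0 \<le> C"
  shows "AE w in L. \<exists>K>0. eventually (\<lambda>N. q N (pr N w) \<le> ennreal K) U"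
proof -
  define A where "A K N = {x\<in>space (P N). q N x \<le> ennreal (real (Suc K))}" for K N
  have A[measurable]: "A K N \<in> sets (P N)" for K N unfolding A_def by measurable
  have low: "1 - C / real (Suc K) \<le> measure L (iset (A K))" for K
    unfolding measure_L_iset[OF A]
  proof (rule tendsto_lowerbound[OF meas_lim])
    show "eventually (\<lambda>N. 1 - C / real (Suc K) \<le> measure (P N) (A K N)) U"
      using C
    proof eventually_elim
      case (elim N)
      interpret prob_space "P N" by (rule P)
      let ?c = "ennreal (1 / real (Suc K))"
      have c: "?c * ennreal (real (Suc K)) = 1"
        by (subst ennreal_mult'[symmetric]) auto
      have "space (P N) - A K N \<subseteq> {x\<in>space (P N). 1 \<le> ?c * q N x}"
      proof safe
        fix x assume "x \<in> space (P N)" "x \<notin> A K N"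
        then have "ennreal (real (Suc K)) \<le> q N x" by (auto simp: A_def)
        then have "?c * ennreal (real (Suc K)) \<le> ?c * q N x" by (intro mult_left_mono) auto
        then show "1 \<le> ?c * q N x" using c by simp
      qed
      then have "emeasure (P N) (space (P N) - A K N) \<le> emeasure (P N) {x\<in>space (P N). 1 \<le> ?c * q N x}"
        by (intro emeasure_mono) auto
      also have "\<dots> \<le> ?c * (\<integral>\<^sup>+x. q N x * indicator (space (P N)) x \<partial>P N)"
        by (rule nn_integral_Markov_inequality) auto
      also have "(\<integral>\<^sup>+x. q N x * indicator (space (P N)) x \<partial>P N) = (\<integral>\<^sup>+x. q N x \<partial>P N)"
        by (rule nn_integral_cong) auto
      also have "?c * (\<integral>\<^sup>+x. q N x \<partial>P N) \<le> ?c * ennreal C" by (intro mult_left_mono elim) auto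
      also have "\<dots> = ennreal (C / real (Suc K))" using \<open>0 \<le> C\<close> by (simp add: ennreal_mult'[symmetric])
      finally have "measure (P N) (space (P N) - A K N) \<le> C / real (Suc K)"
        using \<open>0 \<le> C\<close> by (simp add: emeasure_eq_measure)
      then show ?case by (subst (asm) prob_compl) auto
    qed
  qed auto
  have "(\<lambda>K. measure L (iset (A K))) \<longlonglongrightarrow> measure L (\<Union>K. iset (A K))"
  proof (rule L.finite_Lim_measure_incseq)
    show "incseq (\<lambda>K. iset (A K))"
      unfolding incseq_Suc_iff iset_subset_iff
    proof (intro allI always_eventually subsetI)
      fix k N x assume x: "x \<in> A k N"
      have "ennreal (real (Suc k)) \<le> ennreal (real (Suc (Suc k)))" by (intro ennreal_leI) simp
      then show "x \<in> A (Suc k) N" using x unfolding A_def by (auto intro: order_trans)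
    qed
  qed (use A in auto)
  moreover have "(\<lambda>K. 1 - C / real (Suc K)) \<longlonglongrightarrow> 1 - 0"
    by (intro tendsto_diff tendsto_const LIMSEQ_Suc[OF lim_const_over_n])
  ultimately have "1 - 0 \<le> measure L (\<Union>K. iset (A K))"
    by (intro LIMSEQ_le[of "\<lambda>K. 1 - C / real (Suc K)" _ "\<lambda>K. measure L (iset (A K))"]) (use low in auto)
  then have "measure L (\<Union>K. iset (A K)) = 1"
    using L.prob_le_1[of "\<Union>K. iset (A K)"] by linarith
  then have "AE w in L. w \<in> (\<Union>K. iset (A K))"
    by (rule L.AE_prob_1)
  then show ?thesis
  proof eventually_elim
    case (elim w)
    then obtain K where "w \<in> iset (A K)" by blast
    then show ?case by (intro exI[of _ "real (Suc K)"]) (auto simp: iset_def A_def elim: eventually_mono)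
  qed
qed

text \<open>A bound for a limit corresponds to internal events with every positive slack 1/(k + 1):
  the limit may equal the threshold while all approximations exceed it. The countable description
  carries both measurability and laws over to the limit.\<close>

lemma iset_le_subset:
  assumes "finite F" and c: "\<And>i. i \<in> F \<Longrightarrow> ((\<lambda>N. f i N (pr N w)) \<longlongrightarrow> X i) U" and w: "w \<in> Om"
  shows "(\<forall>i\<in>F. X i \<le> c i) \<longleftrightarrow>
    (\<forall>k::nat. w \<in> iset (\<lambda>N. {x\<in>space (P N). \<forall>i\<in>F. f i N x \<le> c i + 1 / real (Suc k)}))"
    (is "_ \<longleftrightarrow> (\<forall>k. w \<in> ?S k)")
proof
  assume X: "\<forall>i\<in>F. X i \<le> c i"
  show "\<forall>k. w \<in> ?S k"
  proof
    fix k
    have "eventually (\<lambda>N. \<forall>i\<in>F. f i N (pr N w) < c i + 1 / real (Suc k)) U"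
    proof (intro eventually_ball_finite assms(1) ballI)
      fix i assume "i \<in> F"
      then have "X i < c i + 1 / real (Suc k)" using X by (auto intro: le_less_trans[of _ "c i"])
      with c[OF \<open>i \<in> F\<close>] show "eventually (\<lambda>N. f i N (pr N w) < c i + 1 / real (Suc k)) U"
        by (rule order_tendstoD)
    qed
    moreover have "eventually (\<lambda>N. pr N w \<in> space (P N)) U" using w by (simp add: iset_def)
    ultimately have "eventually (\<lambda>N. pr N w \<in> {x\<in>space (P N). \<forall>i\<in>F. f i N x \<le> c i + 1 / real (Suc k)}) U"
      by eventually_elim (auto intro: less_imp_le)
    then show "w \<in> ?S k" by (simp only: iset_def mem_Collect_eq)
  qed
next
  assume S: "\<forall>k. w \<in> ?S k"
  show "\<forall>i\<in>F. X i \<le> c i"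
  proof
    fix i assume i: "i \<in> F"
    have "X i \<le> c i + 1 / real (Suc k)" for k
    proof (rule tendsto_upperbound[OF c[OF i]])
      have "eventually (\<lambda>N. pr N w \<in> {x\<in>space (P N). \<forall>i\<in>F. f i N x \<le> c i + 1 / real (Suc k)}) U"
        using S[rule_format, of k] by (simp only: iset_def mem_Collect_eq)
      then show "eventually (\<lambda>N. f i N (pr N w) \<le> c i + 1 / real (Suc k)) U"
        by eventually_elim (use i in auto)
    qed simp
    moreover have "(\<lambda>k. c i + 1 / real (Suc k)) \<longlonglongrightarrow> c i + 0"
      by (intro tendsto_add tendsto_const LIMSEQ_Suc[OF lim_const_over_n])
    ultimately show "X i \<le> c i" using LIMSEQ_le_const[of _ "c i + 0" "X i"] by auto
  qed
qed

lemma limit_measurable: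
  fixes X :: "'w \<Rightarrow> real"
  assumes f[measurable]: "\<And>N. f N \<in> borel_measurable (P N)" and G[measurable]: "G \<in> sets L"
    and lim: "\<And>w. w \<in> G \<Longrightarrow> ((\<lambda>N. f N (pr N w)) \<longlongrightarrow> X w) U"
  shows "(\<lambda>w. if w \<in> G then X w else z) \<in> borel_measurable L"
  unfolding borel_measurable_iff_le
proof
  fix c
  let ?S = "\<lambda>k::nat. iset (\<lambda>N. {x\<in>space (P N). f N x \<le> c + 1 / real (Suc k)})"
  have [measurable]: "?S k \<in> sets L" for k by (rule iset_sets) measurable
  have "{w \<in> space L. (if w \<in> G then X w else z) \<le> c} =
      (G \<inter> (\<Inter>k. ?S k)) \<union> ((space L - G) \<inter> (if z \<le> c then space L else {}))"
  proof -
    have "X w \<le> c \<longleftrightarrow> (\<forall>k. w \<in> ?S k)" if "w \<in> G" for w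
      using iset_le_subset[of "{()}" "\<lambda>_. f" w "\<lambda>_. X w" "\<lambda>_. c"] lim[OF that]
        sets.sets_into_space[OF G] that space_L by auto
    then show ?thesis using sets.sets_into_space[OF G] by auto
  qed
  also have "\<dots> \<in> sets L" by measurable
  finally show "{w \<in> space L. (if w \<in> G then X w else z) \<le> c} \<in> sets L" .
qed

text \<open>For a fixed slack the Loeb measure of the internal event is a limit along U; continuity
  from above then sends the slack to 0.\<close>

lemma law_limit:
  assumes F: "finite F" and f[measurable]: "\<And>i N. i \<in> F \<Longrightarrow> f i N \<in> borel_measurable (P N)"
    and X[measurable]: "\<And>i. i \<in> F \<Longrightarrow> X i \<in> borel_measurable L"
    and lim: "AE w in L. \<forall>i\<in>F. ((\<lambda>N. f i N (pr N w)) \<longlongrightarrow> X i w) U"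
  shows "(\<lambda>k. Lim U (\<lambda>N. measure (P N) {x\<in>space (P N). \<forall>i\<in>F. f i N x \<le> c i + 1 / real (Suc k)})) \<longlonglongrightarrow>
     measure L {w\<in>space L. \<forall>i\<in>F. X i w \<le> c i}"
proof -
  let ?B = "\<lambda>(k::nat) N. {x\<in>space (P N). \<forall>i\<in>F. f i N x \<le> c i + 1 / real (Suc k)}"
  have B: "?B k N \<in> sets (P N)" for k N
    using F by measurable
  have S[measurable]: "iset (?B k) \<in> sets L" for k by (rule iset_sets) (rule B)
  have "(\<lambda>k. measure L (iset (?B k))) \<longlonglongrightarrow> measure L (\<Inter>k. iset (?B k))"
  proof (rule L.finite_Lim_measure_decseq)
    show "decseq (\<lambda>k. iset (?B k))"
      unfolding decseq_Suc_iff iset_subset_iff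
    proof (intro allI always_eventually subsetI)
      fix k N x assume x: "x \<in> ?B (Suc k) N"
      have "1 / real (Suc (Suc k)) \<le> 1 / real (Suc k)" by (simp add: frac_le)
      then have "c i + 1 / real (Suc (Suc k)) \<le> c i + 1 / real (Suc k)" for i by simp
      then show "x \<in> ?B k N" using x by (blast intro: order_trans)
    qed
  qed (use S in blast)
  also have "measure L (\<Inter>k. iset (?B k)) = measure L {w\<in>space L. \<forall>i\<in>F. X i w \<le> c i}"
  proof (rule L.finite_measure_eq_AE)
    show "AE x in L. (x \<in> (\<Inter>k. iset (?B k))) = (x \<in> {w \<in> space L. \<forall>i\<in>F. X i w \<le> c i})"
      using lim AE_space
    proof eventually_elim
      case (elim w)
      then show ?case using iset_le_subset[OF F, of f w "\<lambda>i. X i w" c] space_L by auto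
    qed
    show "{w \<in> space L. \<forall>i\<in>F. X i w \<le> c i} \<in> sets L" using F by measurable
  qed measurable
  finally show ?thesis by (simp only: measure_L_iset[OF B])
qed

end

section \<open>Limits of discrete paths along an ultrafilter\<close>

lemma sum_power_le:
  fixes f :: "'i \<Rightarrow> real"
  assumes "finite A" and f: "\<And>i. i \<in> A \<Longrightarrow> 0 \<le> f i" and p: "1 \<le> p"
  shows "(\<Sum>i\<in>A. f i) ^ p \<le> real (card A) ^ (p - 1) * (\<Sum>i\<in>A. f i ^ p)"
proof (cases "A = {}")
  case True
  then show ?thesis using p by (simp add: power_0_left)
next
  case False
  let ?c = "real (card A)"
  have c: "?c > 0" using False assms(1) by (simp add: card_gt_0_iff)
  have "convex_on {0::real..} (\<lambda>x. x ^ p)"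
    by (cases "even p") (auto intro: convex_power_odd convex_on_subset[OF convex_power_even])
  then have "(\<Sum>i\<in>A. (1 / ?c) *\<^sub>R f i) ^ p \<le> (\<Sum>i\<in>A. (1 / ?c) * f i ^ p)"
    by (rule convex_on_sum[OF assms(1) False]) (use c f in auto)
  then have "(\<Sum>i\<in>A. f i) ^ p / ?c ^ p \<le> (\<Sum>i\<in>A. f i ^ p) / ?c"
    by (simp add: sum_divide_distrib[symmetric] power_divide)
  then have "(\<Sum>i\<in>A. f i) ^ p \<le> (\<Sum>i\<in>A. f i ^ p) / ?c * ?c ^ p"
    using c by (simp add: pos_divide_le_eq)
  also have "\<dots> = ?c ^ (p - 1) * (\<Sum>i\<in>A. f i ^ p)"
    using c p by (simp add: power_eq_if[of _ p])
  finally show ?thesis .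
qed

lemma int_telescope:
  fixes g :: "int \<Rightarrow> 'a::ab_group_add"
  assumes "i \<le> j"
  shows "(\<Sum>l\<in>{i..<j}. g (l + 1) - g l) = g j - g i"
  using assms
proof (induction j rule: int_ge_induct)
  case (step j)
  have "{i..<j + 1} = insert j {i..<j}" using step by auto
  then show ?case using step by simp
qed simp

lemma summable_power_geometric:
  fixes q :: real
  assumes "0 \<le> q" "q < 1"
  shows "summable (\<lambda>n. real n ^ 4 * q ^ n)"
proof -
  \<comment> \<open>Half of the decay, r^4 to the power n, absorbs n^4 because
    \<open>n * r ^ n\<close> is bounded; the other half is a convergent geometric series.\<close>
  define r where "r = root 8 q"
  have r: "0 \<le> r" "r < 1" "q = r ^ 8" using assms unfolding r_def by auto
  have "(\<lambda>n. real n * r ^ n) \<longlonglongrightarrow> 0" using r by (intro powser_times_n_limit_0) auto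
  then have "Bseq (\<lambda>n. real n * r ^ n)" by (auto intro: convergent_imp_Bseq convergentI)
  then obtain C where C: "\<And>n. \<bar>real n * r ^ n\<bar> \<le> C" by (auto simp: Bseq_def)
  show ?thesis
  proof (rule summable_comparison_test'[of "\<lambda>n. C ^ 4 * (r ^ 4) ^ n" 0])
    show "summable (\<lambda>n. C ^ 4 * (r ^ 4) ^ n)"
      using r by (intro summable_mult summable_geometric) (auto simp: power_less_one_iff)
    fix n :: nat
    have "real n ^ 4 * q ^ n = (real n * r ^ n) ^ 4 * (r ^ 4) ^ n"
      unfolding r(3) power_mult_distrib power_mult[symmetric] power_add[symmetric] mult.assoc
      by (simp add: algebra_simps power_add[symmetric])
    also have "\<dots> \<le> C ^ 4 * (r ^ 4) ^ n"
      using C[of n] r by (intro mult_right_mono power_mono) auto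
    finally show "norm (real n ^ 4 * q ^ n) \<le> C ^ 4 * (r ^ 4) ^ n" using assms by simp
  qed
qed

lemma norm_mult_diff_le:
  fixes x y x' y' :: "'a::real_normed_algebra"
  assumes "norm (x - x') \<le> \<delta>" "norm (y - y') \<le> \<delta>" "norm y \<le> M" "norm x' \<le> M" "0 \<le> M" "0 \<le> \<delta>"
  shows "norm (x * y - x' * y') \<le> 2 * (M * \<delta>)"
proof -
  have "x * y - x' * y' = (x - x') * y + x' * (y - y')" by (simp add: algebra_simps)
  also have "norm \<dots> \<le> norm (x - x') * norm y + norm x' * norm (y - y')"
    by (intro norm_triangle_le add_mono norm_mult_ineq)
  also have "\<dots> \<le> \<delta> * M + M * \<delta>" using assms by (intro add_mono mult_mono) auto
  finally show ?thesis by (simp add: algebra_simps)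
qed

text \<open>Each term of \<open>sabraB\<close> at n is a product of two shells with numbers at most
  n + 2, so its variation is at most a size M times a difference \<delta>, up to the coefficients
  and the factor 2.\<close>

lemma sabraB_Lipschitz:
  "\<exists>C\<ge>0. \<forall>u v M \<delta>. (\<forall>m. 1 \<le> m \<and> m \<le> n + 2 \<longrightarrow> cmod (u m) \<le> M \<and> cmod (v m) \<le> M \<and> cmod (u m - v m) \<le> \<delta>) \<longrightarrow>
     cmod (sabraB k0 lam a b u u n - sabraB k0 lam a b v v n) \<le> C * (M * \<delta>)"
proof -
  let ?c1 = "a * shell_k k0 lam (n + 1)" and ?c2 = "b * shell_k k0 lam n"
  let ?c3 = "a * shell_k k0 lam (n - 1)" and ?c4 = "b * shell_k k0 lam (n - 1)"
  let ?C = "2 * (\<bar>?c1\<bar> + \<bar>?c2\<bar> + \<bar>?c3\<bar> + \<bar>?c4\<bar>)"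
  have "cmod (sabraB k0 lam a b u u n - sabraB k0 lam a b v v n) \<le> ?C * (M * \<delta>)"
    if h: "\<And>m. 1 \<le> m \<Longrightarrow> m \<le> n + 2 \<Longrightarrow> cmod (u m) \<le> M \<and> cmod (v m) \<le> M \<and> cmod (u m - v m) \<le> \<delta>"
    for u v M \<delta>
  proof -
    have nn: "0 \<le> M" "0 \<le> \<delta>"
      using h[of 1] norm_ge_zero[of "u 1"] norm_ge_zero[of "u 1 - v 1"] by linarith+
    have s: "cmod (sh u j) \<le> M" "cmod (sh v j) \<le> M" "cmod (sh u j - sh v j) \<le> \<delta>"
      if "j \<le> int n + 2" for j
      using h[of "nat j"] nn that by (auto simp: sh_def le_nat_iff nat_le_iff)
    have cs: "cmod (cnj (sh u j) - cnj (sh v j)) \<le> \<delta>" if "j \<le> int n + 2" for j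
      using s(3)[OF that] by (metis complex_cnj_diff complex_mod_cnj)
    have p1: "cmod (cnj (sh u i) * sh u j - cnj (sh v i) * sh v j) \<le> 2 * (M * \<delta>)"
      if "i \<le> int n + 2" "j \<le> int n + 2" for i j
      by (rule norm_mult_diff_le) (use s cs nn that in auto)
    have p2: "cmod (sh u i * sh u j - sh v i * sh v j) \<le> 2 * (M * \<delta>)"
      if "i \<le> int n + 2" "j \<le> int n + 2" for i j
      by (rule norm_mult_diff_le) (use s nn that in auto)
    have tri: "cmod (x1 + x2 + x3 + x4) \<le> e1 + e2 + e3 + e4"
      if "cmod x1 \<le> e1" "cmod x2 \<le> e2" "cmod x3 \<le> e3" "cmod x4 \<le> e4" for x1 x2 x3 x4 e1 e2 e3 e4
      using norm_triangle_ineq[of "x1 + x2 + x3" x4] norm_triangle_ineq[of "x1 + x2" x3]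
        norm_triangle_ineq[of x1 x2] that by linarith
    have m: "cmod (of_real c * z) \<le> \<bar>c\<bar> * (2 * (M * \<delta>))" if "cmod z \<le> 2 * (M * \<delta>)" for c z
      using that by (simp add: norm_mult mult_left_mono)
    have eq: "sabraB k0 lam a b u u n - sabraB k0 lam a b v v n =
       - \<i> * (of_real ?c1 * (cnj (sh u (int n + 1)) * sh u (int n + 2) - cnj (sh v (int n + 1)) * sh v (int n + 2))
          + of_real ?c2 * (cnj (sh u (int n - 1)) * sh u (int n + 1) - cnj (sh v (int n - 1)) * sh v (int n + 1))
          + of_real ?c3 * (sh u (int n - 1) * sh u (int n - 2) - sh v (int n - 1) * sh v (int n - 2))
          + of_real ?c4 * (sh u (int n - 2) * sh u (int n - 1) - sh v (int n - 2) * sh v (int n - 1)))"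
      unfolding sabraB_def by (simp add: algebra_simps)
    have "cmod (sabraB k0 lam a b u u n - sabraB k0 lam a b v v n) = cmod (of_real ?c1 * (cnj (sh u (int n + 1)) * sh u (int n + 2) - cnj (sh v (int n + 1)) * sh v (int n + 2))
          + of_real ?c2 * (cnj (sh u (int n - 1)) * sh u (int n + 1) - cnj (sh v (int n - 1)) * sh v (int n + 1))
          + of_real ?c3 * (sh u (int n - 1) * sh u (int n - 2) - sh v (int n - 1) * sh v (int n - 2))
          + of_real ?c4 * (sh u (int n - 2) * sh u (int n - 1) - sh v (int n - 2) * sh v (int n - 1)))"
      unfolding eq by (simp only: norm_mult norm_minus_cancel norm_ii mult_1)
    also have "\<dots> \<le> \<bar>?c1\<bar> * (2 * (M * \<delta>)) + \<bar>?c2\<bar> * (2 * (M * \<delta>)) + \<bar>?c3\<bar> * (2 * (M * \<delta>)) + \<bar>?c4\<bar> * (2 * (M * \<delta>))"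
    proof (rule tri)
      show "cmod (of_real ?c1 * (cnj (sh u (int n + 1)) * sh u (int n + 2) - cnj (sh v (int n + 1)) * sh v (int n + 2)))
          \<le> \<bar>?c1\<bar> * (2 * (M * \<delta>))" by (rule m, rule p1) simp_all
      show "cmod (of_real ?c2 * (cnj (sh u (int n - 1)) * sh u (int n + 1) - cnj (sh v (int n - 1)) * sh v (int n + 1)))
          \<le> \<bar>?c2\<bar> * (2 * (M * \<delta>))" by (rule m, rule p1) simp_all
      show "cmod (of_real ?c3 * (sh u (int n - 1) * sh u (int n - 2) - sh v (int n - 1) * sh v (int n - 2)))
          \<le> \<bar>?c3\<bar> * (2 * (M * \<delta>))" by (rule m, rule p2) simp_all
      show "cmod (of_real ?c4 * (sh u (int n - 2) * sh u (int n - 1) - sh v (int n - 2) * sh v (int n - 1)))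
          \<le> \<bar>?c4\<bar> * (2 * (M * \<delta>))" by (rule m, rule p2) simp_all
    qed
    also have "\<dots> = ?C * (M * \<delta>)" by algebra
    finally show ?thesis .
  qed
  then show ?thesis by (intro exI[of _ ?C] conjI) auto
qed

lemma tendsto_sabraB:
  assumes "\<And>m. 1 \<le> m \<Longrightarrow> ((\<lambda>x. f x m) \<longlongrightarrow> l m) F"
  shows "((\<lambda>x. sabraB k0 lam a b (f x) (f x) n) \<longlongrightarrow> sabraB k0 lam a b l l n) F"
proof -
  have [tendsto_intros]: "((\<lambda>x. sh (f x) j) \<longlongrightarrow> sh l j) F" for j
    using assms[of "nat j"] by (auto simp: sh_def le_nat_iff)
  show ?thesis unfolding sabraB_def by (intro tendsto_intros)
qed

section \<open>Existence and continuity of the limit path\<close>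

abbreviation tick :: "real \<Rightarrow> nat \<Rightarrow> int" where
  "tick t N \<equiv> \<lfloor>t * real (Suc N)\<rfloor>"

text \<open>This locale is deterministic: it treats one sequence of discrete paths, index j of
  \<open>Y N\<close> standing for the time j/(N + 1). In \<open>increments\<close> and
  \<open>start\<close> the constant may depend on T and p but neither on the shell nor on N, and
  this uniformity yields the weighted norms. \<open>W T N\<close> is half-open because its members
  label the steps from j to j + 1.\<close>

locale path_limit =
  fixes U :: "nat filter" and k0 lam a b :: real and Y :: "nat \<Rightarrow> int \<Rightarrow> nat \<Rightarrow> complex"
    and W :: "nat \<Rightarrow> nat \<Rightarrow> int set"
  defines "W T N \<equiv> {- (int T * int (Suc N))..<int T * int (Suc N)}"
  assumes U: "ultra U" and U_seq: "U \<le> sequentially" and k0: "0 < k0" and lam: "1 < lam"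
    and increments: "\<And>T p. 2 \<le> p \<Longrightarrow> \<exists>K. eventually (\<lambda>N. \<forall>n\<ge>1.
        (\<Sum>j\<in>W T N. cmod (Y N (j + 1) n - Y N j n) ^ p)
          \<le> K * (real n)\<^sup>2 * shell_k k0 lam n ^ p / real (Suc N) ^ (p - 1)) U"
    and start: "\<exists>K. eventually (\<lambda>N. \<forall>n\<ge>1. (cmod (Y N 0 n))\<^sup>2 \<le> K * (real n)\<^sup>2) U"
    and residual: "\<And>T n. 1 \<le> n \<Longrightarrow> ((\<lambda>N. \<Sum>j\<in>W T N.
        cmod (Y N (j + 1) n - Y N j n + of_real (1 / real (Suc N)) * sabraB k0 lam a b (Y N j) (Y N j) n)) \<longlongrightarrow> 0) U"
begin

abbreviation k :: "nat \<Rightarrow> real" where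
  "k \<equiv> shell_k k0 lam"

abbreviation B :: "(nat \<Rightarrow> complex) \<Rightarrow> nat \<Rightarrow> complex" where
  "B u n \<equiv> sabraB k0 lam a b u u n"

lemma U_bot: "U \<noteq> bot"
  using U by (simp add: ultra_def)

lemma inverse_Suc_tendsto: "((\<lambda>N. 1 / real (Suc N)) \<longlongrightarrow> 0) U"
  by (rule tendsto_mono[OF U_seq LIMSEQ_Suc[OF lim_const_over_n]])

lemma k_pos: "0 < k n"
  using k0 lam by (simp add: shell_k_def)

abbreviation win :: "nat \<Rightarrow> nat \<Rightarrow> int set" where
  "win T N \<equiv> {- (int T * int (Suc N))..int T * int (Suc N)}"

abbreviation increment_bound :: "nat \<Rightarrow> nat \<Rightarrow> real \<Rightarrow> bool" where
  "increment_bound p T K \<equiv> eventually (\<lambda>N. \<forall>n\<ge>1. \<forall>i\<in>win T N. \<forall>j\<in>win T N. cmod (Y N j n - Y N i n) ^ p \<le>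
     K * (real n)\<^sup>2 * k n ^ p * (\<bar>real_of_int j - real_of_int i\<bar> / real (Suc N)) ^ (p - 1)) U"

text \<open>After telescoping, Jensen's inequality produces the factor (number of steps)^(p - 1),
  that is, a power p - 1 of the elapsed time. This power is the source of the Hoelder exponent 1 -
  1/p. The sum of p-th powers is simply enlarged to the whole window.\<close>

lemma discrete_increment:
  assumes p: "2 \<le> p"
  shows "\<exists>K\<ge>1. increment_bound p T K"
proof -
  obtain K where K: "eventually (\<lambda>N. \<forall>n\<ge>1. (\<Sum>j\<in>W T N. cmod (Y N (j + 1) n - Y N j n) ^ p)
          \<le> K * (real n)\<^sup>2 * k n ^ p / real (Suc N) ^ (p - 1)) U"
    using increments[OF p, of T] by blast
  \<comment> \<open>A constant of at least 1 is dominated by its own p-th power, which is used when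
    the p-th root is taken in \<open>X_Holder\<close>.\<close>
  let ?K = "max 1 K"
  let ?B = "\<lambda>N n i j. ?K * (real n)\<^sup>2 * k n ^ p * (\<bar>real_of_int j - real_of_int i\<bar> / real (Suc N)) ^ (p - 1)"
  have "eventually (\<lambda>N. \<forall>n\<ge>1. \<forall>i\<in>win T N. \<forall>j\<in>win T N. cmod (Y N j n - Y N i n) ^ p \<le> ?B N n i j) U"
    using K
  proof eventually_elim
    case (elim N)
    have le: "cmod (Y N j n - Y N i n) ^ p \<le> ?B N n i j"
      if n: "n \<ge> 1" and ij: "i \<in> win T N" "j \<in> win T N" "i \<le> j" for i j n
    proof -
      have "cmod (Y N j n - Y N i n) ^ p = cmod (\<Sum>l\<in>{i..<j}. Y N (l + 1) n - Y N l n) ^ p"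
        using int_telescope[OF \<open>i \<le> j\<close>, of "\<lambda>l. Y N l n"] by simp
      also have "\<dots> \<le> (\<Sum>l\<in>{i..<j}. cmod (Y N (l + 1) n - Y N l n)) ^ p"
        by (intro power_mono norm_sum norm_ge_zero)
      also have "\<dots> \<le> real (card {i..<j}) ^ (p - 1) * (\<Sum>l\<in>{i..<j}. cmod (Y N (l + 1) n - Y N l n) ^ p)"
        using p by (intro sum_power_le) auto
      also have "\<dots> \<le> real (card {i..<j}) ^ (p - 1) * (\<Sum>l\<in>W T N. cmod (Y N (l + 1) n - Y N l n) ^ p)"
        by (intro mult_left_mono sum_mono2) (use ij in \<open>auto simp: W_def\<close>)
      also have "\<dots> \<le> real (card {i..<j}) ^ (p - 1) * (K * (real n)\<^sup>2 * k n ^ p / real (Suc N) ^ (p - 1))"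
        by (intro mult_left_mono) (use elim n in auto)
      also have "\<dots> = K * ((real n)\<^sup>2 * k n ^ p * (\<bar>real_of_int j - real_of_int i\<bar> / real (Suc N)) ^ (p - 1))"
        using ij(3) by (simp add: power_divide)
      also have "\<dots> \<le> ?K * ((real n)\<^sup>2 * k n ^ p * (\<bar>real_of_int j - real_of_int i\<bar> / real (Suc N)) ^ (p - 1))"
        by (intro mult_right_mono) (auto intro!: mult_nonneg_nonneg simp: k_pos less_imp_le)
      finally show ?thesis by (simp only: mult.assoc)
    qed
    show ?case
    proof (intro allI impI ballI)
      fix n i j assume n: "1 \<le> (n::nat)" "i \<in> win T N" "j \<in> win T N"
      show "cmod (Y N j n - Y N i n) ^ p \<le> ?B N n i j"
      proof (cases "i \<le> j")
        case True
        then show ?thesis using le n by blast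
      next
        case False
        then show ?thesis using le[of n j i] n by (simp add: norm_minus_commute abs_minus_commute)
      qed
    qed
  qed
  then show ?thesis by (intro exI[of _ ?K]) auto
qed

lemma discrete_bound:
  "\<exists>M\<ge>0. eventually (\<lambda>N. \<forall>i\<in>win T N. \<forall>m. 1 \<le> m \<and> m \<le> n \<longrightarrow> cmod (Y N i m) \<le> M) U"
proof -
  obtain K where K: "K \<ge> 1" and K_ev: "increment_bound 2 T K"
    using discrete_increment[of 2 T] by auto
  obtain K' where K': "eventually (\<lambda>N. \<forall>n\<ge>1. (cmod (Y N 0 n))\<^sup>2 \<le> K' * (real n)\<^sup>2) U"
    using start by blast
  define D where "D m = sqrt (\<bar>K'\<bar> * (real m)\<^sup>2) + sqrt (K * (real m)\<^sup>2 * (k m)\<^sup>2 * real T)" for m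
  have D: "0 \<le> D m" for m unfolding D_def using K by auto
  have "eventually (\<lambda>N. \<forall>i\<in>win T N. \<forall>m. 1 \<le> m \<and> m \<le> n \<longrightarrow> cmod (Y N i m) \<le> (\<Sum>m\<le>n. D m)) U"
    using K_ev K'
  proof eventually_elim
    case (elim N)
    show ?case
    proof (intro ballI allI impI)
      fix i m assume i: "i \<in> win T N" and m: "1 \<le> m \<and> m \<le> n"
      have "(cmod (Y N 0 m))\<^sup>2 \<le> \<bar>K'\<bar> * (real m)\<^sup>2"
        using elim(2) m by (meson abs_ge_self mult_right_mono order_trans zero_le_power2)
      then have 1: "cmod (Y N 0 m) \<le> sqrt (\<bar>K'\<bar> * (real m)\<^sup>2)" by (rule real_le_rsqrt)
      have "real_of_int \<bar>i\<bar> \<le> real_of_int (int T * int (Suc N))"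
        unfolding of_int_le_iff using i by auto
      then have "\<bar>real_of_int i\<bar> \<le> real T * real (Suc N)" by simp
      then have "\<bar>real_of_int i\<bar> / real (Suc N) \<le> real T" by (simp add: pos_divide_le_eq)
      moreover have "(cmod (Y N i m - Y N 0 m))\<^sup>2 \<le> K * (real m)\<^sup>2 * (k m)\<^sup>2 * (\<bar>real_of_int i\<bar> / real (Suc N))"
        using elim(1)[rule_format, of m 0 i] m i by simp
      ultimately have "(cmod (Y N i m - Y N 0 m))\<^sup>2 \<le> K * (real m)\<^sup>2 * (k m)\<^sup>2 * real T"
        using K by (elim order_trans) (intro mult_left_mono, auto)
      then have "cmod (Y N i m - Y N 0 m) \<le> sqrt (K * (real m)\<^sup>2 * (k m)\<^sup>2 * real T)" by (rule real_le_rsqrt)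
      with 1 have "cmod (Y N i m) \<le> D m"
        unfolding D_def using norm_triangle_sub[of "Y N i m" "Y N 0 m"] by linarith
      also have "\<dots> \<le> (\<Sum>m\<le>n. D m)" using m D by (intro member_le_sum) auto
      finally show "cmod (Y N i m) \<le> (\<Sum>m\<le>n. D m)" .
    qed
  qed
  then show ?thesis using D by (intro exI[of _ "\<Sum>m\<le>n. D m"]) (auto intro: sum_nonneg)
qed

definition approx :: "(nat \<Rightarrow> int) \<Rightarrow> real \<Rightarrow> bool" where
  "approx J t \<longleftrightarrow> ((\<lambda>N. real_of_int (J N) / real (Suc N)) \<longlongrightarrow> t) U"

lemma approx_bounded_dist:
  assumes "eventually (\<lambda>N. \<bar>real_of_int (J N) - t * real (Suc N)\<bar> \<le> c) U"
  shows "approx J t"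
proof -
  have "((\<lambda>N. real_of_int (J N) / real (Suc N) - t) \<longlongrightarrow> 0) U"
  proof (rule Lim_null_comparison)
    show "eventually (\<lambda>N. norm (real_of_int (J N) / real (Suc N) - t) \<le> c * (1 / real (Suc N))) U"
      using assms
    proof eventually_elim
      case (elim N)
      have "real_of_int (J N) / real (Suc N) - t = (real_of_int (J N) - t * real (Suc N)) / real (Suc N)"
        by (simp add: field_simps)
      then show ?case using elim by (simp add: divide_right_mono)
    qed
    show "((\<lambda>N. c * (1 / real (Suc N))) \<longlongrightarrow> 0) U"
      using tendsto_mult[OF tendsto_const inverse_Suc_tendsto, of c] by simp
  qed
  then show ?thesis unfolding approx_def by (simp add: LIM_zero_iff)
qed

lemma approx_floor: "approx (\<lambda>N. tick t N) t"
  by (rule approx_bounded_dist[of _ _ 1]) (auto intro!: always_eventually simp: abs_le_iff, linarith+)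

lemma approx_win:
  assumes "approx J t" "\<bar>t\<bar> < real T"
  shows "eventually (\<lambda>N. J N \<in> win T N) U"
proof -
  have "eventually (\<lambda>N. real_of_int (J N) / real (Suc N) < real T) U"
    "eventually (\<lambda>N. - real T < real_of_int (J N) / real (Suc N)) U"
    using assms unfolding approx_def by (auto intro: order_tendstoD simp: abs_less_iff minus_less_iff)
  then show ?thesis
  proof eventually_elim
    case (elim N)
    then have "real_of_int (J N) \<le> real_of_int (int T * int (Suc N))"
      "real_of_int (- (int T * int (Suc N))) \<le> real_of_int (J N)"
      by (auto simp: pos_divide_less_eq pos_less_divide_eq)
    then show ?case unfolding of_int_le_iff by simp
  qed
qed

definition X :: "real \<Rightarrow> nat \<Rightarrow> complex" where
  "X t n = Lim U (\<lambda>N. Y N (tick t N) n)"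

lemma ex_nat_gt: "\<exists>T::nat. \<bar>t\<bar> < real T"
  by (rule reals_Archimedean2)

lemma X_floor:
  assumes n: "1 \<le> n"
  shows "((\<lambda>N. Y N (tick t N) n) \<longlongrightarrow> X t n) U"
proof -
  obtain T :: nat where T: "\<bar>t\<bar> < real T" using ex_nat_gt by blast
  obtain M where "eventually (\<lambda>N. \<forall>i\<in>win T N. \<forall>m. 1 \<le> m \<and> m \<le> n \<longrightarrow> cmod (Y N i m) \<le> M) U"
    using discrete_bound by blast
  then have "eventually (\<lambda>N. Y N (tick t N) n \<in> cball 0 M) U"
    using approx_win[OF approx_floor T] by eventually_elim (use n in auto)
  then show ?thesis unfolding X_def by (rule ultra_tendsto_bounded[OF U bounded_cball])
qed

text \<open>By the increment bound the limit depends on the index sequence only through its limiting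
  time. Stationarity uses this freedom: \<open>tick t N + tick h N\<close> may differ from
  \<open>tick (t + h) N\<close>.\<close>

lemma X_tendsto:
  assumes n: "1 \<le> n" and J: "approx J t"
  shows "((\<lambda>N. Y N (J N) n) \<longlongrightarrow> X t n) U"
proof -
  let ?I = "\<lambda>N. tick t N"
  obtain T :: nat where T: "\<bar>t\<bar> < real T" using ex_nat_gt by blast
  obtain K where K: "increment_bound 2 T K"
    using discrete_increment[of 2 T] by auto
  let ?g = "\<lambda>N. K * (real n)\<^sup>2 * k n ^ 2 * \<bar>real_of_int (J N) / real (Suc N) - real_of_int (?I N) / real (Suc N)\<bar>"
  have "((\<lambda>N. (cmod (Y N (J N) n - Y N (?I N) n))\<^sup>2) \<longlongrightarrow> 0) U"
  proof (rule Lim_null_comparison)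
    show "eventually (\<lambda>N. norm ((cmod (Y N (J N) n - Y N (?I N) n))\<^sup>2) \<le> ?g N) U"
      using K approx_win[OF approx_floor T] approx_win[OF J T]
    proof eventually_elim
      case (elim N)
      have "(cmod (Y N (J N) n - Y N (?I N) n))\<^sup>2 \<le> K * (real n)\<^sup>2 * k n ^ 2 *
          (\<bar>real_of_int (J N) - real_of_int (?I N)\<bar> / real (Suc N)) ^ (2 - 1)"
        using elim n by blast
      then show ?case by (simp add: diff_divide_distrib[symmetric])
    qed
    have "(?g \<longlongrightarrow> K * (real n)\<^sup>2 * k n ^ 2 * \<bar>t - t\<bar>) U"
      using J approx_floor[of t] unfolding approx_def by (intro tendsto_intros)
    then show "(?g \<longlongrightarrow> 0) U" by simp
  qed
  then have "((\<lambda>N. sqrt ((cmod (Y N (J N) n - Y N (?I N) n))\<^sup>2)) \<longlongrightarrow> sqrt 0) U"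
    by (rule tendsto_real_sqrt)
  then have "((\<lambda>N. Y N (J N) n - Y N (?I N) n) \<longlongrightarrow> 0) U"
    by (simp add: tendsto_norm_zero_iff)
  from tendsto_add[OF this X_floor[OF n, of t]] show ?thesis by simp
qed

lemma X_increment:
  assumes p: "2 \<le> p"
  shows "\<exists>K\<ge>1. \<forall>n\<ge>1. \<forall>s\<in>{-real T..real T}. \<forall>t\<in>{-real T..real T}.
     cmod (X t n - X s n) ^ p \<le> K * (real n)\<^sup>2 * k n ^ p * \<bar>t - s\<bar> ^ (p - 1)"
proof -
  let ?I = "\<lambda>t N. tick t N"
  \<comment> \<open>The window is one unit of time wider because \<open>approx_win\<close> asks for
    times strictly inside it, while T and -T are allowed here.\<close>
  obtain K where K: "K \<ge> 1" and K_ev: "increment_bound p (Suc T) K"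
    using discrete_increment[OF p, of "Suc T"] by auto
  have "cmod (X t n - X s n) ^ p \<le> K * (real n)\<^sup>2 * k n ^ p * \<bar>t - s\<bar> ^ (p - 1)"
    if n: "1 \<le> n" and s: "s \<in> {-real T..real T}" and t: "t \<in> {-real T..real T}" for n s t
  proof (rule tendsto_le[OF U_bot])
    show "((\<lambda>N. cmod (Y N (?I t N) n - Y N (?I s N) n) ^ p) \<longlongrightarrow> cmod (X t n - X s n) ^ p) U"
      by (intro tendsto_intros X_floor n)
    show "((\<lambda>N. K * (real n)\<^sup>2 * k n ^ p *
       \<bar>real_of_int (?I t N) / real (Suc N) - real_of_int (?I s N) / real (Suc N)\<bar> ^ (p - 1))
      \<longlongrightarrow> K * (real n)\<^sup>2 * k n ^ p * \<bar>t - s\<bar> ^ (p - 1)) U"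
      using approx_floor[of t] approx_floor[of s] unfolding approx_def by (intro tendsto_intros)
    have "\<bar>t\<bar> < real (Suc T)" "\<bar>s\<bar> < real (Suc T)" using s t by auto
    then have "eventually (\<lambda>N. ?I t N \<in> win (Suc T) N) U" "eventually (\<lambda>N. ?I s N \<in> win (Suc T) N) U"
      by (auto simp only: approx_win[OF approx_floor])
    then show "eventually (\<lambda>N. cmod (Y N (?I t N) n - Y N (?I s N) n) ^ p \<le> K * (real n)\<^sup>2 * k n ^ p *
       \<bar>real_of_int (?I t N) / real (Suc N) - real_of_int (?I s N) / real (Suc N)\<bar> ^ (p - 1)) U"
      using K_ev
    proof eventually_elim
      case (elim N)
      have "cmod (Y N (?I t N) n - Y N (?I s N) n) ^ p \<le> K * (real n)\<^sup>2 * k n ^ p *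
          (\<bar>real_of_int (?I t N) - real_of_int (?I s N)\<bar> / real (Suc N)) ^ (p - 1)"
        using elim n by blast
      then show ?case by (simp add: diff_divide_distrib[symmetric])
    qed
  qed
  with K show ?thesis by blast
qed

lemma X_start: "\<exists>K\<ge>0. \<forall>n\<ge>1. (cmod (X 0 n))\<^sup>2 \<le> K * (real n)\<^sup>2"
proof -
  obtain K where K: "eventually (\<lambda>N. \<forall>n\<ge>1. (cmod (Y N 0 n))\<^sup>2 \<le> K * (real n)\<^sup>2) U"
    using start by blast
  have "(cmod (X 0 n))\<^sup>2 \<le> \<bar>K\<bar> * (real n)\<^sup>2" if n: "n \<ge> 1" for n
  proof (rule tendsto_upperbound)
    show "((\<lambda>N. (cmod (Y N 0 n))\<^sup>2) \<longlongrightarrow> (cmod (X 0 n))\<^sup>2) U"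
      using X_floor[OF n, of 0] by (intro tendsto_intros) simp
    show "eventually (\<lambda>N. (cmod (Y N 0 n))\<^sup>2 \<le> \<bar>K\<bar> * (real n)\<^sup>2) U"
      using K
    proof eventually_elim
      case (elim N)
      then show ?case using n by (meson abs_ge_self mult_right_mono order_trans zero_le_power2)
    qed
  qed (rule U_bot)
  then show ?thesis by (intro exI[of _ "\<bar>K\<bar>"]) auto
qed

section \<open>The limit path solves the equation\<close>

abbreviation res :: "nat \<Rightarrow> int \<Rightarrow> nat \<Rightarrow> complex" where
  "res N l n \<equiv> Y N (l + 1) n - Y N l n + of_real (1 / real (Suc N)) * B (Y N l) n"

text \<open>The residuals are summed from i to j and every \<open>B (Y N l)\<close> is replaced by
  \<open>B (Y N r)\<close>. The replacement costs, per unit of time, the Lipschitz constant times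
  the oscillation of the shells up to n + 2, which is of the order of the square root of the elapsed
  time by the increment bound with p = 2.\<close>

lemma discrete_Taylor:
  assumes n: "1 \<le> n"
  shows "\<exists>C\<ge>0. eventually (\<lambda>N. \<forall>i\<in>win T N. \<forall>j\<in>win T N. \<forall>r\<in>{i..j}.
     cmod (Y N j n - Y N i n + of_real (real_of_int (j - i) / real (Suc N)) * B (Y N r) n)
      \<le> (\<Sum>l\<in>W T N. cmod (res N l n))
        + C * (real_of_int (j - i) / real (Suc N)) * sqrt (real_of_int (j - i) / real (Suc N))) U"
proof -
  let ?B = "\<lambda>N l. B (Y N l) n"
  obtain K where K: "K \<ge> 1" and K_ev: "increment_bound 2 T K"
    using discrete_increment[of 2 T] by auto
  obtain M where M: "M \<ge> 0" and M_ev: "eventually (\<lambda>N. \<forall>i\<in>win T N. \<forall>m. 1 \<le> m \<and> m \<le> n + 2 \<longrightarrow> cmod (Y N i m) \<le> M) U"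
    using discrete_bound[of T "n + 2"] by blast
  obtain C where C: "C \<ge> 0" and C_le: "\<And>u v M \<delta>. (\<forall>m. 1 \<le> m \<and> m \<le> n + 2 \<longrightarrow> cmod (u m) \<le> M \<and> cmod (v m) \<le> M \<and> cmod (u m - v m) \<le> \<delta>) \<Longrightarrow>
     cmod (B u n - B v n) \<le> C * (M * \<delta>)"
    using sabraB_Lipschitz[of n k0 lam a b] by blast
  \<comment> \<open>The sum over the finitely many shells that enter \<open>B\<close> at n serves as
    a maximum of their constants.\<close>
  define K' where "K' = (\<Sum>m\<le>n + 2. K * (real m)\<^sup>2 * (k m)\<^sup>2)"
  have "0 \<le> K * (real m)\<^sup>2 * (k m)\<^sup>2" for m using K by auto
  then have K': "0 \<le> K'" "\<And>m. m \<le> n + 2 \<Longrightarrow> K * (real m)\<^sup>2 * (k m)\<^sup>2 \<le> K'"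
    unfolding K'_def
    by (auto intro: sum_nonneg member_le_sum[where f = "\<lambda>m. K * (real m)\<^sup>2 * (k m)\<^sup>2"] simp del: sum.atMost_Suc add_2_eq_Suc')
  let ?C = "C * (M * sqrt K')"
  have "eventually (\<lambda>N. \<forall>i\<in>win T N. \<forall>j\<in>win T N. \<forall>r\<in>{i..j}.
     cmod (Y N j n - Y N i n + of_real (real_of_int (j - i) / real (Suc N)) * ?B N r)
      \<le> (\<Sum>l\<in>W T N. cmod (Y N (l + 1) n - Y N l n + of_real (1 / real (Suc N)) * ?B N l))
        + ?C * (real_of_int (j - i) / real (Suc N)) * sqrt (real_of_int (j - i) / real (Suc N))) U"
    using K_ev M_ev
  proof eventually_elim
    case (elim N)
    show ?case
    proof (intro ballI)
      fix i j r assume ij: "i \<in> win T N" "j \<in> win T N" and r: "r \<in> {i..j}"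
      then have le: "i \<le> j" by auto
      let ?h = "1 / real (Suc N)"
      let ?x = "real_of_int (j - i) / real (Suc N)"
      let ?R = "\<lambda>l. Y N (l + 1) n - Y N l n + of_real ?h * ?B N l"
      have x: "0 \<le> ?x" using le by simp
      have dB: "cmod (?B N r - ?B N l) \<le> ?C * sqrt ?x" if l: "l \<in> {i..<j}" for l
      proof -
        have "cmod (Y N r m - Y N l m) \<le> sqrt (K' * ?x)" if m: "1 \<le> m" "m \<le> n + 2" for m
        proof (rule real_le_rsqrt)
          have w: "r \<in> win T N" "l \<in> win T N" using ij r l by auto
          have "(cmod (Y N r m - Y N l m))\<^sup>2 \<le> K * (real m)\<^sup>2 * k m ^ 2 * (\<bar>real_of_int r - real_of_int l\<bar> / real (Suc N)) ^ (2 - 1)"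
            using elim(1) w m by blast
          also have "\<dots> \<le> K' * ?x"
          proof (rule mult_mono)
            have "real_of_int \<bar>r - l\<bar> \<le> real_of_int (j - i)" unfolding of_int_le_iff using r l by auto
            then show "(\<bar>real_of_int r - real_of_int l\<bar> / real (Suc N)) ^ (2 - 1) \<le> ?x"
              by (simp add: divide_right_mono)
          qed (use K' m in auto)
          finally show "(cmod (Y N r m - Y N l m))\<^sup>2 \<le> K' * ?x" .
        qed
        moreover have "cmod (Y N r m) \<le> M" "cmod (Y N l m) \<le> M" if "1 \<le> m" "m \<le> n + 2" for m
          using elim(2) that ij r l by auto
        ultimately have "cmod (?B N r - ?B N l) \<le> C * (M * sqrt (K' * ?x))" by (intro C_le) auto
        then show ?thesis by (simp only: real_sqrt_mult mult.assoc)
      qed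
      have eq: "Y N j n - Y N i n + of_real ?x * ?B N r = (\<Sum>l\<in>{i..<j}. ?R l + of_real ?h * (?B N r - ?B N l))"
      proof -
        have "(\<Sum>l\<in>{i..<j}. ?R l + of_real ?h * (?B N r - ?B N l)) =
          (\<Sum>l\<in>{i..<j}. (Y N (l + 1) n - Y N l n) + of_real ?h * ?B N r)"
          by (intro sum.cong refl) (simp add: right_diff_distrib)
        also have "\<dots> = (Y N j n - Y N i n) + of_nat (card {i..<j}) * (of_real ?h * ?B N r)"
          by (simp only: sum.distrib int_telescope[OF le, of "\<lambda>l. Y N l n"] sum_constant)
        also have "of_nat (card {i..<j}) * (of_real ?h * ?B N r) = of_real ?x * ?B N r"
          using le by (simp add: of_nat_nat)
        finally show ?thesis by simp
      qed
      have 1: "cmod (Y N j n - Y N i n + of_real ?x * ?B N r) \<le> (\<Sum>l\<in>{i..<j}. cmod (?R l) + ?h * (?C * sqrt ?x))"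
        unfolding eq
      proof (rule sum_norm_le)
        fix l assume "l \<in> {i..<j}"
        from dB[OF this] have "cmod (of_real ?h * (?B N r - ?B N l)) \<le> ?h * (?C * sqrt ?x)"
          unfolding norm_mult norm_of_real by (simp add: divide_right_mono)
        then show "cmod (?R l + of_real ?h * (?B N r - ?B N l)) \<le> cmod (?R l) + ?h * (?C * sqrt ?x)"
          using norm_triangle_ineq[of "?R l" "of_real ?h * (?B N r - ?B N l)"] by linarith
      qed
      have 2: "(\<Sum>l\<in>{i..<j}. cmod (?R l) + ?h * (?C * sqrt ?x)) = (\<Sum>l\<in>{i..<j}. cmod (?R l)) + ?C * ?x * sqrt ?x"
        using le by (simp add: sum.distrib of_nat_nat)
      have 3: "(\<Sum>l\<in>{i..<j}. cmod (?R l)) \<le> (\<Sum>l\<in>W T N. cmod (?R l))"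
        by (rule sum_mono2) (use ij in \<open>auto simp: W_def\<close>)
      from 1 show "cmod (Y N j n - Y N i n + of_real ?x * ?B N r) \<le> (\<Sum>l\<in>W T N. cmod (?R l)) + ?C * ?x * sqrt ?x"
        unfolding 2 using 3 by (rule order_trans[OF _ add_right_mono])
    qed
  qed
  then show ?thesis using C M K' by (intro exI[of _ ?C] conjI) auto
qed

text \<open>In the limit the residual sum disappears and a remainder of order 3/2 in the elapsed
  time is left. Both end points are allowed for r, so at a fixed time the same drift governs the
  increments to the right and to the left, which gives a two-sided derivative.\<close>

lemma X_Taylor:
  assumes n: "1 \<le> n"
  shows "\<exists>C\<ge>0. \<forall>s\<in>{-real T..real T}. \<forall>t\<in>{s..real T}. \<forall>r\<in>{s, t}.
     cmod (X t n - X s n + of_real (t - s) * B (X r) n) \<le> C * (t - s) * sqrt (t - s)"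
proof -
  let ?I = "\<lambda>t N. tick t N"
  let ?W = "\<lambda>N. \<Sum>l\<in>W (Suc T) N. cmod (res N l n)"
  obtain C where C: "C \<ge> 0" and C_ev: "eventually (\<lambda>N. \<forall>i\<in>win (Suc T) N. \<forall>j\<in>win (Suc T) N. \<forall>r\<in>{i..j}.
     cmod (Y N j n - Y N i n + of_real (real_of_int (j - i) / real (Suc N)) * B (Y N r) n)
      \<le> ?W N + C * (real_of_int (j - i) / real (Suc N)) * sqrt (real_of_int (j - i) / real (Suc N))) U"
    using discrete_Taylor[OF n, of "Suc T"] by blast
  have "cmod (X t n - X s n + of_real (t - s) * B (X r) n) \<le> 0 + C * (t - s) * sqrt (t - s)"
    if s: "s \<in> {-real T..real T}" and t: "t \<in> {s..real T}" and r: "r \<in> {s, t}" for s t r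
  proof (rule tendsto_le[OF U_bot])
    have d: "((\<lambda>N. real_of_int (?I t N - ?I s N) / real (Suc N)) \<longlongrightarrow> t - s) U"
      using tendsto_diff[OF approx_floor[of t, unfolded approx_def] approx_floor[of s, unfolded approx_def]]
      by (simp add: diff_divide_distrib)
    show "((\<lambda>N. cmod (Y N (?I t N) n - Y N (?I s N) n + of_real (real_of_int (?I t N - ?I s N) / real (Suc N))
        * B (Y N (?I r N)) n)) \<longlongrightarrow>
        cmod (X t n - X s n + of_real (t - s) * B (X r) n)) U"
      by (intro tendsto_norm tendsto_add tendsto_diff tendsto_mult tendsto_of_real tendsto_sabraB X_floor n d)
    show "((\<lambda>N. ?W N + C * (real_of_int (?I t N - ?I s N) / real (Suc N)) * sqrt (real_of_int (?I t N - ?I s N) / real (Suc N)))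
        \<longlongrightarrow> 0 + C * (t - s) * sqrt (t - s)) U"
      by (intro tendsto_add tendsto_mult tendsto_const tendsto_real_sqrt d residual n)
    have "\<bar>t\<bar> < real (Suc T)" "\<bar>s\<bar> < real (Suc T)" using s t by auto
    then have "eventually (\<lambda>N. ?I t N \<in> win (Suc T) N) U" "eventually (\<lambda>N. ?I s N \<in> win (Suc T) N) U"
      by (auto simp only: approx_win[OF approx_floor])
    then show "eventually (\<lambda>N. cmod (Y N (?I t N) n - Y N (?I s N) n + of_real (real_of_int (?I t N - ?I s N) / real (Suc N))
        * B (Y N (?I r N)) n)
      \<le> ?W N + C * (real_of_int (?I t N - ?I s N) / real (Suc N)) * sqrt (real_of_int (?I t N - ?I s N) / real (Suc N))) U"
      using C_ev
    proof eventually_elim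
      case (elim N)
      have "?I s N \<le> ?I t N" using t by (intro floor_mono mult_right_mono) auto
      then have "?I r N \<in> {?I s N..?I t N}" using r by auto
      with elim show ?case by blast
    qed
  qed
  with C show ?thesis by auto
qed

lemma X_has_vector_derivative:
  assumes n: "1 \<le> n"
  shows "((\<lambda>t. X t n) has_vector_derivative - B (X s) n) (at s)"
proof -
  let ?B = "B (X s) n"
  obtain T :: nat where T: "\<bar>s\<bar> < real T" using ex_nat_gt by blast
  obtain C where C: "\<And>s t r. s \<in> {-real T..real T} \<Longrightarrow> t \<in> {s..real T} \<Longrightarrow> r \<in> {s, t} \<Longrightarrow>
     cmod (X t n - X s n + of_real (t - s) * B (X r) n) \<le> C * (t - s) * sqrt (t - s)"
    using X_Taylor[OF n, of T] by blast
  have both: "cmod (X t n - X s n + of_real (t - s) * ?B) \<le> C * \<bar>t - s\<bar> * sqrt \<bar>t - s\<bar>" if t: "\<bar>t\<bar> < real T" for t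
  proof (cases "s \<le> t")
    case True
    then show ?thesis using C[of s t s] T t by auto
  next
    case False
    have "X t n - X s n + of_real (t - s) * ?B = - (X s n - X t n + of_real (s - t) * ?B)"
      by (simp add: algebra_simps)
    then have "cmod (X t n - X s n + of_real (t - s) * ?B) = cmod (X s n - X t n + of_real (s - t) * ?B)"
      by (metis norm_minus_cancel)
    also have "\<dots> \<le> C * (s - t) * sqrt (s - t)" using C[of t s s] T t False by auto
    finally show ?thesis using False by simp
  qed
  have ev: "eventually (\<lambda>t. \<bar>t\<bar> < real T) (at s)"
  proof (rule order_tendstoD(2)[OF _ T])
    show "((\<lambda>t. \<bar>t\<bar>) \<longlongrightarrow> \<bar>s\<bar>) (at s)" by (intro tendsto_intros)
  qed
  have "((\<lambda>t. norm (X t n - X s n - (t - s) *\<^sub>R (- ?B)) / norm (t - s)) \<longlongrightarrow> 0) (at s)"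
  proof (rule Lim_null_comparison)
    show "eventually (\<lambda>t. norm (norm (X t n - X s n - (t - s) *\<^sub>R (- ?B)) / norm (t - s)) \<le> C * sqrt \<bar>t - s\<bar>) (at s)"
      using ev eventually_neq_at_within[of s]
    proof eventually_elim
      case (elim t)
      have "norm (X t n - X s n - (t - s) *\<^sub>R (- ?B)) = cmod (X t n - X s n + of_real (t - s) * ?B)"
        by (simp add: scaleR_conv_of_real)
      also have "\<dots> \<le> C * sqrt \<bar>t - s\<bar> * \<bar>t - s\<bar>" using both[OF elim(1)] by (simp add: mult_ac)
      finally show ?case using elim(2) by (simp add: pos_divide_le_eq)
    qed
    have "((\<lambda>t. C * sqrt \<bar>t - s\<bar>) \<longlongrightarrow> C * sqrt \<bar>s - s\<bar>) (at s)" by (intro tendsto_intros)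
    then show "((\<lambda>t. C * sqrt \<bar>t - s\<bar>) \<longlongrightarrow> 0) (at s)" by simp
  qed
  then show ?thesis
    unfolding has_vector_derivative_def has_derivative_iff_norm using bounded_linear_scaleR_left by blast
qed

lemma X_solves: "solves_inviscid k0 lam a b X"
  unfolding solves_inviscid_def
proof (intro allI impI)
  fix n s t assume n: "1 \<le> (n::nat)" and st: "(s::real) < t"
  let ?B = "\<lambda>r. B (X r) n"
  have "isCont (\<lambda>r. X r m) r" if "1 \<le> m" for m r
    by (rule has_vector_derivative_continuous[OF X_has_vector_derivative[OF that]])
  then have "isCont ?B r" for r unfolding isCont_def by (intro tendsto_sabraB)
  then have cont: "continuous_on {s..t} ?B" by (simp add: continuous_at_imp_continuous_on)
  have "integral\<^sup>L lborel (\<lambda>x. indicator {s..t} x *\<^sub>R (- ?B x)) = X t n - X s n"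
    by (rule integral_FTC_atLeastAtMost)
      (use st n cont in \<open>auto intro!: has_vector_derivative_at_within[OF X_has_vector_derivative] continuous_intros\<close>)
  then show "set_integrable lborel {s..t} ?B \<and> X t n - X s n = - (LINT r:{s..t}|lborel. ?B r)"
    using borel_integrable_atLeastAtMost'[OF cont] by (simp add: set_lebesgue_integral_def)
qed

section \<open>Hoelder regularity in the weighted sequence spaces\<close>

lemma X_Holder:
  assumes p: "2 \<le> p"
  shows "\<exists>K\<ge>1. \<forall>n\<ge>1. \<forall>s\<in>{-real T..real T}. \<forall>t\<in>{-real T..real T}.
     cmod (X t n - X s n) \<le> K * (real n)\<^sup>2 * k n * \<bar>t - s\<bar> powr (1 - 1 / real p)"
proof -
  obtain K where K: "K \<ge> 1" and K_le: "\<And>n s t. n\<ge>1 \<Longrightarrow> s\<in>{-real T..real T} \<Longrightarrow> t\<in>{-real T..real T} \<Longrightarrow>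
     cmod (X t n - X s n) ^ p \<le> K * (real n)\<^sup>2 * k n ^ p * \<bar>t - s\<bar> ^ (p - 1)"
    using X_increment[OF p, of T] by blast
  have "cmod (X t n - X s n) \<le> K * (real n)\<^sup>2 * k n * \<bar>t - s\<bar> powr (1 - 1 / real p)"
    if n: "n \<ge> 1" and st: "s \<in> {-real T..real T}" "t \<in> {-real T..real T}" for n s t
  proof (cases "s = t")
    case False
    let ?A = "K * (real n)\<^sup>2"
    have A: "1 \<le> ?A"
      using mult_mono[of 1 K 1 "(real n)\<^sup>2"] K n by simp
    have "(\<bar>t - s\<bar> powr (1 - 1 / real p)) ^ p = \<bar>t - s\<bar> powr ((1 - 1 / real p) * real p)"
      using False by (simp add: powr_powr powr_realpow[symmetric])
    also have "(1 - 1 / real p) * real p = real (p - 1)" using p by (simp add: field_simps)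
    also have "\<bar>t - s\<bar> powr real (p - 1) = \<bar>t - s\<bar> ^ (p - 1)" using False by (simp add: powr_realpow)
    finally have e: "(\<bar>t - s\<bar> powr (1 - 1 / real p)) ^ p = \<bar>t - s\<bar> ^ (p - 1)" .
    have "cmod (X t n - X s n) ^ p \<le> ?A * (k n ^ p * \<bar>t - s\<bar> ^ (p - 1))"
      using K_le[OF n st] by (simp only: mult.assoc)
    \<comment> \<open>The prefactor is made a p-th power so that the root can be taken; this is
      where \<open>?A \<ge> 1\<close> enters.\<close>
    also have "\<dots> \<le> ?A ^ p * (k n ^ p * \<bar>t - s\<bar> ^ (p - 1))"
      using A p k_pos[of n] by (intro mult_right_mono self_le_power) auto
    also have "\<dots> = (?A * k n * \<bar>t - s\<bar> powr (1 - 1 / real p)) ^ p"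
      by (simp only: power_mult_distrib e mult.assoc)
    finally show ?thesis
      by (subst (asm) power_mono_iff) (use A p k_pos[of n] in \<open>auto intro!: mult_nonneg_nonneg simp: less_imp_le\<close>)
  qed simp
  with K show ?thesis by blast
qed

text \<open>The weight of order -1 - \<alpha> cancels the square of \<open>k\<close> and leaves
  \<open>k powr (- (2 * \<alpha>))\<close>. As \<open>k\<close> grows geometrically, this decays
  geometrically in n and beats the factor n^4.\<close>

lemma weight_summable:
  assumes "0 < \<alpha>"
  shows "summable (\<lambda>n. k (Suc n) powr (2 * (- 1 - \<alpha>)) * (D * (real (Suc n))\<^sup>2 * k (Suc n))\<^sup>2)"
proof -
  let ?q = "lam powr (- (2 * \<alpha>))"
  have "?q < 1" using powr_less_mono[of "- (2 * \<alpha>)" 0 lam] lam assms by simp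
  then have "summable (\<lambda>n. real n ^ 4 * ?q ^ n)" by (intro summable_power_geometric) auto
  then have s: "summable (\<lambda>n. D\<^sup>2 * k0 powr (- (2 * \<alpha>)) * (real (Suc n) ^ 4 * ?q ^ Suc n))"
    by (intro summable_mult) (subst summable_Suc_iff, assumption)
  have "k m powr (2 * (- 1 - \<alpha>)) * (D * (real m)\<^sup>2 * k m)\<^sup>2 =
      D\<^sup>2 * k0 powr (- (2 * \<alpha>)) * (real m ^ 4 * ?q ^ m)" for m
  proof -
    have "k m powr (2 * (- 1 - \<alpha>)) * (k m)\<^sup>2 =
        k m powr (2 * (- 1 - \<alpha>)) * k m powr 2"
      using k_pos by (simp add: powr_realpow[symmetric])
    also have "\<dots> = k m powr (- (2 * \<alpha>))" by (simp add: powr_add[symmetric] algebra_simps)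
    also have "\<dots> = k0 powr (- (2 * \<alpha>)) * ?q ^ m"
      using k0 lam by (simp add: shell_k_def powr_mult powr_powr powr_realpow[symmetric] mult_ac)
    finally have "k m powr (2 * (- 1 - \<alpha>)) * (k m)\<^sup>2 = k0 powr (- (2 * \<alpha>)) * ?q ^ m" .
    then show ?thesis by (simp add: power_mult_distrib power_mult[symmetric] mult_ac)
  qed
  then show ?thesis using s by (simp only:)
qed

lemma normH_le:
  assumes \<alpha>: "0 < \<alpha>" and "0 \<le> D"
    and w: "\<And>n. 1 \<le> n \<Longrightarrow> cmod (w n) \<le> D * (real n)\<^sup>2 * k n"
  shows "inH k0 lam (- 1 - \<alpha>) w"
    "normH k0 lam (- 1 - \<alpha>) w \<le> D * sqrt (\<Sum>n. k (Suc n) powr (2 * (- 1 - \<alpha>)) * (1 * (real (Suc n))\<^sup>2 * k (Suc n))\<^sup>2)"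
proof -
  let ?k = "\<lambda>n. k (Suc n)"
  let ?f = "\<lambda>n. ?k n powr (2 * (- 1 - \<alpha>)) * (cmod (w (Suc n)))\<^sup>2"
  let ?g = "\<lambda>D n. ?k n powr (2 * (- 1 - \<alpha>)) * (D * (real (Suc n))\<^sup>2 * ?k n)\<^sup>2"
  have le: "?f n \<le> ?g D n" for n
    by (intro mult_left_mono power_mono w) auto
  show f: "inH k0 lam (- 1 - \<alpha>) w"
    unfolding inH_def by (rule summable_comparison_test'[OF weight_summable[OF \<alpha>, of D], of 0]) (use le in auto)
  have "suminf ?f \<le> suminf (?g D)"
    by (intro suminf_le le weight_summable[OF \<alpha>] f[unfolded inH_def])
  also have "\<dots> = (\<Sum>n. D\<^sup>2 * ?g 1 n)" by (simp add: power_mult_distrib mult_ac)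
  also have "\<dots> = D\<^sup>2 * suminf (?g 1)" by (rule suminf_mult[OF weight_summable[OF \<alpha>]])
  finally have "sqrt (suminf ?f) \<le> sqrt (D\<^sup>2 * suminf (?g 1))" by (rule real_sqrt_le_mono)
  then show "normH k0 lam (- 1 - \<alpha>) w \<le> D * sqrt (suminf (?g 1))"
    unfolding normH_def using \<open>0 \<le> D\<close> by (simp add: real_sqrt_mult)
qed

lemma X_inH:
  assumes \<alpha>: "0 < \<alpha>"
  shows "inH k0 lam (- 1 - \<alpha>) (X t)"
proof -
  obtain T :: nat where T: "\<bar>t\<bar> < real T" using ex_nat_gt by blast
  obtain K where K: "K \<ge> 1" and K_le: "\<And>n s t. n\<ge>1 \<Longrightarrow> s\<in>{-real T..real T} \<Longrightarrow> t\<in>{-real T..real T} \<Longrightarrow>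
     cmod (X t n - X s n) \<le> K * (real n)\<^sup>2 * k n * \<bar>t - s\<bar> powr (1 - 1 / real 2)"
    using X_Holder[of 2 T] by auto
  obtain K' where K': "K' \<ge> 0" "\<And>n. n\<ge>1 \<Longrightarrow> (cmod (X 0 n))\<^sup>2 \<le> K' * (real n)\<^sup>2"
    using X_start by blast
  \<comment> \<open>The value at time 0 and the increment from 0 to t are brought to the common
    shape (constant) * n^2 * \<open>k n\<close>; for the former, n is bounded by n^2 *
    \<open>lam ^ n\<close>.\<close>
  let ?D = "sqrt K' / k0 + K * \<bar>t\<bar> powr (1 - 1 / real 2)"
  show ?thesis
  proof (rule normH_le(1)[OF \<alpha>, of ?D])
    fix n :: nat assume n: "1 \<le> n"
    have "cmod (X 0 n) \<le> sqrt (K' * (real n)\<^sup>2)" using K'(2)[OF n] by (rule real_le_rsqrt)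
    also have "\<dots> = sqrt K' * real n" by (simp add: real_sqrt_mult)
    also have "\<dots> \<le> sqrt K' * ((real n)\<^sup>2 * lam ^ n)"
    proof (rule mult_left_mono)
      have "real n * 1 \<le> (real n)\<^sup>2 * lam ^ n"
        using n lam by (intro mult_mono) (auto simp: power2_eq_square)
      then show "real n \<le> (real n)\<^sup>2 * lam ^ n" by simp
    qed (use K' in auto)
    also have "\<dots> = sqrt K' / k0 * (real n)\<^sup>2 * k n"
      using k0 by (simp add: shell_k_def)
    finally have 1: "cmod (X 0 n) \<le> sqrt K' / k0 * (real n)\<^sup>2 * k n" .
    have 2: "cmod (X t n - X 0 n) \<le> K * (real n)\<^sup>2 * k n * \<bar>t\<bar> powr (1 - 1 / real 2)"
      using K_le[OF n, of 0 t] T by (simp add: abs_less_iff)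
    have "?D * (real n)\<^sup>2 * k n = sqrt K' / k0 * (real n)\<^sup>2 * k n + 
       K * (real n)\<^sup>2 * k n * \<bar>t\<bar> powr (1 - 1 / real 2)" by algebra
    then show "cmod (X t n) \<le> ?D * (real n)\<^sup>2 * k n"
      using 1 2 norm_triangle_sub[of "X t n" "X 0 n"] by linarith
  qed (use K K' k0 in auto)
qed

lemma X_Holder_H:
  assumes \<alpha>: "0 < \<alpha>" and \<gamma>: "0 \<le> \<gamma>" "\<gamma> < 1" and "0 < T"
  shows "\<exists>C\<ge>0. \<forall>s\<in>{-T..T}. \<forall>t\<in>{-T..T}. 0 \<le> normH k0 lam (- 1 - \<alpha>) (\<lambda>n. X t n - X s n) \<and> normH k0 lam (- 1 - \<alpha>) (\<lambda>n. X t n - X s n) \<le> C * \<bar>t - s\<bar> powr \<gamma>"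
proof -
  obtain T' :: nat where T': "T < real T'" using reals_Archimedean2 by blast
  \<comment> \<open>With p \<ge> 1/(1 - \<gamma>) the exponent 1 - 1/p is at least \<gamma>; the
    surplus \<delta> - \<gamma> is absorbed by the length 2T of the interval.\<close>
  obtain q :: nat where q: "1 / (1 - \<gamma>) < real q" using reals_Archimedean2 by blast
  define p where "p = max 2 q"
  define \<delta> where "\<delta> = 1 - 1 / real p"
  have p: "2 \<le> p" "1 / (1 - \<gamma>) < real p" using q by (auto simp: p_def)
  then have "\<gamma> \<le> \<delta>" using \<gamma> by (simp add: \<delta>_def field_simps)
  obtain K where K: "K \<ge> 1" and K_le: "\<And>n s t. n\<ge>1 \<Longrightarrow> s\<in>{-real T'..real T'} \<Longrightarrow> t\<in>{-real T'..real T'} \<Longrightarrow>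
     cmod (X t n - X s n) \<le> K * (real n)\<^sup>2 * k n * \<bar>t - s\<bar> powr \<delta>"
    using X_Holder[OF p(1), of T'] unfolding \<delta>_def by blast
  define Z where "Z = sqrt (\<Sum>n. k (Suc n) powr (2 * (- 1 - \<alpha>)) * (1 * (real (Suc n))\<^sup>2 * k (Suc n))\<^sup>2)"
  have Z: "0 \<le> Z" unfolding Z_def by (intro real_sqrt_ge_zero suminf_nonneg weight_summable \<alpha>) auto
  let ?C = "K * (2 * T) powr (\<delta> - \<gamma>) * Z"
  have "0 \<le> normH k0 lam (- 1 - \<alpha>) (\<lambda>n. X t n - X s n) \<and> normH k0 lam (- 1 - \<alpha>) (\<lambda>n. X t n - X s n) \<le> ?C * \<bar>t - s\<bar> powr \<gamma>"
    if s: "s \<in> {-T..T}" and t: "t \<in> {-T..T}" for s t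
  proof
    have le: "cmod (X t n - X s n) \<le> K * \<bar>t - s\<bar> powr \<delta> * (real n)\<^sup>2 * k n" if "1 \<le> n" for n
      using K_le[OF that, of s t] s t T' by (simp add: mult_ac)
    have "inH k0 lam (- 1 - \<alpha>) (\<lambda>n. X t n - X s n)" by (rule normH_le(1)[OF \<alpha> _ le]) (use K in auto)
    then show "0 \<le> normH k0 lam (- 1 - \<alpha>) (\<lambda>n. X t n - X s n)"
      unfolding inH_def normH_def by (intro real_sqrt_ge_zero suminf_nonneg) auto
    have "normH k0 lam (- 1 - \<alpha>) (\<lambda>n. X t n - X s n) \<le> (K * \<bar>t - s\<bar> powr \<delta>) * Z"
      unfolding Z_def by (rule normH_le(2)[OF \<alpha> _ le]) (use K in auto)
    also have "\<bar>t - s\<bar> powr \<delta> = \<bar>t - s\<bar> powr (\<delta> - \<gamma>) * \<bar>t - s\<bar> powr \<gamma>"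
      by (simp add: powr_add[symmetric])
    also have "K * (\<bar>t - s\<bar> powr (\<delta> - \<gamma>) * \<bar>t - s\<bar> powr \<gamma>) * Z \<le> K * ((2 * T) powr (\<delta> - \<gamma>) * \<bar>t - s\<bar> powr \<gamma>) * Z"
      using s t Z K \<open>\<gamma> \<le> \<delta>\<close> by (intro mult_right_mono mult_left_mono powr_mono2) auto
    finally show "normH k0 lam (- 1 - \<alpha>) (\<lambda>n. X t n - X s n) \<le> ?C * \<bar>t - s\<bar> powr \<gamma>" by (simp add: mult_ac)
  qed
  moreover have "0 \<le> ?C" using K Z by auto
  ultimately show ?thesis by blast
qed

lemma X_loc_holder:
  assumes \<alpha>: "0 < \<alpha>" and \<gamma>: "0 \<le> \<gamma>" "\<gamma> < 1"
  shows "loc_holder_H k0 lam \<gamma> (- 1 - \<alpha>) X"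
  unfolding loc_holder_H_def
proof (intro conjI allI impI)
  show "inH k0 lam (- 1 - \<alpha>) (X t)" for t by (rule X_inH[OF \<alpha>])
  show "\<exists>C. \<forall>s\<in>{-T..T}. \<forall>t\<in>{-T..T}. normH k0 lam (- 1 - \<alpha>) (\<lambda>n. X t n - X s n) \<le> C * \<bar>t - s\<bar> powr \<gamma>"
    if "0 < T" for T
    using X_Holder_H[OF \<alpha> \<gamma> that] by blast
  fix t
  \<comment> \<open>The exponent 1/2 is fixed for the continuity clause, as a bound with \<gamma> =
    0 would not force convergence.\<close>
  obtain C where C: "\<And>s r. s\<in>{-(\<bar>t\<bar> + 1)..\<bar>t\<bar> + 1} \<Longrightarrow> r\<in>{-(\<bar>t\<bar> + 1)..\<bar>t\<bar> + 1} \<Longrightarrow>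
     0 \<le> normH k0 lam (- 1 - \<alpha>) (\<lambda>n. X r n - X s n) \<and> normH k0 lam (- 1 - \<alpha>) (\<lambda>n. X r n - X s n) \<le> C * \<bar>r - s\<bar> powr (1/2)"
    using X_Holder_H[OF \<alpha>, of "1/2" "\<bar>t\<bar> + 1"] by fastforce
  show "((\<lambda>s. normH k0 lam (- 1 - \<alpha>) (\<lambda>n. X s n - X t n)) \<longlongrightarrow> 0) (at t)"
  proof (rule Lim_null_comparison)
    have "eventually (\<lambda>s. s \<in> {-(\<bar>t\<bar> + 1)<..<\<bar>t\<bar> + 1}) (at t)"
      by (rule eventually_at_in_open') auto
    then show "eventually (\<lambda>s. norm (normH k0 lam (- 1 - \<alpha>) (\<lambda>n. X s n - X t n)) \<le> C * \<bar>s - t\<bar> powr (1/2)) (at t)"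
    proof eventually_elim
      case (elim s)
      have "t \<in> {-(\<bar>t\<bar> + 1)..\<bar>t\<bar> + 1}" by (auto simp: abs_if)
      then show ?case using C[of t s] elim by auto
    qed
    have "((\<lambda>s. C * \<bar>s - t\<bar> powr (1/2)) \<longlongrightarrow> C * \<bar>t - t\<bar> powr (1/2)) (at t)"
      by (intro tendsto_intros tendsto_powr') auto
    then show "((\<lambda>s. C * \<bar>s - t\<bar> powr (1/2)) \<longlongrightarrow> 0) (at t)" by simp
  qed
qed

end

section \<open>Triad maps preserve the Gaussian measure\<close>

text \<open>The Cayley transform of the triad rotation \<open>z' = \<i> * cnj c * w\<close>, \<open>w' = \<i> * c * z\<close>; the second
  component of its value at \<open>(z, w)\<close> is \<open>cayley (cnj c) w z\<close>.\<close>
definition cayley :: "complex \<Rightarrow> complex \<Rightarrow> complex \<Rightarrow> complex" where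
  "cayley c z w = ((1 - of_real ((cmod c)\<^sup>2 / 4)) * z + \<i> * cnj c * w) / of_real (1 + (cmod c)\<^sup>2 / 4)"

text \<open>With |c|^2 = 4s, the numbers (1 - s)/(1 + s) and |c|/(1 + s) are the cosine and the sine
  of one angle, because (1 - s)^2 + 4s = (1 + s)^2; so the pair is transformed by a unitary
  matrix.\<close>

lemma cayley_energy:
  "(cmod (cayley c z w))\<^sup>2 + (cmod (cayley (cnj c) w z))\<^sup>2 = (cmod z)\<^sup>2 + (cmod w)\<^sup>2"
proof -
  define s where "s = (cmod c)\<^sup>2 / 4"
  have s: "0 \<le> s" unfolding s_def by simp
  have cc: "(cmod c)\<^sup>2 = 4 * s" unfolding s_def by simp
  have c2: "(Re c)\<^sup>2 + (Im c)\<^sup>2 = 4 * s" using cc by (simp add: cmod_power2)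
  let ?A = "(1 - of_real s) * z + \<i> * cnj c * w" and ?B = "(1 - of_real s) * w + \<i> * c * z"
  have e: "(cmod ?A)\<^sup>2 + (cmod ?B)\<^sup>2 = ((1 - s)\<^sup>2 + ((Re c)\<^sup>2 + (Im c)\<^sup>2)) * ((cmod z)\<^sup>2 + (cmod w)\<^sup>2)"
    unfolding cmod_power2 by (simp add: power2_eq_square algebra_simps)
  have c2': "(1 - s)\<^sup>2 + ((Re c)\<^sup>2 + (Im c)\<^sup>2) = (1 + s)\<^sup>2"
    unfolding c2 by (simp add: power2_eq_square algebra_simps)
  have d: "(cmod (x / of_real (1 + s)))\<^sup>2 = (cmod x)\<^sup>2 / (1 + s)\<^sup>2" for x
    by (simp only: norm_divide norm_of_real power_divide power2_abs)
  have c: "cayley c z w = ?A / of_real (1 + s)" "cayley (cnj c) w z = ?B / of_real (1 + s)"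
    unfolding cayley_def s_def by simp_all
  have "(cmod (cayley c z w))\<^sup>2 + (cmod (cayley (cnj c) w z))\<^sup>2 = ((cmod ?A)\<^sup>2 + (cmod ?B)\<^sup>2) / (1 + s)\<^sup>2"
    unfolding c d by (rule add_divide_distrib[symmetric])
  then show ?thesis unfolding e c2' using s by simp
qed

text \<open>The classical factorisation of a rotation into three shears: \<open>\<alpha> c\<close>
  has the tangent of half the angle as its modulus, \<open>\<beta> c\<close> the sine. For the
  Cayley transform that tangent is |c|/2, finite for every c, so there is no exceptional
  angle.\<close>

lemma cayley_shears:
  defines "\<alpha> \<equiv> \<lambda>c. \<i> * cnj c / 2" and "\<beta> \<equiv> \<lambda>c. \<i> * c / of_real (1 + (cmod c)\<^sup>2 / 4)"
  shows "cayley (cnj c) w z = w + \<beta> c * (z + \<alpha> c * w)"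
    and "cayley c z w = (z + \<alpha> c * w) + \<alpha> c * (w + \<beta> c * (z + \<alpha> c * w))"
proof -
  define s where "s = (cmod c)\<^sup>2 / 4"
  have cc: "c * cnj c = 4 * of_real s"
    unfolding s_def by (simp add: complex_norm_square[symmetric])
  have s: "(1 + of_real s :: complex) \<noteq> 0"
  proof
    assume "(1 + of_real s :: complex) = 0"
    then have "complex_of_real (1 + s) = of_real 0" by simp
    then have "1 + s = 0" unfolding of_real_eq_iff .
    moreover have "0 \<le> s" unfolding s_def by simp
    ultimately show False by simp
  qed
  have b: "\<beta> c * (1 + of_real s) = \<i> * c" using s by (simp add: \<beta>_def s_def)
  have a: "2 * \<alpha> c = \<i> * cnj c" by (simp add: \<alpha>_def)
  have ab: "\<beta> c * \<alpha> c * (1 + of_real s) = - (2 * of_real s)"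
  proof -
    have "2 * (\<beta> c * \<alpha> c * (1 + of_real s)) = (\<beta> c * (1 + of_real s)) * (2 * \<alpha> c)" by algebra
    also have "\<dots> = (\<i> * \<i>) * (c * cnj c)" unfolding a b by algebra
    also have "\<dots> = 2 * - (2 * of_real s)" by (simp add: cc)
    finally show ?thesis unfolding mult_cancel_left by simp
  qed
  have w: "(w + \<beta> c * (z + \<alpha> c * w)) * (1 + of_real s) = (1 - of_real s) * w + \<i> * c * z"
  proof -
    have "(w + \<beta> c * (z + \<alpha> c * w)) * (1 + of_real s) =
      w * (1 + of_real s) + (\<beta> c * (1 + of_real s)) * z + (\<beta> c * \<alpha> c * (1 + of_real s)) * w" by algebra
    then show ?thesis unfolding b ab by (simp add: algebra_simps)
  qed
  then show "cayley (cnj c) w z = w + \<beta> c * (z + \<alpha> c * w)"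
    unfolding cayley_def using s by (simp add: s_def[symmetric] divide_eq_eq)
  have "((z + \<alpha> c * w) + \<alpha> c * (w + \<beta> c * (z + \<alpha> c * w))) * (1 + of_real s) =
    z * (1 + of_real s) + (2 * \<alpha> c) * w * (1 + of_real s) + (\<beta> c * \<alpha> c * (1 + of_real s)) * (z + \<alpha> c * w)" by algebra
  also have "\<dots> = (1 - of_real s) * z + (2 * \<alpha> c) * w"
    unfolding ab by algebra
  finally show "cayley c z w = (z + \<alpha> c * w) + \<alpha> c * (w + \<beta> c * (z + \<alpha> c * w))"
    unfolding cayley_def a using s by (simp add: s_def[symmetric] divide_eq_eq)
qed

lemma nn_integral_lborel_shift:
  fixes f :: "complex \<Rightarrow> ennreal"
  assumes [measurable]: "f \<in> borel_measurable borel"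
  shows "(\<integral>\<^sup>+z. f (z + c) \<partial>lborel) = (\<integral>\<^sup>+z. f z \<partial>lborel)"
proof -
  have "(\<integral>\<^sup>+z. f z \<partial>lborel) = (\<integral>\<^sup>+z. f z \<partial>distr lborel borel ((+) c))" by (simp add: lborel_distr_plus)
  also have "\<dots> = (\<integral>\<^sup>+z. f (c + z) \<partial>lborel)" by (rule nn_integral_distr) auto
  finally show ?thesis by (simp add: add.commute)
qed

interpretation lborel_pair: pair_sigma_finite "lborel :: complex measure" "lborel :: complex measure"
  by standard

text \<open>A shear translates one variable by an amount that depends on the other alone, so
  translation invariance applies once the translated variable is integrated first. Tonelli's theorem
  changes the order for the middle shear.\<close>

lemma lborel_cayley_invariant:
  fixes F :: "complex \<Rightarrow> complex \<Rightarrow> ennreal"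
  assumes F[measurable]: "case_prod F \<in> borel_measurable (borel \<Otimes>\<^sub>M borel)"
  shows "(\<integral>\<^sup>+w. \<integral>\<^sup>+z. F (cayley c z w) (cayley (cnj c) w z) \<partial>lborel \<partial>lborel) = (\<integral>\<^sup>+w. \<integral>\<^sup>+z. F z w \<partial>lborel \<partial>lborel)"
proof -
  have S1: "(\<integral>\<^sup>+w. \<integral>\<^sup>+z. G (z + \<alpha> * w) w \<partial>lborel \<partial>lborel) = (\<integral>\<^sup>+w. \<integral>\<^sup>+z. G z w \<partial>lborel \<partial>lborel)"
    if [measurable]: "case_prod G \<in> borel_measurable (borel \<Otimes>\<^sub>M borel)" for G :: "complex \<Rightarrow> complex \<Rightarrow> ennreal" and \<alpha>
    by (intro nn_integral_cong nn_integral_lborel_shift) measurable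
  have S2: "(\<integral>\<^sup>+w. \<integral>\<^sup>+z. G z (w + \<beta> * z) \<partial>lborel \<partial>lborel) = (\<integral>\<^sup>+w. \<integral>\<^sup>+z. G z w \<partial>lborel \<partial>lborel)"
    if [measurable]: "case_prod G \<in> borel_measurable (borel \<Otimes>\<^sub>M borel)" for G :: "complex \<Rightarrow> complex \<Rightarrow> ennreal" and \<beta>
  proof -
    have "(\<integral>\<^sup>+w. \<integral>\<^sup>+z. G z (w + \<beta> * z) \<partial>lborel \<partial>lborel) = (\<integral>\<^sup>+z. \<integral>\<^sup>+w. G z (w + \<beta> * z) \<partial>lborel \<partial>lborel)"
      by (rule lborel_pair.Fubini') measurable
    also have "\<dots> = (\<integral>\<^sup>+z. \<integral>\<^sup>+w. G z w \<partial>lborel \<partial>lborel)"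
      by (intro nn_integral_cong nn_integral_lborel_shift) measurable
    also have "\<dots> = (\<integral>\<^sup>+w. \<integral>\<^sup>+z. G z w \<partial>lborel \<partial>lborel)"
      by (rule lborel_pair.Fubini'[symmetric]) measurable
    finally show ?thesis .
  qed
  let ?a = "\<i> * cnj c / 2" and ?b = "\<i> * c / of_real (1 + (cmod c)\<^sup>2 / 4)"
  show ?thesis
    unfolding cayley_shears(1)[of c] cayley_shears(2)[of c]
    \<comment> \<open>The shears are removed in the order in which they act on the pair (z, w), the
      first one to act being removed first.\<close>
    using S1[of "\<lambda>z w. F (z + ?a * (w + ?b * z)) (w + ?b * z)" ?a]
      S2[of "\<lambda>z w. F (z + ?a * w) w" ?b] S1[of F ?a]
    by simp
qed

section \<open>Gaussian invariance, on two shells and on the infinite product\<close>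

lemma sets_gauss_shell [simp, measurable_cong]: "sets (gauss_shell \<nu>) = sets borel"
  by (simp add: gauss_shell_def)

lemma space_gauss_shell [simp]: "space (gauss_shell \<nu>) = UNIV"
  by (simp add: gauss_shell_def)

lemma nn_integral_gauss_shell:
  assumes "f \<in> borel_measurable borel"
  shows "(\<integral>\<^sup>+z. f z \<partial>gauss_shell \<nu>) = (\<integral>\<^sup>+z. ennreal (\<nu> / (2 * pi) * exp (- (\<nu> / 2) * (cmod z)\<^sup>2)) * f z \<partial>lborel)"
  unfolding gauss_shell_def using assms by (subst nn_integral_density) auto

lemma prob_space_gauss_shell:
  assumes "0 < \<nu>"
  shows "prob_space (gauss_shell \<nu>)"
proof
  \<comment> \<open>In real and imaginary parts the density is a product of two centred normal
    densities of variance 1/\<nu>.\<close>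
  let ?s = "1 / sqrt \<nu>"
  let ?n = "\<lambda>x::real. ennreal (normal_density 0 ?s x)"
  interpret N: prob_space "density lborel (normal_density 0 ?s)"
    using assms by (intro prob_space_normal_density) simp
  have 1: "(\<integral>\<^sup>+x. normal_density 0 ?s x \<partial>lborel) = 1"
    using N.emeasure_space_1 by (simp add: emeasure_density)
  have nd: "normal_density 0 ?s x = sqrt (\<nu> / (2 * pi)) * exp (- (\<nu> / 2) * x\<^sup>2)" for x
    using assms by (simp add: normal_density_def power_divide real_sqrt_divide)
  have Re_Im_Basis: "(\<Prod>b\<in>Basis. g (z \<bullet> b)) = g (Re z) * g (Im z)" for g :: "real \<Rightarrow> real" and z :: complex
    by (simp add: Basis_complex_def inner_complex_def)
  have "\<nu> / (2 * pi) * exp (- (\<nu> / 2) * (cmod z)\<^sup>2) = (\<Prod>b\<in>Basis. normal_density 0 ?s (z \<bullet> b))" for z :: complex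
  proof -
    have "(\<Prod>b\<in>Basis. normal_density 0 ?s (z \<bullet> b)) = (sqrt (\<nu> / (2 * pi)) * sqrt (\<nu> / (2 * pi))) *
        (exp (- (\<nu> / 2) * (Re z)\<^sup>2) * exp (- (\<nu> / 2) * (Im z)\<^sup>2))"
      by (simp only: Re_Im_Basis[of "normal_density 0 ?s"] nd[of "Re z"] nd[of "Im z"] mult_ac)
    moreover have "sqrt (\<nu> / (2 * pi)) * sqrt (\<nu> / (2 * pi)) = \<nu> / (2 * pi)"
      using assms by simp
    moreover have "exp (- (\<nu> / 2) * (Re z)\<^sup>2) * exp (- (\<nu> / 2) * (Im z)\<^sup>2) = exp (- (\<nu> / 2) * (cmod z)\<^sup>2)"
      unfolding exp_add[symmetric] cmod_power2 by (simp add: algebra_simps)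
    ultimately show ?thesis by (simp only:)
  qed
  then have "(\<integral>\<^sup>+z. ennreal (\<nu> / (2 * pi) * exp (- (\<nu> / 2) * (cmod z)\<^sup>2)) \<partial>lborel)
      = (\<integral>\<^sup>+z. ennreal (\<Prod>b\<in>(Basis :: complex set). normal_density 0 ?s (z \<bullet> b)) \<partial>lborel)" by simp
  also have "\<dots> = (\<Prod>b\<in>(Basis :: complex set). (\<integral>\<^sup>+x. ennreal (normal_density 0 ?s x) \<partial>lborel))"
    by (subst nn_integral_lborel_prod[symmetric]) (auto simp: prod_ennreal)
  also have "\<dots> = 1" by (simp only: 1) simp
  finally show "emeasure (gauss_shell \<nu>) (space (gauss_shell \<nu>)) = 1"
    by (simp add: gauss_shell_def emeasure_density)
qed

text \<open>The joint density \<open>?e\<close> depends on the pair only through its energy. Energy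
  conservation lets it be evaluated at the image point, and Lebesgue invariance does the
  rest.\<close>

lemma gauss_cayley_invariant:
  fixes F :: "complex \<Rightarrow> complex \<Rightarrow> ennreal"
  assumes F[measurable]: "case_prod F \<in> borel_measurable (borel \<Otimes>\<^sub>M borel)" and "0 < \<nu>"
  shows "(\<integral>\<^sup>+w. \<integral>\<^sup>+z. F (cayley c z w) (cayley (cnj c) w z) \<partial>gauss_shell \<nu> \<partial>gauss_shell \<nu>)
    = (\<integral>\<^sup>+w. \<integral>\<^sup>+z. F z w \<partial>gauss_shell \<nu> \<partial>gauss_shell \<nu>)"
proof -
  let ?d = "\<lambda>z::complex. ennreal (\<nu> / (2 * pi) * exp (- (\<nu> / 2) * (cmod z)\<^sup>2))"
  let ?e = "\<lambda>z w. ennreal ((\<nu> / (2 * pi))\<^sup>2 * exp (- (\<nu> / 2) * ((cmod z)\<^sup>2 + (cmod w)\<^sup>2)))"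
  have cm[measurable]: "(\<lambda>x. cayley c (fst x) (snd x)) \<in> borel_measurable (borel \<Otimes>\<^sub>M borel)"
    "(\<lambda>x. cayley (cnj c) (snd x) (fst x)) \<in> borel_measurable (borel \<Otimes>\<^sub>M borel)"
    unfolding cayley_def by measurable
  have [measurable]: "(\<lambda>x. F (cayley c (fst x) (snd x)) (cayley (cnj c) (snd x) (fst x))) \<in> borel_measurable (borel \<Otimes>\<^sub>M borel)"
    using measurable_compose[OF measurable_Pair[OF cm] F] by simp
  have e: "?d w * (?d z * x) = ?e z w * x" for z w x
    using assms(2) unfolding mult.assoc[symmetric]
    by (subst ennreal_mult[symmetric]) (auto simp: power2_eq_square exp_add[symmetric] algebra_simps)
  have G: "(\<integral>\<^sup>+w. \<integral>\<^sup>+z. G z w \<partial>gauss_shell \<nu> \<partial>gauss_shell \<nu>) = (\<integral>\<^sup>+w. \<integral>\<^sup>+z. ?e z w * G z w \<partial>lborel \<partial>lborel)"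
    if G[measurable]: "(\<lambda>x. G (fst x) (snd x)) \<in> borel_measurable (borel \<Otimes>\<^sub>M borel)" for G :: "complex \<Rightarrow> complex \<Rightarrow> ennreal"
  proof -
    have Gw[measurable]: "(\<lambda>z. G z w) \<in> borel_measurable borel" for w
      using measurable_compose[OF _ G, of "\<lambda>z. (z, w)" borel] by simp
    have [measurable]: "(\<lambda>x. G (snd x) (fst x)) \<in> borel_measurable (borel \<Otimes>\<^sub>M borel)"
      using measurable_compose[OF measurable_Pair[OF measurable_snd measurable_fst] G] by simp
    have [measurable]: "(\<lambda>w. \<integral>\<^sup>+z. ?d z * G z w \<partial>lborel) \<in> borel_measurable borel"
      using G by (intro lborel.borel_measurable_nn_integral) (simp add: split_beta' , measurable)
    have "(\<integral>\<^sup>+w. \<integral>\<^sup>+z. G z w \<partial>gauss_shell \<nu> \<partial>gauss_shell \<nu>) = (\<integral>\<^sup>+w. \<integral>\<^sup>+z. ?d z * G z w \<partial>lborel \<partial>gauss_shell \<nu>)"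
      by (simp add: nn_integral_gauss_shell)
    also have "\<dots> = (\<integral>\<^sup>+w. ?d w * \<integral>\<^sup>+z. ?d z * G z w \<partial>lborel \<partial>lborel)"
      by (rule nn_integral_gauss_shell) measurable
    also have "\<dots> = (\<integral>\<^sup>+w. \<integral>\<^sup>+z. ?d w * (?d z * G z w) \<partial>lborel \<partial>lborel)"
      by (intro nn_integral_cong nn_integral_cmult[symmetric]) measurable
    finally show ?thesis by (simp only: e)
  qed
  have "(\<integral>\<^sup>+w. \<integral>\<^sup>+z. F (cayley c z w) (cayley (cnj c) w z) \<partial>gauss_shell \<nu> \<partial>gauss_shell \<nu>) =
     (\<integral>\<^sup>+w. \<integral>\<^sup>+z. ?e (cayley c z w) (cayley (cnj c) w z) * F (cayley c z w) (cayley (cnj c) w z) \<partial>lborel \<partial>lborel)"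
    unfolding cayley_energy by (rule G) measurable
  also have "\<dots> = (\<integral>\<^sup>+w. \<integral>\<^sup>+z. ?e z w * F z w \<partial>lborel \<partial>lborel)"
    by (rule lborel_cayley_invariant[of "\<lambda>z w. ?e z w * F z w"]) measurable
  also have "\<dots> = (\<integral>\<^sup>+w. \<integral>\<^sup>+z. F z w \<partial>gauss_shell \<nu> \<partial>gauss_shell \<nu>)"
    by (rule G[symmetric]) measurable
  finally show ?thesis .
qed

lemma sets_mu [measurable_cong]: "sets (mu \<nu>) = sets (PiM {1..} (\<lambda>_. borel :: complex measure))"
  unfolding mu_def by (intro sets_PiM_cong) auto

lemma prob_space_mu: "0 < \<nu> \<Longrightarrow> prob_space (mu \<nu>)"
  unfolding mu_def by (intro prob_space_PiM prob_space_gauss_shell)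

lemma measurable_mu_component: "1 \<le> n \<Longrightarrow> (\<lambda>u. u n) \<in> borel_measurable (mu \<nu>)"
  unfolding measurable_cong_sets[OF sets_mu refl] by (rule measurable_component_singleton) simp

lemma measurable_muI:
  assumes "\<And>n. 1 \<le> n \<Longrightarrow> (\<lambda>x. f x n) \<in> borel_measurable M" "\<And>x. x \<in> space M \<Longrightarrow> f x \<in> extensional {1..}"
  shows "f \<in> measurable M (mu \<nu>)"
  unfolding measurable_cong_sets[OF refl sets_mu]
  by (rule measurable_PiM_single') (use assms in \<open>auto simp: PiE_def\<close>)

lemma space_mu: "space (mu \<nu>) = extensional {1..}"
  by (simp add: mu_def space_PiM PiE_def)

lemma borel_measurable_cnj: "cnj \<in> borel_measurable borel"
  by (intro borel_measurable_continuous_onI continuous_intros)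

lemma measurable_cayley:
  assumes "f \<in> borel_measurable M" "g \<in> borel_measurable M" "h \<in> borel_measurable M"
  shows "(\<lambda>x. cayley (f x) (g x) (h x)) \<in> borel_measurable M"
  unfolding cayley_def using assms measurable_compose[OF assms(1) borel_measurable_cnj] by measurable

definition triad :: "nat \<Rightarrow> nat \<Rightarrow> nat \<Rightarrow> real \<Rightarrow> (nat \<Rightarrow> complex) \<Rightarrow> nat \<Rightarrow> complex" where
  "triad p r q th u = u(p := cayley (of_real th * u r) (u p) (u q), q := cayley (cnj (of_real th * u r)) (u q) (u p))"

lemma measurable_triad [measurable]:
  assumes "1 \<le> p" "1 \<le> r" "1 \<le> q"
  shows "triad p r q th \<in> measurable (mu \<nu>) (mu \<nu>)"
proof (rule measurable_muI)
  fix n :: nat assume n: "1 \<le> n"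
  note c = measurable_mu_component[OF assms(1)] measurable_mu_component[OF assms(2)] measurable_mu_component[OF assms(3)]
  have 1: "(\<lambda>x. cayley (of_real th * x r) (x p) (x q)) \<in> borel_measurable (mu \<nu>)"
    by (intro measurable_cayley borel_measurable_times borel_measurable_const c)
  have 2: "(\<lambda>x. cayley (cnj (of_real th * x r)) (x q) (x p)) \<in> borel_measurable (mu \<nu>)"
    by (intro measurable_cayley measurable_compose[OF _ borel_measurable_cnj] borel_measurable_times borel_measurable_const c)
  show "(\<lambda>x. triad p r q th x n) \<in> borel_measurable (mu \<nu>)"
  proof (cases "n = q")
    case True
    with 2 show ?thesis by (simp add: triad_def)
  next
    case False
    with 1 measurable_mu_component[OF n] show ?thesis by (cases "n = p") (simp_all add: triad_def)
  qed
qed (use assms in \<open>auto simp: triad_def space_mu extensional_def\<close>)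

text \<open>Shells p and q are peeled off the infinite product one at a time. All others, including
  the shell that will drive the rotation, are fixed in the outer integral.\<close>

lemma nn_integral_mu_split:
  assumes pq: "1 \<le> p" "1 \<le> q" "p \<noteq> q" and \<nu>: "0 < \<nu>" and f[measurable]: "f \<in> borel_measurable (mu \<nu>)"
  shows "(\<integral>\<^sup>+u. f u \<partial>mu \<nu>) =
    (\<integral>\<^sup>+X. \<integral>\<^sup>+w. \<integral>\<^sup>+z. f (X(q := w, p := z)) \<partial>gauss_shell \<nu> \<partial>gauss_shell \<nu> \<partial>PiM ({1..} - {p, q}) (\<lambda>_. gauss_shell \<nu>))"
proof -
  let ?G = "gauss_shell \<nu>"
  interpret G: prob_space ?G by (rule prob_space_gauss_shell[OF \<nu>])
  have step: "(\<integral>\<^sup>+u. g u \<partial>PiM (insert i I) (\<lambda>_. ?G)) = (\<integral>\<^sup>+X. \<integral>\<^sup>+z. g (X(i := z)) \<partial>?G \<partial>PiM I (\<lambda>_. ?G))"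
    if g[measurable]: "g \<in> borel_measurable (PiM (insert i I) (\<lambda>_. ?G))" for g :: "_ \<Rightarrow> ennreal" and i :: nat and I
  proof -
    interpret P: prob_space "PiM I (\<lambda>_. ?G)" by (intro prob_space_PiM prob_space_gauss_shell \<nu>)
    interpret pair_sigma_finite ?G "PiM I (\<lambda>_. ?G)" by standard
    have m[measurable]: "(\<lambda>x. (snd x)(i := fst x)) \<in> measurable (?G \<Otimes>\<^sub>M PiM I (\<lambda>_. ?G)) (PiM (insert i I) (\<lambda>_. ?G))"
      by (rule measurable_fun_upd[where J = I]) auto
    have "(\<integral>\<^sup>+u. g u \<partial>PiM (insert i I) (\<lambda>_. ?G)) =
        (\<integral>\<^sup>+u. g u \<partial>distr (?G \<Otimes>\<^sub>M PiM I (\<lambda>_. ?G)) (PiM (insert i I) (\<lambda>_. ?G)) (\<lambda>(x, X). X(i := x)))"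
      by (subst distr_pair_PiM_eq_PiM) (auto intro: prob_space_gauss_shell \<nu>)
    also have "\<dots> = (\<integral>\<^sup>+x. g ((snd x)(i := fst x)) \<partial>(?G \<Otimes>\<^sub>M PiM I (\<lambda>_. ?G)))"
      by (subst nn_integral_distr) (auto simp: split_beta')
    also have "\<dots> = (\<integral>\<^sup>+X. \<integral>\<^sup>+z. g (X(i := z)) \<partial>?G \<partial>PiM I (\<lambda>_. ?G))"
      by (subst nn_integral_snd[symmetric]) auto
    finally show ?thesis .
  qed
  let ?I = "{1..} - {p, q}"
  have I: "insert p (insert q ?I) = {1..}" using pq by auto
  have f': "f \<in> borel_measurable (PiM (insert p (insert q ?I)) (\<lambda>_. ?G))"
    using f unfolding mu_def I .
  have [measurable]: "(\<lambda>X. \<integral>\<^sup>+z. f (X(p := z)) \<partial>?G) \<in> borel_measurable (PiM (insert q ?I) (\<lambda>_. ?G))"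
  proof (rule G.borel_measurable_nn_integral)
    have "(\<lambda>x. (fst x)(p := snd x)) \<in> measurable (PiM (insert q ?I) (\<lambda>_. ?G) \<Otimes>\<^sub>M ?G) (PiM (insert p (insert q ?I)) (\<lambda>_. ?G))"
      by (rule measurable_fun_upd[where J = "insert q ?I"]) auto
    from measurable_compose[OF this f']
    show "(\<lambda>(X, z). f (X(p := z))) \<in> borel_measurable (PiM (insert q ?I) (\<lambda>_. ?G) \<Otimes>\<^sub>M ?G)" by (simp add: split_beta')
  qed
  have "(\<integral>\<^sup>+u. f u \<partial>mu \<nu>) = (\<integral>\<^sup>+u. f u \<partial>PiM (insert p (insert q ?I)) (\<lambda>_. ?G))"
    unfolding mu_def I ..
  also have "\<dots> = (\<integral>\<^sup>+X. \<integral>\<^sup>+z. f (X(p := z)) \<partial>?G \<partial>PiM (insert q ?I) (\<lambda>_. ?G))"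
    by (rule step[OF f'])
  also have "\<dots> = (\<integral>\<^sup>+X. \<integral>\<^sup>+w. \<integral>\<^sup>+z. f (X(q := w, p := z)) \<partial>?G \<partial>?G \<partial>PiM ?I (\<lambda>_. ?G))"
    by (rule step) measurable
  finally show ?thesis .
qed

text \<open>Since r differs from p and q, the coefficient \<open>of_real th * X r\<close> is
  constant in the two inner integrals, where the map is then a single Cayley transform.\<close>

lemma distr_triad:
  assumes prq: "1 \<le> p" "1 \<le> r" "1 \<le> q" and ne: "p \<noteq> q" "p \<noteq> r" "q \<noteq> r" and \<nu>: "0 < \<nu>"
  shows "distr (mu \<nu>) (mu \<nu>) (triad p r q th) = mu \<nu>"
proof (rule measure_eqI)
  let ?G = "gauss_shell \<nu>" and ?I = "{1..} - {p, q}"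
  have T[measurable]: "triad p r q th \<in> measurable (mu \<nu>) (mu \<nu>)" using prq by (rule measurable_triad)
  fix A assume "A \<in> sets (distr (mu \<nu>) (mu \<nu>) (triad p r q th))"
  then have A[measurable]: "A \<in> sets (mu \<nu>)" by simp
  let ?f = "indicator A :: _ \<Rightarrow> ennreal"
  have upd: "triad p r q th (X(q := w, p := z)) =
      X(q := cayley (cnj (of_real th * X r)) w z, p := cayley (of_real th * X r) z w)" for X w z
    using ne by (auto simp: triad_def fun_eq_iff)
  have "emeasure (distr (mu \<nu>) (mu \<nu>) (triad p r q th)) A = (\<integral>\<^sup>+u. ?f u \<partial>distr (mu \<nu>) (mu \<nu>) (triad p r q th))"
    by simp
  also have "\<dots> = (\<integral>\<^sup>+u. ?f (triad p r q th u) \<partial>mu \<nu>)"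
    by (rule nn_integral_distr) measurable
  also have "\<dots> = (\<integral>\<^sup>+X. \<integral>\<^sup>+w. \<integral>\<^sup>+z. ?f (triad p r q th (X(q := w, p := z))) \<partial>?G \<partial>?G \<partial>PiM ?I (\<lambda>_. ?G))"
    by (rule nn_integral_mu_split) (use prq ne \<nu> in auto)
  also have "\<dots> = (\<integral>\<^sup>+X. \<integral>\<^sup>+w. \<integral>\<^sup>+z. ?f (X(q := w, p := z)) \<partial>?G \<partial>?G \<partial>PiM ?I (\<lambda>_. ?G))"
    unfolding upd
  proof (rule nn_integral_cong)
    fix X assume "X \<in> space (PiM ?I (\<lambda>_. ?G))"
    then have X: "X \<in> extensional ?I" by (simp add: space_PiM PiE_def)
    have "(\<lambda>x. X(q := snd x, p := fst x)) \<in> measurable (borel \<Otimes>\<^sub>M borel) (mu \<nu>)"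
    proof (rule measurable_muI)
      show "(\<lambda>x. (X(q := snd x, p := fst x)) n) \<in> borel_measurable (borel \<Otimes>\<^sub>M borel)" for n
        unfolding fun_upd_def by measurable
    qed (use X prq in \<open>auto simp: extensional_def\<close>)
    from measurable_compose[OF this, of ?f borel]
    have "(\<lambda>(z, w). ?f (X(q := w, p := z))) \<in> borel_measurable (borel \<Otimes>\<^sub>M borel)"
      by (simp add: split_beta')
    from gauss_cayley_invariant[OF this \<nu>, of "of_real th * X r"]
    show "(\<integral>\<^sup>+w. \<integral>\<^sup>+z. ?f (X(q := cayley (cnj (of_real th * X r)) w z, p := cayley (of_real th * X r) z w)) \<partial>?G \<partial>?G)
      = (\<integral>\<^sup>+w. \<integral>\<^sup>+z. ?f (X(q := w, p := z)) \<partial>?G \<partial>?G)" .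
  qed
  also have "\<dots> = (\<integral>\<^sup>+u. ?f u \<partial>mu \<nu>)"
    by (rule nn_integral_mu_split[symmetric]) (use prq ne \<nu> in auto)
  finally show "emeasure (distr (mu \<nu>) (mu \<nu>) (triad p r q th)) A = emeasure (mu \<nu>) A" by simp
qed simp

section \<open>Moments of the Gaussian shells\<close>

definition moment :: "real \<Rightarrow> nat \<Rightarrow> ennreal" where
  "moment \<nu> p = (\<integral>\<^sup>+z. ennreal (cmod z ^ p) \<partial>gauss_shell \<nu>)"

lemma power_le_fact_exp: "0 \<le> x \<Longrightarrow> x ^ p \<le> fact p * exp (x::real)"
proof -
  assume x: "0 \<le> x"
  have "(\<Sum>n\<in>{p}. x ^ n /\<^sub>R fact n) \<le> (\<Sum>n. x ^ n /\<^sub>R fact n)"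
    using x by (intro sum_le_suminf summable_exp_generic) auto
  then have "x ^ p / fact p \<le> exp x" by (simp add: exp_def divide_inverse mult.commute)
  then show ?thesis by (simp add: pos_divide_le_eq mult.commute)
qed

text \<open>Half of the Gaussian exponent absorbs the power: x^p is at most p! exp x, and completing
  the square bounds x by \<nu> x^2/4 + 1/\<nu>. What remains is a multiple of the density with
  parameter \<nu>/2, of total mass 1; the 2 in \<open>2 * ?C\<close> corrects the normalising
  factor.\<close>

lemma moment_finite:
  assumes \<nu>: "0 < \<nu>"
  shows "moment \<nu> p < \<infinity>"
proof -
  let ?C = "fact p * exp (1 / \<nu>)"
  have le: "exp (- (\<nu> / 2) * x\<^sup>2) * x ^ p \<le> ?C * exp (- (\<nu> / 4) * x\<^sup>2)" if x: "0 \<le> x" for x :: real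
  proof -
    have "\<nu> / 4 * x\<^sup>2 + 1 / \<nu> - x = (\<nu> * x / 2 - 1)\<^sup>2 / \<nu>"
      using \<nu> by (simp add: power2_eq_square field_simps)
    also have "\<dots> \<ge> 0" using \<nu> by simp
    finally have *: "x \<le> \<nu> / 4 * x\<^sup>2 + 1 / \<nu>" by simp
    have "exp (- (\<nu> / 2) * x\<^sup>2) * x ^ p \<le> exp (- (\<nu> / 2) * x\<^sup>2) * (fact p * exp (\<nu> / 4 * x\<^sup>2 + 1 / \<nu>))"
      using power_le_fact_exp[OF x, of p] * by (intro mult_left_mono) (auto elim!: order_trans)
    also have "\<dots> = ?C * exp (- (\<nu> / 4) * x\<^sup>2)"
      by (simp add: exp_add[symmetric] mult_ac)
    finally show ?thesis .
  qed
  have "moment \<nu> p = (\<integral>\<^sup>+z. ennreal (\<nu> / (2 * pi) * exp (- (\<nu> / 2) * (cmod z)\<^sup>2)) * ennreal (cmod z ^ p) \<partial>lborel)"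
    unfolding moment_def by (rule nn_integral_gauss_shell) measurable
  also have "\<dots> \<le> (\<integral>\<^sup>+z. ennreal (2 * ?C) * ennreal (\<nu> / 2 / (2 * pi) * exp (- (\<nu> / 2 / 2) * (cmod z)\<^sup>2)) \<partial>lborel)"
  proof (rule nn_integral_mono)
    fix z :: complex
    have "\<nu> / (2 * pi) * (exp (- (\<nu> / 2) * (cmod z)\<^sup>2) * cmod z ^ p) \<le> \<nu> / (2 * pi) * (?C * exp (- (\<nu> / 4) * (cmod z)\<^sup>2))"
      using \<nu> by (intro mult_left_mono le) auto
    then show "ennreal (\<nu> / (2 * pi) * exp (- (\<nu> / 2) * (cmod z)\<^sup>2)) * ennreal (cmod z ^ p)
      \<le> ennreal (2 * ?C) * ennreal (\<nu> / 2 / (2 * pi) * exp (- (\<nu> / 2 / 2) * (cmod z)\<^sup>2))"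
      using \<nu> by (subst (1 2) ennreal_mult[symmetric]) (auto simp: ennreal_leI mult_ac)
  qed
  also have "\<dots> = ennreal (2 * ?C) * (\<integral>\<^sup>+z. ennreal (\<nu> / 2 / (2 * pi) * exp (- (\<nu> / 2 / 2) * (cmod z)\<^sup>2)) \<partial>lborel)"
    by (rule nn_integral_cmult) measurable
  also have "(\<integral>\<^sup>+z. ennreal (\<nu> / 2 / (2 * pi) * exp (- (\<nu> / 2 / 2) * (cmod z)\<^sup>2)) \<partial>lborel) = 1"
    using prob_space.emeasure_space_1[OF prob_space_gauss_shell[of "\<nu> / 2"]] \<nu>
    unfolding gauss_shell_def by (simp add: emeasure_density)
  finally show ?thesis by (auto simp: le_less_trans)
qed

lemma nn_integral_mu_component:
  assumes \<nu>: "0 < \<nu>" and n: "1 \<le> n"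
  shows "(\<integral>\<^sup>+u. ennreal (cmod (u n) ^ p) \<partial>mu \<nu>) = moment \<nu> p"
proof -
  have "moment \<nu> p = (\<integral>\<^sup>+z. ennreal (cmod z ^ p) \<partial>distr (mu \<nu>) (gauss_shell \<nu>) (\<lambda>u. u n))"
    unfolding moment_def mu_def using n by (subst distr_PiM_component) (auto intro: prob_space_gauss_shell \<nu>)
  also have "\<dots> = (\<integral>\<^sup>+u. ennreal (cmod (u n) ^ p) \<partial>mu \<nu>)"
    using measurable_mu_component[OF n] by (intro nn_integral_distr) (auto cong: measurable_cong_sets)
  finally show ?thesis ..
qed

section \<open>The splitting scheme\<close>

text \<open>In the scheme c is the time step times a coefficient times a Gaussian shell, hence
  unbounded, so the errors of first and second order have to be controlled for every c. The
  denominator 1 + s tames large c, through x \<le> 1 + s for x = |c| and s = x^2/4.\<close>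

lemma cayley_diff_le: "cmod (cayley c z w - z) \<le> cmod c * (cmod z + cmod w)"
  and cayley_Taylor_le: "cmod (cayley c z w - z - \<i> * cnj c * w) \<le> (cmod c)\<^sup>2 * (cmod z + cmod w)"
proof -
  define x where "x = cmod c"
  define s where "s = x\<^sup>2 / 4"
  have x: "0 \<le> x" by (simp add: x_def)
  have s: "0 \<le> s" by (simp add: s_def)
  have ne: "(1 + of_real s :: complex) \<noteq> 0"
    using s by (metis add_nonneg_eq_0_iff of_real_1 of_real_add of_real_eq_0_iff zero_le_one zero_neq_one)
  have n1: "cmod (1 + of_real s) = 1 + s"
    using s norm_of_real[of "1 + s", where 'a = complex] by simp
  have c: "cayley c z w = ((1 - of_real s) * z + \<i> * cnj c * w) / (1 + of_real s)"
    by (simp add: cayley_def s_def x_def)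
  have sq: "0 \<le> (x / 2 - 1)\<^sup>2" "0 \<le> (x - 2)\<^sup>2" by simp_all
  have x2: "x\<^sup>2 = 4 * s" by (simp add: s_def)
  have xs: "x \<le> 1 + s" using sq(1) by (simp add: s_def power2_eq_square algebra_simps)
  have "cayley c z w - z = (- (2 * of_real s) * z + \<i> * cnj c * w) / (1 + of_real s)"
    unfolding c using ne by (simp add: field_simps)
  then have "cmod (cayley c z w - z) \<le> (2 * s * cmod z + x * cmod w) / (1 + s)"
    using s norm_triangle_ineq[of "- (2 * of_real s) * z" "\<i> * cnj c * w"]
    by (simp add: norm_divide norm_mult n1 divide_right_mono x_def)
  also have "\<dots> \<le> x * (cmod z + cmod w)"
  proof -
    have "2 * s = x * x / 2" by (simp add: s_def power2_eq_square)
    also have "\<dots> \<le> x * (1 + s)" using mult_left_mono[OF xs x] mult_nonneg_nonneg[OF x x] by linarith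
    finally have "2 * s * cmod z \<le> x * (1 + s) * cmod z" by (intro mult_right_mono) auto
    moreover have "x * cmod w \<le> x * (1 + s) * cmod w" using x s by (intro mult_right_mono) (auto simp: distrib_left)
    ultimately have "2 * s * cmod z + x * cmod w \<le> x * (cmod z + cmod w) * (1 + s)" by (simp add: algebra_simps)
    then show ?thesis using s by (simp add: pos_divide_le_eq)
  qed
  finally show "cmod (cayley c z w - z) \<le> cmod c * (cmod z + cmod w)" by (simp add: x_def)
  have "cayley c z w - z - \<i> * cnj c * w = - (of_real s * (2 * z + \<i> * cnj c * w)) / (1 + of_real s)"
    unfolding c using ne by (simp add: field_simps)
  then have "cmod (cayley c z w - z - \<i> * cnj c * w) = s * cmod (2 * z + \<i> * cnj c * w) / (1 + s)"
    using s by (simp add: norm_divide norm_mult n1)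
  also have "\<dots> \<le> s * (2 * cmod z + x * cmod w) / (1 + s)"
    using s norm_triangle_ineq[of "2 * z" "\<i> * cnj c * w"]
    by (intro divide_right_mono mult_left_mono) (auto simp: norm_mult x_def)
  also have "\<dots> \<le> x\<^sup>2 * (cmod z + cmod w)"
  proof -
    have "2 * cmod z + x * cmod w \<le> 4 * (1 + s) * cmod z + (1 + s) * cmod w"
      using s xs by (intro add_mono mult_right_mono) auto
    also have "\<dots> \<le> 4 * (cmod z + cmod w) * (1 + s)"
      using s by (simp add: algebra_simps)
    finally have "s * (2 * cmod z + x * cmod w) \<le> s * (4 * (cmod z + cmod w) * (1 + s))"
      using s by (intro mult_left_mono)
    also have "\<dots> = x\<^sup>2 * (cmod z + cmod w) * (1 + s)" by (simp add: x2)
    finally show ?thesis using s by (simp add: pos_divide_le_eq)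
  qed
  finally show "cmod (cayley c z w - z - \<i> * cnj c * w) \<le> (cmod c)\<^sup>2 * (cmod z + cmod w)" by (simp add: x_def)
qed

section \<open>Bounds for integrals and for sums over shells\<close>

lemma nn_integral_le_linear:
  assumes [measurable]: "f \<in> borel_measurable M" "g \<in> borel_measurable M"
    and f: "\<And>u. 0 \<le> f u" "(\<integral>\<^sup>+u. ennreal (f u) \<partial>M) \<le> ennreal F"
    and g: "\<And>u. 0 \<le> g u" "(\<integral>\<^sup>+u. ennreal (g u) \<partial>M) \<le> ennreal G"
    and nn: "0 \<le> c" "0 \<le> F" "0 \<le> G"
  shows "(\<integral>\<^sup>+u. ennreal (c * f u + g u) \<partial>M) \<le> ennreal (c * F + G)"
proof -
  have "(\<integral>\<^sup>+u. ennreal (c * f u + g u) \<partial>M) = (\<integral>\<^sup>+u. ennreal c * ennreal (f u) + ennreal (g u) \<partial>M)"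
    using f(1) g(1) nn by (intro nn_integral_cong) (simp add: ennreal_plus ennreal_mult)
  also have "\<dots> = ennreal c * (\<integral>\<^sup>+u. ennreal (f u) \<partial>M) + (\<integral>\<^sup>+u. ennreal (g u) \<partial>M)"
    by (simp add: nn_integral_add nn_integral_cmult)
  also have "\<dots> \<le> ennreal c * ennreal F + ennreal G"
    by (intro add_mono mult_left_mono f g) simp
  also have "\<dots> = ennreal (c * F + G)" using nn by (simp add: ennreal_plus ennreal_mult)
  finally show ?thesis .
qed

lemma nn_integral_le_sum:
  assumes [measurable]: "\<And>i. i \<in> I \<Longrightarrow> f i \<in> borel_measurable M"
    and f: "\<And>i u. i \<in> I \<Longrightarrow> 0 \<le> f i u" "\<And>i. i \<in> I \<Longrightarrow> (\<integral>\<^sup>+u. ennreal (f i u) \<partial>M) \<le> ennreal F" and F: "0 \<le> F"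
  shows "(\<integral>\<^sup>+u. ennreal (\<Sum>i\<in>I. f i u) \<partial>M) \<le> ennreal (real (card I) * F)"
proof -
  have "(\<integral>\<^sup>+u. ennreal (\<Sum>i\<in>I. f i u) \<partial>M) = (\<integral>\<^sup>+u. (\<Sum>i\<in>I. ennreal (f i u)) \<partial>M)"
    using f(1) by (intro nn_integral_cong) (simp add: sum_ennreal)
  also have "\<dots> = (\<Sum>i\<in>I. \<integral>\<^sup>+u. ennreal (f i u) \<partial>M)"
    by (rule nn_integral_sum) measurable
  also have "\<dots> \<le> (\<Sum>i\<in>I. ennreal F)" by (intro sum_mono f)
  also have "\<dots> = ennreal (real (card I) * F)" using F by (simp add: ennreal_mult ennreal_of_nat_eq_real_of_nat)
  finally show ?thesis .
qed

text \<open>Products of different shells are separated into powers of single shells, because the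
  moment bounds draw only on the law of one shell at a time.\<close>

lemma square_mult_le_cubes:
  fixes x y :: real
  assumes "0 \<le> x" "0 \<le> y"
  shows "x\<^sup>2 * y \<le> x ^ 3 + y ^ 3"
proof (cases "x \<le> y")
  case True
  then have "x\<^sup>2 * y \<le> y\<^sup>2 * y" using assms by (intro mult_right_mono power_mono) auto
  then show ?thesis using assms by (simp add: power2_eq_square power3_eq_cube add_increasing)
next
  case False
  then have "x\<^sup>2 * y \<le> x\<^sup>2 * x" using assms by (intro mult_left_mono) auto
  then show ?thesis using assms by (simp add: power2_eq_square power3_eq_cube add_increasing2)
qed

lemma suminf_inverse_squares:
  assumes "0 \<le> c"
  shows "(\<Sum>n. ennreal (c / (real (Suc n))\<^sup>2)) = ennreal (c * (\<Sum>n. 1 / (real (Suc n))\<^sup>2))"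
    "0 \<le> (\<Sum>n. 1 / (real (Suc n))\<^sup>2)"
proof -
  have s: "summable (\<lambda>n. 1 / (real (Suc n))\<^sup>2)"
    using inverse_power_summable[of 2, where 'a = real] by (subst summable_Suc_iff) (simp add: inverse_eq_divide)
  have "(\<lambda>n. c * (1 / (real (Suc n))\<^sup>2)) sums (c * (\<Sum>n. 1 / (real (Suc n))\<^sup>2))"
    by (intro sums_mult summable_sums s)
  then show "(\<Sum>n. ennreal (c / (real (Suc n))\<^sup>2)) = ennreal (c * (\<Sum>n. 1 / (real (Suc n))\<^sup>2))"
    using assms by (intro suminf_ennreal_eq) simp_all
  show "0 \<le> (\<Sum>n. 1 / (real (Suc n))\<^sup>2)" by (intro suminf_nonneg s) simp
qed

lemma ennreal_suminf_term_le: "f n \<le> (\<Sum>n. f n :: ennreal)"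
  using sum_le_suminf[of f "{n}"] by simp

text \<open>The nonlinearity splits into two families of conservative triad interactions. Those with base
  \<open>m = i div 2 + 1\<close> carry the coefficient \<open>a\<close> for even \<open>i\<close> and \<open>b\<close> for odd \<open>i\<close>; shell \<open>tr i\<close>
  rotates the pair of shells \<open>tp i\<close>, \<open>tq i\<close>.\<close>
definition tp :: "nat \<Rightarrow> nat" where "tp i = (if even i then i div 2 + 1 else i div 2 + 2)"
definition tr :: "nat \<Rightarrow> nat" where "tr i = (if even i then i div 2 + 2 else i div 2 + 1)"
definition tq :: "nat \<Rightarrow> nat" where "tq i = i div 2 + 3"
definition tv :: "nat \<Rightarrow> nat \<Rightarrow> nat" where "tv i l = (if l = 0 then tp i else if l = 1 then tr i else tq i)"

lemma triad_shells: "1 \<le> tp i" "1 \<le> tr i" "1 \<le> tq i" "tp i \<noteq> tq i" "tp i \<noteq> tr i" "tq i \<noteq> tr i" "1 \<le> tv i l"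
  by (auto simp: tp_def tr_def tq_def tv_def)

lemma sum_tv: "(\<Sum>l<3. f (tv i l)) = f (tp i) + f (tr i) + f (tq i)"
  by (simp add: numeral_3_eq_3 tv_def)

locale shell_scheme =
  fixes k0 lam a b \<nu> :: real
  assumes k0: "0 < k0" and lam: "1 < lam" and \<nu>: "0 < \<nu>"
begin

abbreviation k :: "nat \<Rightarrow> real" where
  "k \<equiv> shell_k k0 lam"

abbreviation B :: "(nat \<Rightarrow> complex) \<Rightarrow> nat \<Rightarrow> complex" where
  "B u n \<equiv> sabraB k0 lam a b u u n"

abbreviation E :: "((nat \<Rightarrow> complex) \<Rightarrow> ennreal) \<Rightarrow> ennreal" where
  "E \<equiv> nn_integral (mu \<nu>)"

lemma k_pos: "0 < k n"
  using k0 lam by (simp add: shell_k_def)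

lemma k_mono: "m \<le> n \<Longrightarrow> k m \<le> k n"
  using k0 lam by (simp add: shell_k_def power_increasing)

section \<open>The rotations, their sum and their errors\<close>

definition tc :: "nat \<Rightarrow> real" where
  "tc i = (if even i then a else b) * k (i div 2 + 2)"

definition sub :: "real \<Rightarrow> nat \<Rightarrow> (nat \<Rightarrow> complex) \<Rightarrow> nat \<Rightarrow> complex" where
  "sub h i = triad (tp i) (tr i) (tq i) (h * tc i)"

primrec stage :: "real \<Rightarrow> nat \<Rightarrow> (nat \<Rightarrow> complex) \<Rightarrow> nat \<Rightarrow> complex" where
  "stage h 0 u = u"
| "stage h (Suc i) u = sub h i (stage h i u)"

definition field :: "nat \<Rightarrow> (nat \<Rightarrow> complex) \<Rightarrow> nat \<Rightarrow> complex" where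
  "field i u n = (if n = tp i then \<i> * cnj (of_real (tc i) * u (tr i)) * u (tq i)
     else if n = tq i then \<i> * (of_real (tc i) * u (tr i)) * u (tp i) else 0)"

text \<open>The factor \<open>lam\<close> is there because a rotation that moves shell n may carry
  the coefficient of shell n + 1, as when n is the lowest shell of the triad.\<close>

definition A :: real where "A = (\<bar>a\<bar> + \<bar>b\<bar>) * lam"

lemma A_nonneg: "0 \<le> A"
  using lam by (simp add: A_def)

text \<open>For n \<ge> 3, shell n is moved by the rotations 2n - 6 and 2n - 5 (as
  \<open>tq\<close>) and 2n - 3 and 2n - 2 (as \<open>tp\<close>). The index 2n - 4 between them has
  n as its driver and leaves it fixed; an interval is simpler than the exact set.\<close>

definition J :: "nat \<Rightarrow> nat set" where "J n = {2 * n - 6..2 * n - 2}"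

lemma card_J: "finite (J n)" "card (J n) \<le> 5"
  by (auto simp: J_def)

lemma mem_J: "n = tp i \<or> n = tq i \<Longrightarrow> i \<in> J n"
  by (auto simp: J_def tp_def tq_def elim!: evenE oddE)

lemma sub_eq: "n \<noteq> tp i \<Longrightarrow> n \<noteq> tq i \<Longrightarrow> sub h i u n = u n"
  by (simp add: sub_def triad_def)

lemma tc_le:
  assumes "n = tp i \<or> n = tq i"
  shows "\<bar>tc i\<bar> \<le> A * k n"
proof -
  have "i div 2 + 1 \<le> n" using assms by (auto simp: tp_def tq_def)
  then have "k (i div 2 + 2) \<le> k (Suc n)" by (intro k_mono) auto
  also have "k (Suc n) = lam * k n" by (simp add: shell_k_def)
  finally have k: "k (i div 2 + 2) \<le> lam * k n" .
  have "\<bar>tc i\<bar> = \<bar>if even i then a else b\<bar> * k (i div 2 + 2)"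
    using k_pos by (simp add: tc_def abs_mult less_imp_le)
  also have "\<dots> \<le> (\<bar>a\<bar> + \<bar>b\<bar>) * (lam * k n)"
    using k k_pos[of "i div 2 + 2"] by (intro mult_mono) auto
  finally show ?thesis by (simp add: A_def mult_ac)
qed

lemma sub_diff_le:
  assumes h: "0 \<le> h" and n: "n = tp i \<or> n = tq i"
  shows "cmod (sub h i u n - u n) \<le> h * (A * k n) * (\<Sum>l<3. (cmod (u (tv i l)))\<^sup>2)"
proof -
  let ?r = "cmod (u (tr i))" and ?p = "cmod (u (tp i))" and ?q = "cmod (u (tq i))"
  have "cmod (sub h i u n - u n) \<le> cmod (of_real (h * tc i) * u (tr i)) * (?p + ?q)"
    using n triad_shells[of i] cayley_diff_le[of "of_real (h * tc i) * u (tr i)" "u (tp i)" "u (tq i)"]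
      cayley_diff_le[of "cnj (of_real (h * tc i) * u (tr i))" "u (tq i)" "u (tp i)"]
    unfolding sub_def triad_def complex_mod_cnj by (auto simp: add.commute)
  also have "\<dots> = h * \<bar>tc i\<bar> * (?r * (?p + ?q))"
    using h by (simp add: norm_mult abs_mult)
  also have "\<dots> \<le> h * (A * k n) * (\<Sum>l<3. (cmod (u (tv i l)))\<^sup>2)"
  proof (rule mult_mono)
    show "h * \<bar>tc i\<bar> \<le> h * (A * k n)" using h tc_le[OF n] by (rule mult_left_mono[rotated])
    have "2 * (?r * ?p) \<le> ?r\<^sup>2 + ?p\<^sup>2" "2 * (?r * ?q) \<le> ?r\<^sup>2 + ?q\<^sup>2" "0 \<le> ?p\<^sup>2" "0 \<le> ?q\<^sup>2"
      using sum_squares_bound[of ?r ?p] sum_squares_bound[of ?r ?q] by simp_all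
    then show "?r * (?p + ?q) \<le> (\<Sum>l<3. (cmod (u (tv i l)))\<^sup>2)"
      unfolding sum_tv[of "\<lambda>m. (cmod (u m))\<^sup>2"] distrib_left by linarith
  qed (use h A_nonneg k_pos[of n] in \<open>auto intro!: mult_nonneg_nonneg simp: less_imp_le\<close>)
  finally show ?thesis .
qed

lemma sub_Taylor_le:
  assumes h: "0 \<le> h" and n: "n = tp i \<or> n = tq i"
  shows "cmod (sub h i u n - u n - of_real h * field i u n) \<le> 2 * (h * (A * k n))\<^sup>2 * (\<Sum>l<3. cmod (u (tv i l)) ^ 3)"
proof -
  let ?r = "cmod (u (tr i))" and ?p = "cmod (u (tp i))" and ?q = "cmod (u (tq i))"
  let ?c = "of_real (h * tc i) * u (tr i)"
  have "of_real h * field i u n = (if n = tp i then \<i> * cnj ?c * u (tq i) else \<i> * cnj (cnj ?c) * u (tp i))"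
    using n triad_shells[of i] by (auto simp: field_def)
  then have "cmod (sub h i u n - u n - of_real h * field i u n) \<le> (cmod ?c)\<^sup>2 * (?p + ?q)"
    using n triad_shells[of i] cayley_Taylor_le[of ?c "u (tp i)" "u (tq i)"]
      cayley_Taylor_le[of "cnj ?c" "u (tq i)" "u (tp i)"]
    unfolding sub_def triad_def complex_mod_cnj by (auto simp: add.commute)
  also have "\<dots> = (h * \<bar>tc i\<bar>)\<^sup>2 * (?r\<^sup>2 * (?p + ?q))"
    using h by (simp add: norm_mult abs_mult power_mult_distrib)
  also have "\<dots> \<le> (h * (A * k n))\<^sup>2 * (2 * (\<Sum>l<3. cmod (u (tv i l)) ^ 3))"
  proof (rule mult_mono)
    show "(h * \<bar>tc i\<bar>)\<^sup>2 \<le> (h * (A * k n))\<^sup>2"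
      using h tc_le[OF n] by (intro power_mono mult_left_mono) auto
    show "?r\<^sup>2 * (?p + ?q) \<le> 2 * (\<Sum>l<3. cmod (u (tv i l)) ^ 3)"
      using square_mult_le_cubes[OF norm_ge_zero norm_ge_zero, of "u (tr i)" "u (tp i)"]
        square_mult_le_cubes[OF norm_ge_zero norm_ge_zero, of "u (tr i)" "u (tq i)"]
        zero_le_power[OF norm_ge_zero, of "u (tp i)" 3] zero_le_power[OF norm_ge_zero, of "u (tq i)" 3]
      unfolding sum_tv[of "\<lambda>m. cmod (u m) ^ 3"] distrib_left by linarith
  qed auto
  finally show ?thesis by (simp add: mult_ac)
qed

text \<open>The weighted inequality h x y \<le> h^2 x^2 + y^2 is used with y a difference of states.
  In \<open>residual_le\<close> that difference arises within one step and is of order h in mean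
  square, so all terms have expectations of order h^2.\<close>

lemma field_diff_le:
  assumes h: "0 < h" and n: "n = tp i \<or> n = tq i"
  shows "h * cmod (field i u n - field i v n) \<le>
    A * k n * (\<Sum>l<3. h\<^sup>2 * (cmod (u (tv i l)))\<^sup>2 + h\<^sup>2 * (cmod (v (tv i l)))\<^sup>2 + (cmod (u (tv i l) - v (tv i l)))\<^sup>2)"
proof -
  define g where "g m = h\<^sup>2 * (cmod (u m))\<^sup>2 + h\<^sup>2 * (cmod (v m))\<^sup>2 + (cmod (u m - v m))\<^sup>2" for m
  have g: "0 \<le> g m" for m by (simp add: g_def)
  have amgm: "h * (x * y) \<le> h\<^sup>2 * x\<^sup>2 + y\<^sup>2" if "0 \<le> x" "0 \<le> y" for x y :: real
  proof -
    have "0 \<le> (h * x - y)\<^sup>2" "0 \<le> h * (x * y)" using that h by simp_all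
    then show ?thesis by (simp add: power2_eq_square algebra_simps)
  qed
  have prod: "h * cmod (u r * u x - v r * v x) \<le> g r + g x" "h * cmod (cnj (u r) * u x - cnj (v r) * v x) \<le> g r + g x" for r x
  proof -
    have le: "h * (cmod (u r - v r) * cmod (u x) + cmod (v r) * cmod (u x - v x)) \<le> g r + g x"
    proof -
      have "0 \<le> h\<^sup>2 * (cmod (u r))\<^sup>2" "0 \<le> h\<^sup>2 * (cmod (v x))\<^sup>2" by simp_all
      moreover have "h * (cmod (u r - v r) * cmod (u x)) \<le> h\<^sup>2 * (cmod (u x))\<^sup>2 + (cmod (u r - v r))\<^sup>2"
        using amgm[of "cmod (u x)" "cmod (u r - v r)"] by (simp add: mult.commute)
      ultimately show ?thesis
        using amgm[OF norm_ge_zero norm_ge_zero, of "v r" "u x - v x"] unfolding g_def distrib_left by linarith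
    qed
    have "u r * u x - v r * v x = (u r - v r) * u x + v r * (u x - v x)" by (simp add: algebra_simps)
    then have "cmod (u r * u x - v r * v x) \<le> cmod (u r - v r) * cmod (u x) + cmod (v r) * cmod (u x - v x)"
      by (metis norm_mult norm_triangle_ineq)
    then show "h * cmod (u r * u x - v r * v x) \<le> g r + g x"
      using mult_left_mono[OF _ less_imp_le[OF h]] le by (meson order_trans)
    have "cnj (u r) * u x - cnj (v r) * v x = cnj (u r - v r) * u x + cnj (v r) * (u x - v x)" by (simp add: algebra_simps)
    then have "cmod (cnj (u r) * u x - cnj (v r) * v x) \<le> cmod (u r - v r) * cmod (u x) + cmod (v r) * cmod (u x - v x)"
      by (metis norm_mult norm_triangle_ineq complex_mod_cnj)
    then show "h * cmod (cnj (u r) * u x - cnj (v r) * v x) \<le> g r + g x"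
      using mult_left_mono[OF _ less_imp_le[OF h]] le by (meson order_trans)
  qed
  have "field i u n - field i v n = \<i> * of_real (tc i) * (if n = tp i then cnj (u (tr i)) * u (tq i) - cnj (v (tr i)) * v (tq i)
      else u (tr i) * u (tp i) - v (tr i) * v (tp i))"
    using n by (auto simp: field_def algebra_simps)
  then have "h * cmod (field i u n - field i v n) = \<bar>tc i\<bar> * (h * cmod (if n = tp i then cnj (u (tr i)) * u (tq i) - cnj (v (tr i)) * v (tq i)
      else u (tr i) * u (tp i) - v (tr i) * v (tp i)))"
    by (simp add: norm_mult)
  also have "\<dots> \<le> \<bar>tc i\<bar> * (\<Sum>l<3. g (tv i l))"
  proof (rule mult_left_mono)
    show "h * cmod (if n = tp i then cnj (u (tr i)) * u (tq i) - cnj (v (tr i)) * v (tq i)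
      else u (tr i) * u (tp i) - v (tr i) * v (tp i)) \<le> (\<Sum>l<3. g (tv i l))"
      unfolding sum_tv using prod[of "tr i" "tp i"] prod[of "tr i" "tq i"] g[of "tp i"] g[of "tq i"] by auto
  qed simp
  also have "\<dots> \<le> A * k n * (\<Sum>l<3. g (tv i l))"
    by (intro mult_right_mono tc_le n sum_nonneg g)
  finally show ?thesis by (simp add: g_def)
qed

text \<open>Restricting to \<open>J n\<close> bounds the number of terms independently of M, hence
  of the number of rotations in a step.\<close>

lemma stage_telescope:
  "stage h M u n - u n = (\<Sum>i\<in>{..<M} \<inter> J n. if n = tp i \<or> n = tq i then sub h i (stage h i u) n - stage h i u n else 0)"
proof -
  let ?d = "\<lambda>i. sub h i (stage h i u) n - stage h i u n"
  have "stage h M u n - u n = (\<Sum>i<M. ?d i)"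
    using sum_lessThan_telescope[of "\<lambda>i. stage h i u n" M] by simp
  also have "\<dots> = (\<Sum>i<M. if n = tp i \<or> n = tq i then ?d i else 0)"
    by (intro sum.cong refl) (auto simp: sub_eq)
  also have "\<dots> = (\<Sum>i\<in>{..<M} \<inter> J n. if n = tp i \<or> n = tq i then ?d i else 0)"
    by (intro sum.mono_neutral_right) (use mem_J in auto)
  finally show ?thesis .
qed

text \<open>The indices 2m and 2m + 1 share the triad m + 1, m + 2, m + 3, so shell n receives
  contributions only from m = n - 1, n - 2, n - 3: the a-term, the b-term and the two terms with
  lower shells. By n \<le> N the truncation is not felt at shell n. For n = 1 and n = 2 the missing
  triads match the zero shells in \<open>sh\<close>.\<close>

lemma sum_field:
  assumes n: "1 \<le> n" and N: "n \<le> N"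
  shows "(\<Sum>i<2 * N. field i u n) = - B u n"
proof -
  have pairs: "(\<Sum>i<2 * N. f i) = (\<Sum>m<N. f (2 * m) + f (2 * m + 1))" for f :: "nat \<Rightarrow> complex"
    by (induction N) (auto simp: algebra_simps)
  have ne: "n = m + 1 \<or> n = m + 2 \<or> n = m + 3 \<or> field (2 * m) u n + field (2 * m + 1) u n = 0" for m
    by (auto simp: field_def tp_def tq_def)
  let ?g = "\<lambda>m. field (2 * m) u n + field (2 * m + 1) u n"
  have g1: "?g m = \<i> * of_real (a * k (m + 2)) * cnj (u (m + 2)) * u (m + 3)" if "n = m + 1" for m
    using that by (simp add: field_def tp_def tq_def tr_def tc_def)
  have g2: "?g m = \<i> * of_real (b * k (m + 2)) * cnj (u (m + 1)) * u (m + 3)" if "n = m + 2" for m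
    using that by (simp add: field_def tp_def tq_def tr_def tc_def)
  have g3: "?g m = \<i> * of_real (a * k (m + 2)) * u (m + 2) * u (m + 1) + \<i> * of_real (b * k (m + 2)) * u (m + 1) * u (m + 2)"
    if "n = m + 3" for m
    using that by (simp add: field_def tp_def tq_def tr_def tc_def)
  consider "n = 1" | "n = 2" | m where "n = m + 3"
    using n by (metis One_nat_def Suc_1 add.commute add_Suc_right le_Suc_ex not_less_eq_eq numeral_3_eq_3 plus_1_eq_Suc verit_la_disequality le_antisym)
  then show ?thesis
  proof cases
    case 1
    have "(\<Sum>m<N. ?g m) = (\<Sum>m\<in>{0}. ?g m)"
      by (rule sum.mono_neutral_right) (use 1 N ne in auto)
    with g1[of 0] 1 show ?thesis unfolding pairs by (simp add: sabraB_def sh_def numeral_2_eq_2 numeral_3_eq_3 mult_ac)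
  next
    case 2
    have "(\<Sum>m<N. ?g m) = (\<Sum>m\<in>{0, 1}. ?g m)"
    proof (rule sum.mono_neutral_right)
      show "\<forall>i\<in>{..<N} - {0, 1}. ?g i = 0"
      proof
        fix i assume "i \<in> {..<N} - {0, 1}"
        then show "?g i = 0" using ne[of i] 2 by auto
      qed
    qed (use 2 N in auto)
    with g1[of 1] g2[of 0] 2 show ?thesis unfolding pairs
      by (simp add: sabraB_def sh_def eval_nat_numeral algebra_simps nat_add_distrib)
  next
    case (3 m)
    have "(\<Sum>m<N. ?g m) = (\<Sum>m\<in>{m, m + 1, m + 2}. ?g m)"
    proof (rule sum.mono_neutral_right)
      show "\<forall>i\<in>{..<N} - {m, m + 1, m + 2}. ?g i = 0"
      proof
        fix i assume "i \<in> {..<N} - {m, m + 1, m + 2}"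
        then show "?g i = 0" using ne[of i] 3 by auto
      qed
    qed (use 3 N in auto)
    also have "\<dots> = ?g m + ?g (m + 1) + ?g (m + 2)" by simp
    also have "\<dots> = - B u n"
      using g3[of m] g2[of "m + 1"] g1[of "m + 2"] 3
      by (simp add: sabraB_def sh_def eval_nat_numeral algebra_simps nat_add_distrib)
    finally show ?thesis unfolding pairs .
  qed
qed

section \<open>Invariance and moment bounds for the partial compositions\<close>

lemma measurable_sub [measurable]: "sub h i \<in> measurable (mu \<nu>) (mu \<nu>)"
  unfolding sub_def by (intro measurable_triad triad_shells)

lemma measurable_stage [measurable]: "stage h i \<in> measurable (mu \<nu>) (mu \<nu>)"
proof (induction i)
  case 0
  have "stage h 0 = (\<lambda>u. u)" by (simp add: fun_eq_iff)
  then show ?case by simp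
next
  case (Suc i)
  have "stage h (Suc i) = (\<lambda>u. sub h i (stage h i u))" by (simp add: fun_eq_iff)
  then show ?case using measurable_compose[OF Suc measurable_sub] by simp
qed

lemma distr_stage: "distr (mu \<nu>) (mu \<nu>) (stage h i) = mu \<nu>"
proof (induction i)
  case 0
  have "stage h 0 = (\<lambda>u. u)" by (simp add: fun_eq_iff)
  then show ?case by (simp add: distr_id2)
next
  case (Suc i)
  have "stage h (Suc i) = sub h i \<circ> stage h i" by (simp add: fun_eq_iff)
  then have "distr (mu \<nu>) (mu \<nu>) (stage h (Suc i)) = distr (distr (mu \<nu>) (mu \<nu>) (stage h i)) (mu \<nu>) (sub h i)"
    by (simp add: distr_distr)
  also have "\<dots> = mu \<nu>"
    unfolding Suc sub_def by (rule distr_triad) (use triad_shells \<nu> in auto)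
  finally show ?case .
qed

definition Mom :: "nat \<Rightarrow> real" where "Mom p = enn2real (moment \<nu> p)"

lemma Mom_nonneg: "0 \<le> Mom p"
  by (simp add: Mom_def)

lemma measurable_stage_component: "1 \<le> n \<Longrightarrow> (\<lambda>u. stage h i u n) \<in> borel_measurable (mu \<nu>)"
  using measurable_compose[OF measurable_stage measurable_mu_component] .

lemma nn_integral_stage:
  assumes n: "1 \<le> n"
  shows "E (\<lambda>u. ennreal (cmod (stage h i u n) ^ p)) = ennreal (Mom p)"
proof -
  have "(\<integral>\<^sup>+u. ennreal (cmod (u n) ^ p) \<partial>distr (mu \<nu>) (mu \<nu>) (stage h i)) = E (\<lambda>u. ennreal (cmod (stage h i u n) ^ p))"
    using measurable_mu_component[OF n] by (intro nn_integral_distr) auto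
  then show ?thesis
    unfolding distr_stage using nn_integral_mu_component[OF \<nu> n, of p] moment_finite[OF \<nu>, of p] by (simp add: Mom_def)
qed

text \<open>The 15 is five indices times three shells: each of the two sums is raised to the power p
  by \<open>sum_power_le\<close>, the exponent p - 1 being rounded up to p.\<close>

lemma stage_increment_power_le:
  assumes h: "0 \<le> h" and p: "1 \<le> p"
  shows "cmod (stage h M u n - u n) ^ p \<le>
    (\<Sum>i\<in>{..<M} \<inter> J n. \<Sum>l<3. 15 ^ p * (h * (A * k n)) ^ p * cmod (stage h i u (tv i l)) ^ (2 * p))"
proof -
  let ?I = "{..<M} \<inter> J n"
  let ?s = "\<lambda>i. \<Sum>l<3. (cmod (stage h i u (tv i l)))\<^sup>2"
  have hA: "0 \<le> h * (A * k n)" using h A_nonneg k_pos[of n] by simp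
  have s: "0 \<le> ?s i" for i by (intro sum_nonneg) auto
  have "cmod (stage h M u n - u n) \<le> (\<Sum>i\<in>?I. h * (A * k n) * ?s i)"
    unfolding stage_telescope
  proof (rule sum_norm_le)
    fix i
    show "cmod (if n = tp i \<or> n = tq i then sub h i (stage h i u) n - stage h i u n else 0) \<le> h * (A * k n) * ?s i"
      using sub_diff_le[OF h, of n i "stage h i u"] mult_nonneg_nonneg[OF hA s[of i]] by auto
  qed
  then have "cmod (stage h M u n - u n) ^ p \<le> (\<Sum>i\<in>?I. h * (A * k n) * ?s i) ^ p"
    by (intro power_mono) auto
  also have "\<dots> \<le> real (card ?I) ^ (p - 1) * (\<Sum>i\<in>?I. (h * (A * k n) * ?s i) ^ p)"
    using mult_nonneg_nonneg[OF hA s] p card_J by (intro sum_power_le) auto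
  also have "\<dots> \<le> 5 ^ p * (\<Sum>i\<in>?I. (h * (A * k n)) ^ p * (3 ^ p * (\<Sum>l<3. cmod (stage h i u (tv i l)) ^ (2 * p))))"
  proof (rule mult_mono)
    have "card ?I \<le> card (J n)" by (intro card_mono card_J) auto
    then have "real (card ?I) \<le> 5" using card_J(2)[of n] by linarith
    then have "real (card ?I) ^ (p - 1) \<le> 5 ^ (p - 1)" by (intro power_mono) auto
    also have "\<dots> \<le> (5::real) ^ p" by (intro power_increasing) auto
    finally show "real (card ?I) ^ (p - 1) \<le> 5 ^ p" .
    show "(\<Sum>i\<in>?I. (h * (A * k n) * ?s i) ^ p) \<le> (\<Sum>i\<in>?I. (h * (A * k n)) ^ p * (3 ^ p * (\<Sum>l<3. cmod (stage h i u (tv i l)) ^ (2 * p))))"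
      unfolding power_mult_distrib[of "h * (A * k n)"]
    proof (intro sum_mono mult_left_mono)
      fix i
      have "?s i ^ p \<le> real (card {..<3::nat}) ^ (p - 1) * (\<Sum>l<3. ((cmod (stage h i u (tv i l)))\<^sup>2) ^ p)"
        using p by (intro sum_power_le) auto
      also have "\<dots> \<le> 3 ^ p * (\<Sum>l<3. cmod (stage h i u (tv i l)) ^ (2 * p))"
        by (intro mult_mono) (auto intro!: sum_nonneg power_increasing simp: power_mult)
      finally show "?s i ^ p \<le> 3 ^ p * (\<Sum>l<3. cmod (stage h i u (tv i l)) ^ (2 * p))" .
    qed (use hA in auto)
    show "0 \<le> (\<Sum>i\<in>?I. (h * (A * k n) * ?s i) ^ p)"
      using mult_nonneg_nonneg[OF hA s] by (intro sum_nonneg zero_le_power) auto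
  qed auto
  also have "\<dots> = (\<Sum>i\<in>?I. \<Sum>l<3. 15 ^ p * (h * (A * k n)) ^ p * cmod (stage h i u (tv i l)) ^ (2 * p))"
    using power_mult_distrib[of 5 "3::real" p] by (simp add: sum_distrib_left mult_ac)
  finally show ?thesis .
qed

lemma nn_integral_sum_cmod_le:
  assumes "finite I" "0 \<le> K" and m: "\<And>i l. 1 \<le> m i l"
  shows "E (\<lambda>u. ennreal (\<Sum>i\<in>I. \<Sum>l<3::nat. K * cmod (stage h (g i) u (m i l)) ^ q)) = ennreal (real (card I) * (3 * (K * Mom q)))"
proof -
  have [measurable]: "(\<lambda>u. stage h (g i) u (m i l)) \<in> borel_measurable (mu \<nu>)" for i l
    by (rule measurable_stage_component[OF m])
  have "E (\<lambda>u. ennreal (\<Sum>i\<in>I. \<Sum>l<3::nat. K * cmod (stage h (g i) u (m i l)) ^ q))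
     = E (\<lambda>u. (\<Sum>i\<in>I. \<Sum>l<3::nat. ennreal K * ennreal (cmod (stage h (g i) u (m i l)) ^ q)))"
    using assms(2) by (intro nn_integral_cong) (simp add: sum_ennreal[symmetric] sum_nonneg ennreal_mult)
  also have "\<dots> = (\<Sum>i\<in>I. \<Sum>l<3::nat. ennreal K * E (\<lambda>u. ennreal (cmod (stage h (g i) u (m i l)) ^ q)))"
    by (subst nn_integral_sum, measurable)+ (simp add: nn_integral_cmult)
  also have "\<dots> = (\<Sum>i\<in>I. \<Sum>l<3::nat. ennreal (K * Mom q))"
    using assms(2) Mom_nonneg by (simp only: nn_integral_stage[OF m] ennreal_mult)
  also have "\<dots> = ennreal (real (card I) * (3 * (K * Mom q)))"
    using assms(2) Mom_nonneg[of q] by (simp add: ennreal_mult ennreal_of_nat_eq_real_of_nat mult_ac)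
  finally show ?thesis .
qed

definition Cinc :: "nat \<Rightarrow> real" where "Cinc p = 15 * (15 ^ p * A ^ p * Mom (2 * p))"

lemma Cinc_nonneg: "0 \<le> Cinc p"
  using A_nonneg Mom_nonneg by (simp add: Cinc_def)

lemma stage_increment:
  assumes h: "0 \<le> h" and p: "1 \<le> p"
  shows "E (\<lambda>u. ennreal (cmod (stage h M u n - u n) ^ p)) \<le> ennreal (Cinc p * (h * k n) ^ p)"
proof -
  let ?I = "{..<M} \<inter> J n" and ?K = "15 ^ p * (h * (A * k n)) ^ p"
  have K: "0 \<le> ?K" using h A_nonneg k_pos[of n] by simp
  have "E (\<lambda>u. ennreal (cmod (stage h M u n - u n) ^ p)) \<le>
      E (\<lambda>u. ennreal (\<Sum>i\<in>?I. \<Sum>l<3::nat. ?K * cmod (stage h i u (tv i l)) ^ (2 * p)))"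
    by (intro nn_integral_mono ennreal_leI stage_increment_power_le assms)
  also have "\<dots> = ennreal (real (card ?I) * (3 * (?K * Mom (2 * p))))"
    by (rule nn_integral_sum_cmod_le) (use K triad_shells card_J in auto)
  also have "\<dots> \<le> ennreal (5 * (3 * (?K * Mom (2 * p))))"
  proof (intro ennreal_leI mult_right_mono)
    have "card ?I \<le> card (J n)" by (intro card_mono card_J) auto
    then show "real (card ?I) \<le> 5" using card_J(2)[of n] by linarith
  qed (use K Mom_nonneg in auto)
  also have "5 * (3 * (?K * Mom (2 * p))) = Cinc p * (h * k n) ^ p"
    by (simp add: Cinc_def power_mult_distrib)
  finally show ?thesis .
qed

text \<open>The first summand is the Taylor error of rotation i. The others bound the error of
  evaluating its field at the start of the step instead of at the state reached just before it. The
  nesting and the final 0 have the shape \<open>c * f u + g u\<close>, so that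
  \<open>nn_integral_le_linear\<close> can be applied repeatedly.\<close>

definition res_bound :: "real \<Rightarrow> nat \<Rightarrow> nat \<Rightarrow> nat \<Rightarrow> (nat \<Rightarrow> complex) \<Rightarrow> real" where
  "res_bound h n i m u = 2 * (h * (A * k n))\<^sup>2 * cmod (stage h i u m) ^ 3 +
     (A * k n * h\<^sup>2 * cmod (stage h i u m) ^ 2 + (A * k n * h\<^sup>2 * cmod (u m) ^ 2 + (A * k n * cmod (stage h i u m - u m) ^ 2 + 0)))"

lemma residual_le:
  assumes h: "0 < h" and n: "1 \<le> n" and N: "n \<le> N"
  shows "cmod (stage h (2 * N) u n - u n + of_real h * B u n) \<le>
    (\<Sum>i\<in>{..<2 * N} \<inter> J n. \<Sum>l<3. res_bound h n i (tv i l) u)"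
proof -
  let ?I = "{..<2 * N} \<inter> J n"
  let ?t = "\<lambda>i. n = tp i \<or> n = tq i"
  have "(\<Sum>i<2 * N. field i u n) = (\<Sum>i\<in>?I. if ?t i then field i u n else 0)"
  proof -
    have "(\<Sum>i<2 * N. field i u n) = (\<Sum>i<2 * N. if ?t i then field i u n else 0)"
      by (intro sum.cong refl) (auto simp: field_def)
    also have "\<dots> = (\<Sum>i\<in>?I. if ?t i then field i u n else 0)"
      by (intro sum.mono_neutral_right) (use mem_J in auto)
    finally show ?thesis .
  qed
  then have B: "B u n = - (\<Sum>i\<in>?I. if ?t i then field i u n else 0)"
    using sum_field[OF n N, of u] by (metis minus_minus)
  have eq0: "stage h (2 * N) u n - u n + of_real h * B u n =
      (\<Sum>i\<in>?I. if ?t i then sub h i (stage h i u) n - stage h i u n - of_real h * field i u n else 0)"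
    unfolding stage_telescope B
    by (simp add: sum_distrib_left sum_subtractf[symmetric] if_distrib[of "\<lambda>x. of_real h * x"] cong: if_cong)
      (intro sum.cong refl, auto)
  show ?thesis
    unfolding eq0
  proof (rule sum_norm_le)
    fix i
    let ?U = "stage h i u"
    have nn: "0 \<le> res_bound h n i m u" for m
      unfolding res_bound_def using A_nonneg k_pos[of n] h by (intro add_nonneg_nonneg) auto
    show "cmod (if ?t i then sub h i ?U n - ?U n - of_real h * field i u n else 0) \<le> (\<Sum>l<3. res_bound h n i (tv i l) u)"
    proof (cases "?t i")
      case True
      have eq: "sub h i ?U n - ?U n - of_real h * field i u n =
          (sub h i ?U n - ?U n - of_real h * field i ?U n) + of_real h * (field i ?U n - field i u n)"
        by (simp add: algebra_simps)
      have "cmod (sub h i ?U n - ?U n - of_real h * field i u n) \<le>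
          cmod (sub h i ?U n - ?U n - of_real h * field i ?U n) + h * cmod (field i ?U n - field i u n)"
        unfolding eq by (rule order_trans[OF norm_triangle_ineq]) (use h in \<open>simp add: norm_mult\<close>)
      also have "\<dots> \<le> 2 * (h * (A * k n))\<^sup>2 * (\<Sum>l<3. cmod (?U (tv i l)) ^ 3) +
          A * k n * (\<Sum>l<3. h\<^sup>2 * (cmod (?U (tv i l)))\<^sup>2 + h\<^sup>2 * (cmod (u (tv i l)))\<^sup>2 + (cmod (?U (tv i l) - u (tv i l)))\<^sup>2)"
        using h by (intro add_mono sub_Taylor_le field_diff_le True) auto
      also have "\<dots> = (\<Sum>l<3. res_bound h n i (tv i l) u)"
        unfolding sum_distrib_left sum.distrib[symmetric] res_bound_def
        by (intro sum.cong refl) (simp add: algebra_simps)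
      finally show ?thesis using True by simp
    next
      case False
      then show ?thesis using nn by (simp add: sum_nonneg)
    qed
  qed
qed

text \<open>The number n + 2 is the highest shell of a triad with index in \<open>J n\<close>; the
  increments of that shell within the step give the last term.\<close>

definition Dres :: "nat \<Rightarrow> real" where
  "Dres n = 5 * (3 * (2 * (A * k n)\<^sup>2 * Mom 3 + (A * k n * Mom 2 + (A * k n * Mom 2 + A * k n * (Cinc 2 * (k (n + 2))\<^sup>2)))))"

lemma Dres_nonneg: "0 \<le> Dres n"
  unfolding Dres_def using A_nonneg k_pos[of n] Mom_nonneg Cinc_nonneg
  by (intro mult_nonneg_nonneg add_nonneg_nonneg) auto

lemma nn_integral_residual:
  assumes h: "0 < h" and n: "1 \<le> n" and N: "n \<le> N"
  shows "E (\<lambda>u. ennreal (cmod (stage h (2 * N) u n - u n + of_real h * B u n))) \<le> ennreal (Dres n * h\<^sup>2)"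
proof -
  let ?I = "{..<2 * N} \<inter> J n"
  let ?E = "2 * (h * (A * k n))\<^sup>2 * Mom 3 + (A * k n * h\<^sup>2 * Mom 2 + (A * k n * h\<^sup>2 * Mom 2 + (A * k n * (Cinc 2 * (h * k (n + 2))\<^sup>2) + 0)))"
  have Ak: "0 \<le> A * k n" using A_nonneg k_pos[of n] by simp
  have E: "0 \<le> ?E" using A_nonneg less_imp_le[OF k_pos] h Mom_nonneg Cinc_nonneg by (intro add_nonneg_nonneg mult_nonneg_nonneg) auto
  have nn: "0 \<le> res_bound h n i m u" for i m u
    unfolding res_bound_def using Ak h by (intro add_nonneg_nonneg) auto
  have meas: "(\<lambda>u. res_bound h n i (tv i l) u) \<in> borel_measurable (mu \<nu>)" for i l
  proof -
    have [measurable]: "(\<lambda>u. stage h i u (tv i l)) \<in> borel_measurable (mu \<nu>)" "(\<lambda>u. u (tv i l)) \<in> borel_measurable (mu \<nu>)"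
      by (auto intro: measurable_stage_component measurable_mu_component triad_shells)
    show ?thesis unfolding res_bound_def by measurable
  qed
  have each: "E (\<lambda>u. ennreal (res_bound h n i (tv i l) u)) \<le> ennreal ?E" if i: "i \<in> ?I" for i l
  proof -
    have [measurable]: "(\<lambda>u. stage h i u (tv i l)) \<in> borel_measurable (mu \<nu>)" "(\<lambda>u. u (tv i l)) \<in> borel_measurable (mu \<nu>)"
      by (auto intro: measurable_stage_component measurable_mu_component triad_shells)
    have st: "E (\<lambda>u. ennreal (cmod (stage h i u (tv i l)) ^ p)) \<le> ennreal (Mom p)" for p
      by (simp only: nn_integral_stage[OF triad_shells(7)] order_refl)
    have id: "E (\<lambda>u. ennreal (cmod (u (tv i l)) ^ p)) \<le> ennreal (Mom p)" for p
      using nn_integral_stage[of "tv i l" h 0 p] triad_shells(7) by simp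
    have "tv i l \<le> n + 2" using i n by (auto simp: J_def tv_def tp_def tr_def tq_def)
    then have "(h * k (tv i l))\<^sup>2 \<le> (h * k (n + 2))\<^sup>2"
      using h k_pos[of "tv i l"] by (intro power_mono mult_left_mono k_mono mult_nonneg_nonneg) auto
    then have "Cinc 2 * (h * k (tv i l))\<^sup>2 \<le> Cinc 2 * (h * k (n + 2))\<^sup>2"
      using Cinc_nonneg by (intro mult_left_mono)
    then have inc: "E (\<lambda>u. ennreal ((cmod (stage h i u (tv i l) - u (tv i l)))\<^sup>2)) \<le> ennreal (Cinc 2 * (h * k (n + 2))\<^sup>2)"
      using stage_increment[of h 2 i "tv i l"] h by (meson ennreal_leI less_imp_le one_le_numeral order_trans)
    show ?thesis
      unfolding res_bound_def
      by (intro nn_integral_le_linear st id inc)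
        (use A_nonneg less_imp_le[OF k_pos] h Mom_nonneg Cinc_nonneg in \<open>auto intro!: mult_nonneg_nonneg add_nonneg_nonneg\<close>)
  qed
  have "E (\<lambda>u. ennreal (cmod (stage h (2 * N) u n - u n + of_real h * B u n))) \<le>
    E (\<lambda>u. ennreal (\<Sum>i\<in>?I. \<Sum>l<3. res_bound h n i (tv i l) u))"
    by (intro nn_integral_mono ennreal_leI residual_le assms)
  also have "\<dots> \<le> ennreal (real (card ?I) * (real (card {..<3::nat}) * ?E))"
  proof (rule nn_integral_le_sum)
    fix i assume i: "i \<in> ?I"
    show "E (\<lambda>u. ennreal (\<Sum>l<3. res_bound h n i (tv i l) u)) \<le> ennreal (real (card {..<3::nat}) * ?E)"
      by (intro nn_integral_le_sum meas nn each i E)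
  qed (use meas nn E in \<open>auto intro!: sum_nonneg borel_measurable_sum mult_nonneg_nonneg\<close>)
  also have "\<dots> \<le> ennreal (5 * (3 * ?E))"
  proof (rule ennreal_leI, rule mult_mono)
    have "card ?I \<le> card (J n)" by (intro card_mono card_J) auto
    then show "real (card ?I) \<le> 5" using card_J(2)[of n] by linarith
  qed (use E in auto)
  also have "5 * (3 * ?E) = Dres n * h\<^sup>2"
    by (simp add: Dres_def power_mult_distrib algebra_simps)
  finally show ?thesis .
qed

section \<open>One time step and its iterates\<close>

definition step :: "nat \<Rightarrow> (nat \<Rightarrow> complex) \<Rightarrow> nat \<Rightarrow> complex" where
  "step N = stage (1 / real (Suc N)) (2 * N)"

lemma measurable_step_funpow [measurable]: "(step N ^^ j) \<in> measurable (mu \<nu>) (mu \<nu>)"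
proof (induction j)
  case (Suc j)
  then show ?case using measurable_comp[OF Suc measurable_stage] by (simp add: step_def)
qed simp

lemma distr_step: "distr (mu \<nu>) (mu \<nu>) (step N) = mu \<nu>"
  unfolding step_def by (rule distr_stage)

lemma measurable_step: "step N \<in> measurable (mu \<nu>) (mu \<nu>)"
  unfolding step_def by (rule measurable_stage)

lemma distr_step_funpow: "distr (mu \<nu>) (mu \<nu>) (step N ^^ j) = mu \<nu>"
proof (induction j)
  case (Suc j)
  have "distr (mu \<nu>) (mu \<nu>) (step N ^^ Suc j) = distr (distr (mu \<nu>) (mu \<nu>) (step N ^^ j)) (mu \<nu>) (step N)"
    using measurable_step_funpow[of N j] measurable_step[of N] by (simp add: distr_distr)
  also have "\<dots> = mu \<nu>" unfolding Suc by (rule distr_step)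
  finally show ?case .
qed (simp add: id_def distr_id2)

lemma nn_integral_step_funpow:
  assumes [measurable]: "f \<in> borel_measurable (mu \<nu>)"
  shows "E (\<lambda>u. f ((step N ^^ j) u)) = E (\<lambda>u. f u)"
proof -
  have "(\<integral>\<^sup>+u. f u \<partial>distr (mu \<nu>) (mu \<nu>) (step N ^^ j)) = E (\<lambda>u. f ((step N ^^ j) u))"
    by (rule nn_integral_distr) measurable
  then show ?thesis by (simp add: distr_step_funpow)
qed

lemma measurable_sabraB [measurable]:
  "1 \<le> n \<Longrightarrow> (\<lambda>u. B u n) \<in> borel_measurable (mu \<nu>)"
proof -
  have c: "(\<lambda>u. sh u j) \<in> borel_measurable (mu \<nu>)" for j
    using measurable_mu_component[of "nat j"] by (cases "1 \<le> j") (auto simp: sh_def le_nat_iff)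
  have cc: "(\<lambda>u. cnj (sh u j)) \<in> borel_measurable (mu \<nu>)" for j
    by (rule measurable_compose[OF c borel_measurable_cnj])
  show ?thesis unfolding sabraB_def
    by (intro borel_measurable_times borel_measurable_add borel_measurable_const c cc)
qed

end

section \<open>Laws determined by finitely many half-space conditions\<close>

text \<open>Finite intersections of half-spaces form a pi-system. The assumption \<open>gen\<close>
  says that the \<phi> generate the sigma-algebra of M, in a form that is verified by measurability
  of the identity map.\<close>

lemma measure_eqI_halfspaces:
  fixes \<phi> :: "'i \<Rightarrow> 'a \<Rightarrow> real"
  assumes M: "prob_space M" and N: "prob_space N" and sets: "sets M = sets N"
    and \<phi>[measurable]: "\<And>i. i \<in> I \<Longrightarrow> \<phi> i \<in> borel_measurable M"
    and gen: "\<And>K :: 'a measure. space K = space M \<Longrightarrow> (\<And>i. i \<in> I \<Longrightarrow> \<phi> i \<in> borel_measurable K) \<Longrightarrow> (\<lambda>x. x) \<in> measurable K M"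
    and eq: "\<And>F c. finite F \<Longrightarrow> F \<subseteq> I \<Longrightarrow>
      measure M {x\<in>space M. \<forall>i\<in>F. \<phi> i x \<le> c i} = measure N {x\<in>space M. \<forall>i\<in>F. \<phi> i x \<le> c i}"
  shows "M = N"
proof -
  let ?O = "space M"
  define E where "E = {{x\<in>?O. \<forall>i\<in>F. \<phi> i x \<le> c i} | F c. finite F \<and> F \<subseteq> I}"
  have EI: "{x\<in>?O. \<forall>i\<in>F. \<phi> i x \<le> c i} \<in> E" if "finite F" "F \<subseteq> I" for F c
    using that unfolding E_def by blast
  have E: "E \<subseteq> sets M"
  proof
    fix e assume "e \<in> E"
    then obtain F c where e: "e = {x\<in>?O. \<forall>i\<in>F. \<phi> i x \<le> c i}" "finite F" "F \<subseteq> I" unfolding E_def by blast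
    have [measurable]: "\<And>i. i \<in> F \<Longrightarrow> \<phi> i \<in> borel_measurable M" using e(3) \<phi> by blast
    show "e \<in> sets M" unfolding e(1) using e(2) by measurable
  qed
  have EP: "E \<subseteq> Pow ?O" unfolding E_def by blast
  have "sets M \<subseteq> sigma_sets ?O E"
  proof
    fix A assume A: "A \<in> sets M"
    have "(\<lambda>x. x) \<in> measurable (sigma ?O E) M"
    proof (rule gen)
      show sp: "space (sigma ?O E) = space M" by (rule space_measure_of[OF EP])
      fix i assume i: "i \<in> I"
      show "\<phi> i \<in> borel_measurable (sigma ?O E)"
        unfolding borel_measurable_iff_le
      proof
        fix c
        have "{x\<in>?O. \<forall>j\<in>{i}. \<phi> j x \<le> c} \<in> E" by (rule EI) (use i in auto)
        then show "{w \<in> space (sigma ?O E). \<phi> i w \<le> c} \<in> sets (sigma ?O E)"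
          unfolding sp sets_measure_of[OF EP] by (intro sigma_sets.Basic) simp
      qed
    qed
    from measurable_sets[OF this A] have "A \<inter> ?O \<in> sigma_sets ?O E"
      by (simp add: space_measure_of[OF EP] sets_measure_of[OF EP] vimage_def Int_def)
    then show "A \<in> sigma_sets ?O E" using sets.sets_into_space[OF A] by (simp add: Int_absorb2)
  qed
  moreover have "sigma_sets ?O E \<subseteq> sets M" by (rule sets.sigma_sets_subset[OF E])
  ultimately have S: "sets M = sigma_sets ?O E" by auto
  show ?thesis
  proof (rule measure_eqI_generator_eq[where E = E and \<Omega> = ?O and A = "\<lambda>_. ?O"])
    show "Int_stable E"
    proof (rule Int_stableI)
      fix x y assume "x \<in> E" "y \<in> E"
      then obtain F c G d where x: "x = {x\<in>?O. \<forall>i\<in>F. \<phi> i x \<le> c i}" "finite F" "F \<subseteq> I"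
        and y: "y = {x\<in>?O. \<forall>i\<in>G. \<phi> i x \<le> d i}" "finite G" "G \<subseteq> I" unfolding E_def by blast
      let ?e = "\<lambda>i. if i \<in> F \<inter> G then min (c i) (d i) else if i \<in> F then c i else d i"
      have "x \<inter> y = {x\<in>?O. \<forall>i\<in>F \<union> G. \<phi> i x \<le> ?e i}"
        unfolding x(1) y(1) by (auto split: if_splits)
      also have "\<dots> \<in> E" by (rule EI) (use x y in auto)
      finally show "x \<inter> y \<in> E" .
    qed
    interpret M: prob_space M by fact
    interpret N: prob_space N by fact
    show "emeasure M X = emeasure N X" if "X \<in> E" for X
      using that eq unfolding E_def M.emeasure_eq_measure N.emeasure_eq_measure by auto
    have "{x\<in>?O. \<forall>i\<in>{}. \<phi> i x \<le> 0} \<in> E" by (rule EI) auto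
    then show "range (\<lambda>_::nat. ?O) \<subseteq> E" by simp
    show "emeasure M ?O \<noteq> \<infinity>" by simp
  qed (use EP S sets in auto)
qed

text \<open>The real coordinates of a sequence of complex numbers are indexed by a shell and a flag
  selecting the real or the imaginary part.\<close>
definition part :: "bool \<Rightarrow> complex \<Rightarrow> real" where
  "part s z = (if s then Re z else Im z)"

lemma part_measurable [measurable]: "f \<in> borel_measurable M \<Longrightarrow> (\<lambda>x. part s (f x)) \<in> borel_measurable M"
  unfolding part_def by (cases s) auto

lemma tendsto_part: "(f \<longlongrightarrow> l) F \<Longrightarrow> ((\<lambda>x. part s (f x)) \<longlongrightarrow> part s l) F"
  unfolding part_def by (cases s) (auto intro: tendsto_intros)

lemma measurable_complex_partI:
  "(\<And>s. (\<lambda>x. part s (f x)) \<in> borel_measurable M) \<Longrightarrow> f \<in> borel_measurable M"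
proof -
  assume p: "\<And>s. (\<lambda>x. part s (f x)) \<in> borel_measurable M"
  show ?thesis using p[of True] p[of False] by (simp add: borel_measurable_complex_iff part_def)
qed

lemma mu_eqI:
  assumes \<nu>: "0 < \<nu>" and N: "prob_space N" and sets: "sets N = sets (mu \<nu>)"
    and eq: "\<And>F c. finite F \<Longrightarrow> F \<subseteq> {1..} \<times> UNIV \<Longrightarrow>
      measure (mu \<nu>) {x\<in>space (mu \<nu>). \<forall>i\<in>F. part (snd i) (x (fst i)) \<le> c i}
      = measure N {x\<in>space (mu \<nu>). \<forall>i\<in>F. part (snd i) (x (fst i)) \<le> c i}"
  shows "N = mu \<nu>"
proof (rule measure_eqI_halfspaces[symmetric, where I = "{1..} \<times> UNIV" and \<phi> = "\<lambda>i x. part (snd i) (x (fst i))"])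
  show "prob_space (mu \<nu>)" by (rule prob_space_mu[OF \<nu>])
  show "(\<lambda>x. part (snd i) (x (fst i))) \<in> borel_measurable (mu \<nu>)" if "i \<in> {1..} \<times> UNIV" for i
    using that by (intro part_measurable measurable_mu_component) auto
  fix K assume K: "space K = space (mu \<nu>)" and m: "\<And>i. i \<in> {1..} \<times> UNIV \<Longrightarrow> (\<lambda>x. part (snd i) (x (fst i))) \<in> borel_measurable K"
  show "(\<lambda>x. x) \<in> measurable K (mu \<nu>)"
  proof (rule measurable_muI)
    show "(\<lambda>x. x n) \<in> borel_measurable K" if "1 \<le> n" for n
      using m[of "(n, _)"] that by (intro measurable_complex_partI) auto
  qed (use K in \<open>auto simp: space_mu\<close>)
next
  fix F :: "(nat \<times> bool) set" and c :: "nat \<times> bool \<Rightarrow> real"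
  assume "finite F" "F \<subseteq> {1..} \<times> UNIV"
  then show "measure (mu \<nu>) {x\<in>space (mu \<nu>). \<forall>i\<in>F. part (snd i) (x (fst i)) \<le> c i}
      = measure N {x\<in>space (mu \<nu>). \<forall>i\<in>F. part (snd i) (x (fst i)) \<le> c i}" by (rule eq)
qed (rule N, rule sets[symmetric])

lemma PiM_mu_eqI:
  assumes \<nu>: "0 < \<nu>" and M: "prob_space M" and N: "prob_space N"
    and sets: "sets M = sets (PiM J (\<lambda>_. mu \<nu>))" "sets N = sets (PiM J (\<lambda>_. mu \<nu>))"
    and eq: "\<And>F c. finite F \<Longrightarrow> F \<subseteq> J \<times> {1..} \<times> UNIV \<Longrightarrow>
      measure M {x\<in>space M. \<forall>i\<in>F. part (snd (snd i)) (x (fst i) (fst (snd i))) \<le> c i}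
      = measure N {x\<in>space M. \<forall>i\<in>F. part (snd (snd i)) (x (fst i) (fst (snd i))) \<le> c i}"
  shows "M = N"
proof (rule measure_eqI_halfspaces[where I = "J \<times> {1..} \<times> UNIV" and \<phi> = "\<lambda>i x. part (snd (snd i)) (x (fst i) (fst (snd i)))"])
  have sp: "space M = space (PiM J (\<lambda>_. mu \<nu>))" by (rule sets_eq_imp_space_eq[OF sets(1)])
  show "(\<lambda>x. part (snd (snd i)) (x (fst i) (fst (snd i)))) \<in> borel_measurable M" if i: "i \<in> J \<times> {1..} \<times> UNIV" for i
  proof -
    obtain t n s where i': "i = (t, n, s)" "t \<in> J" "1 \<le> n" using i by auto
    have "(\<lambda>x. x t) \<in> measurable M (mu \<nu>)"
      unfolding measurable_cong_sets[OF sets(1) refl] by (rule measurable_component_singleton[OF i'(2)])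
    from measurable_compose[OF this measurable_mu_component[OF i'(3)]] show ?thesis unfolding i' by simp
  qed
  fix K assume K: "space K = space M" and m: "\<And>i. i \<in> J \<times> {1..} \<times> UNIV \<Longrightarrow> (\<lambda>x. part (snd (snd i)) (x (fst i) (fst (snd i)))) \<in> borel_measurable K"
  show "(\<lambda>x. x) \<in> measurable K M"
    unfolding measurable_cong_sets[OF refl sets(1)]
  proof (rule measurable_PiM_single')
    show "(\<lambda>x. x t) \<in> measurable K (mu \<nu>)" if t: "t \<in> J" for t
    proof (rule measurable_muI)
      show "(\<lambda>x. x t n) \<in> borel_measurable K" if "1 \<le> n" for n
        using m[of "(t, n, _)"] that t by (intro measurable_complex_partI) auto
      show "x t \<in> extensional {1..}" if "x \<in> space K" for x
        using that t unfolding K sp space_PiM by (simp add: PiE_iff space_mu)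
    qed
  qed (use K sp in \<open>auto simp: space_PiM\<close>)
next
  fix F :: "('a \<times> nat \<times> bool) set" and c
  assume "finite F" "F \<subseteq> J \<times> {1..} \<times> UNIV"
  then show "measure M {x\<in>space M. \<forall>i\<in>F. part (snd (snd i)) (x (fst i) (fst (snd i))) \<le> c i}
      = measure N {x\<in>space M. \<forall>i\<in>F. part (snd (snd i)) (x (fst i) (fst (snd i))) \<le> c i}" by (rule eq)
qed (use M N sets in simp_all)

lemma solves_inviscid_cong:
  assumes "\<And>t n. 1 \<le> n \<Longrightarrow> u t n = v t n"
  shows "solves_inviscid k0 lam a b u \<longleftrightarrow> solves_inviscid k0 lam a b v"
proof -
  have "sh (u t) j = sh (v t) j" for t j
    using assms[of "nat j"] by (auto simp: sh_def le_nat_iff)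
  then have "sabraB k0 lam a b (u t) (u t) n = sabraB k0 lam a b (v t) (v t) n" for t n
    unfolding sabraB_def by simp
  then show ?thesis unfolding solves_inviscid_def using assms by simp
qed

lemma loc_holder_H_cong:
  assumes "\<And>t n. 1 \<le> n \<Longrightarrow> u t n = v t n"
  shows "loc_holder_H k0 lam \<gamma> \<beta> u \<longleftrightarrow> loc_holder_H k0 lam \<gamma> \<beta> v"
  unfolding loc_holder_H_def inH_def normH_def using assms by simp

section \<open>The stationary solution\<close>

context shell_scheme
begin

text \<open>The discrete path with step \<open>1 / Suc N\<close>, with time index \<open>j\<close> starting at \<open>- (Suc N)\<^sup>2\<close>.\<close>
definition path :: "nat \<Rightarrow> int \<Rightarrow> (nat \<Rightarrow> complex) \<Rightarrow> nat \<Rightarrow> complex" where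
  "path N j u = (step N ^^ nat (j + (int (Suc N))\<^sup>2)) u"

definition W :: "nat \<Rightarrow> nat \<Rightarrow> int set" where
  "W T N = {- (int T * int (Suc N))..<int T * int (Suc N)}"

lemma card_W: "finite (W T N)" "real (card (W T N)) = 2 * real T * real (Suc N)"
proof -
  have "card (W T N) = nat (2 * (int T * int (Suc N)))" by (simp add: W_def)
  also have "2 * (int T * int (Suc N)) = int (2 * T * Suc N)" by (simp add: algebra_simps)
  also have "nat (int (2 * T * Suc N)) = 2 * T * Suc N" by (rule nat_int)
  finally show "real (card (W T N)) = 2 * real T * real (Suc N)" by (simp add: algebra_simps)
qed (simp add: W_def)

text \<open>The starting index corresponds to time -(N + 1), so the window of size T lies after the
  start once T \<le> N + 1. Before the start, \<open>nat\<close> would freeze the path.\<close>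

lemma window_lower: "T \<le> Suc N \<Longrightarrow> - (int T * int (Suc N)) + (int (Suc N))\<^sup>2 \<ge> 0"
  using mult_right_mono[of "int T" "int (Suc N)" "int (Suc N)"] by (simp add: power2_eq_square)

lemma path_Suc:
  assumes "j \<in> W T N" "T \<le> Suc N"
  shows "path N (j + 1) u = step N (path N j u)"
proof -
  have "0 \<le> j + (int (Suc N))\<^sup>2" using assms window_lower[of T N] by (auto simp: W_def)
  then have "nat (j + 1 + (int (Suc N))\<^sup>2) = Suc (nat (j + (int (Suc N))\<^sup>2))" by linarith
  then show ?thesis unfolding path_def by simp
qed

lemma measurable_path [measurable]: "path N j \<in> measurable (mu \<nu>) (mu \<nu>)"
  unfolding path_def by simp

lemma measurable_path_component: "1 \<le> n \<Longrightarrow> (\<lambda>u. path N j u n) \<in> borel_measurable (mu \<nu>)"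
  using measurable_compose[OF measurable_path measurable_mu_component] .

lemma nn_integral_path:
  "f \<in> borel_measurable (mu \<nu>) \<Longrightarrow> E (\<lambda>u. f (path N j u)) = E (\<lambda>u. f u)"
  unfolding path_def by (rule nn_integral_step_funpow)

lemma measurable_step_component: "1 \<le> n \<Longrightarrow> (\<lambda>u. step N u n) \<in> borel_measurable (mu \<nu>)"
  using measurable_compose[OF measurable_step measurable_mu_component] .

lemma path_increment:
  assumes j: "j \<in> W T N" "T \<le> Suc N" and n: "1 \<le> n" and p: "1 \<le> p"
  shows "E (\<lambda>u. ennreal (cmod (path N (j + 1) u n - path N j u n) ^ p)) \<le> ennreal (Cinc p * (k n / real (Suc N)) ^ p)"
proof -
  have [measurable]: "(\<lambda>u. step N u n) \<in> borel_measurable (mu \<nu>)" "(\<lambda>u. u n) \<in> borel_measurable (mu \<nu>)"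
    using n by (auto intro: measurable_step_component measurable_mu_component)
  have "E (\<lambda>u. ennreal (cmod (path N (j + 1) u n - path N j u n) ^ p)) =
      E (\<lambda>u. ennreal (cmod (step N (path N j u) n - path N j u n) ^ p))"
    by (simp only: path_Suc[OF j])
  also have "\<dots> = E (\<lambda>u. ennreal (cmod (step N u n - u n) ^ p))"
    by (rule nn_integral_path[of "\<lambda>u. ennreal (cmod (step N u n - u n) ^ p)"]) measurable
  also have "\<dots> \<le> ennreal (Cinc p * (1 / real (Suc N) * k n) ^ p)"
    unfolding step_def by (rule stage_increment) (use p in auto)
  finally show ?thesis by simp
qed

abbreviation path_res :: "nat \<Rightarrow> int \<Rightarrow> (nat \<Rightarrow> complex) \<Rightarrow> nat \<Rightarrow> complex" where
  "path_res N j u n \<equiv> path N (j + 1) u n - path N j u n + of_real (1 / real (Suc N)) * B (path N j u) n"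

lemma path_residual:
  assumes j: "j \<in> W T N" "T \<le> Suc N" and n: "1 \<le> n" "n \<le> N"
  shows "E (\<lambda>u. ennreal (cmod (path_res N j u n)))
    \<le> ennreal (Dres n * (1 / real (Suc N))\<^sup>2)"
proof -
  have [measurable]: "(\<lambda>u. step N u n) \<in> borel_measurable (mu \<nu>)" "(\<lambda>u. u n) \<in> borel_measurable (mu \<nu>)"
    "(\<lambda>u. B u n) \<in> borel_measurable (mu \<nu>)"
    using n by (auto intro: measurable_step_component measurable_mu_component measurable_sabraB)
  let ?f = "\<lambda>u. ennreal (cmod (step N u n - u n + of_real (1 / real (Suc N)) * B u n))"
  have "E (\<lambda>u. ennreal (cmod (path_res N j u n))) =
      E (\<lambda>u. ?f (path N j u))"
    by (simp only: path_Suc[OF j])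
  also have "\<dots> = E (\<lambda>u. ?f u)" by (rule nn_integral_path) measurable
  also have "\<dots> \<le> ennreal (Dres n * (1 / real (Suc N))\<^sup>2)"
    unfolding step_def by (rule nn_integral_residual) (use n in auto)
  finally show ?thesis .
qed

text \<open>Advancing every index by m amounts to applying m steps to the initial state first, and
  these preserve \<open>mu \<nu>\<close>. A negative shift is the inverse positive shift applied to
  the shifted indices. The sign conditions make \<open>nat\<close> additive.\<close>

lemma measure_path_shift:
  assumes F: "finite F" and g: "\<And>i. i \<in> F \<Longrightarrow> g i \<in> borel_measurable (mu \<nu>)"
    and j: "\<And>i. i \<in> F \<Longrightarrow> 0 \<le> j i + (int (Suc N))\<^sup>2" "\<And>i. i \<in> F \<Longrightarrow> 0 \<le> j i + m + (int (Suc N))\<^sup>2"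
  shows "measure (mu \<nu>) {u\<in>space (mu \<nu>). \<forall>i\<in>F. g i (path N (j i + m) u) \<le> (c i :: real)}
    = measure (mu \<nu>) {u\<in>space (mu \<nu>). \<forall>i\<in>F. g i (path N (j i) u) \<le> c i}"
proof -
  have nonneg: "measure (mu \<nu>) {u\<in>space (mu \<nu>). \<forall>i\<in>F. g i (path N (l i + m') u) \<le> c i}
    = measure (mu \<nu>) {u\<in>space (mu \<nu>). \<forall>i\<in>F. g i (path N (l i) u) \<le> c i}"
    if m: "0 \<le> m'" and l: "\<And>i. i \<in> F \<Longrightarrow> 0 \<le> l i + (int (Suc N))\<^sup>2" for m' l
  proof -
    let ?B = "{u\<in>space (mu \<nu>). \<forall>i\<in>F. g i (path N (l i) u) \<le> c i}"
    let ?s = "step N ^^ nat m'"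
    have gm: "(\<lambda>u. g i (path N (l i) u)) \<in> borel_measurable (mu \<nu>)" if "i \<in> F" for i
      using measurable_compose[OF measurable_path g[OF that]] .
    have B: "?B \<in> sets (mu \<nu>)" using F gm by measurable
    have e: "path N (l i + m') u = path N (l i) (?s u)" if "i \<in> F" for i u
    proof -
      have "nat (l i + m' + (int (Suc N))\<^sup>2) = nat (l i + (int (Suc N))\<^sup>2) + nat m'"
        using m l[OF that] by linarith
      then show ?thesis unfolding path_def by (simp add: funpow_add)
    qed
    have sm: "?s \<in> measurable (mu \<nu>) (mu \<nu>)" by (rule measurable_step_funpow)
    have "{u\<in>space (mu \<nu>). \<forall>i\<in>F. g i (path N (l i + m') u) \<le> c i} = ?s -` ?B \<inter> space (mu \<nu>)"
      using e measurable_space[OF sm] by auto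
    also have "measure (mu \<nu>) \<dots> = measure (distr (mu \<nu>) (mu \<nu>) ?s) ?B"
      by (rule measure_distr[OF sm B, symmetric])
    finally show ?thesis unfolding distr_step_funpow .
  qed
  show ?thesis
  proof (cases "0 \<le> m")
    case True
    then show ?thesis using nonneg[of m j] j by blast
  next
    case False
    then show ?thesis using nonneg[of "- m" "\<lambda>i. j i + m"] j by simp
  qed
qed

lemma measure_path:
  assumes F: "finite F" and g: "\<And>i. i \<in> F \<Longrightarrow> g i \<in> borel_measurable (mu \<nu>)"
  shows "measure (mu \<nu>) {u\<in>space (mu \<nu>). \<forall>i\<in>F. g i (path N j u) \<le> (c i :: real)}
    = measure (mu \<nu>) {u\<in>space (mu \<nu>). \<forall>i\<in>F. g i u \<le> c i}"
proof -
  let ?B = "{u\<in>space (mu \<nu>). \<forall>i\<in>F. g i u \<le> c i}"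
  have B: "?B \<in> sets (mu \<nu>)" using F g by measurable
  have "{u\<in>space (mu \<nu>). \<forall>i\<in>F. g i (path N j u) \<le> c i} = path N j -` ?B \<inter> space (mu \<nu>)"
    using measurable_space[OF measurable_path] by auto
  also have "measure (mu \<nu>) \<dots> = measure (distr (mu \<nu>) (mu \<nu>) (path N j)) ?B"
    by (rule measure_distr[OF measurable_path B, symmetric])
  finally show ?thesis unfolding path_def distr_step_funpow .
qed

end

section \<open>Almost sure estimates for the discrete paths\<close>

locale shell_loeb = shell_scheme k0 lam a b \<nu> + loeb U "\<lambda>_. mu \<nu>" pr
  for k0 lam a b \<nu> :: real and U :: "nat filter" and pr :: "nat \<Rightarrow> 'w \<Rightarrow> nat \<Rightarrow> complex"
begin

text \<open>To get one constant for all shells, \<open>AE_bounded\<close> is applied to a weighted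
  sum over the shells, and each term is then bounded by the whole sum. The weight 1/n^2 makes the
  expectations summable and reappears as the factor n^2.\<close>

lemma AE_increments:
  assumes p: "2 \<le> p"
  shows "AE w in L. \<exists>K. eventually (\<lambda>N. \<forall>n\<ge>1.
        (\<Sum>j\<in>W T N. cmod (path N (j + 1) (pr N w) n - path N j (pr N w) n) ^ p)
          \<le> K * (real n)\<^sup>2 * k n ^ p / real (Suc N) ^ (p - 1)) U"
proof -
  define t where "t N n u = (\<Sum>j\<in>W T N. cmod (path N (j + 1) u n - path N j u n) ^ p)" for N n u
  \<comment> \<open>There are 2T(N + 1) steps, each with p-th moment at most
    \<open>Cinc p * (k n / real (Suc N)) ^ p\<close>. The weight turns the expected sum into at most
    2T \<open>Cinc p\<close>/n^2, free of N.\<close>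
  define r where "r N n = real (Suc N) ^ (p - 1) / (k n ^ p * (real n)\<^sup>2)" for N n
  have r: "0 < r N (Suc n)" for N n using k_pos by (simp add: r_def)
  define q where "q N u = (\<Sum>n. ennreal (r N (Suc n) * t N (Suc n) u + 0))" for N u
  have tm[measurable]: "t N (Suc n) \<in> borel_measurable (mu \<nu>)" for N n
  proof -
    have [measurable]: "(\<lambda>u. path N j u (Suc n)) \<in> borel_measurable (mu \<nu>)" for j
      by (rule measurable_path_component) simp
    show ?thesis unfolding t_def by measurable
  qed
  have t0: "0 \<le> t N n u" for N n u unfolding t_def by (intro sum_nonneg) auto
  let ?S = "\<Sum>n. 1 / (real (Suc n))\<^sup>2"
  have "AE w in L. \<exists>K>0. eventually (\<lambda>N. q N (pr N w) \<le> ennreal K) U"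
  proof (rule AE_bounded)
    show "q N \<in> borel_measurable (mu \<nu>)" for N unfolding q_def by measurable
    show "eventually (\<lambda>N. E (\<lambda>u. q N u) \<le> ennreal (2 * real T * Cinc p * ?S)) U"
      using ev_ge[of T]
    proof eventually_elim
      case (elim N)
      have "E (\<lambda>u. q N u) = (\<Sum>n. E (\<lambda>u. ennreal (r N (Suc n) * t N (Suc n) u + 0)))"
        unfolding q_def by (rule nn_integral_suminf) measurable
      also have "\<dots> \<le> (\<Sum>n. ennreal (2 * real T * Cinc p / (real (Suc n))\<^sup>2))"
      proof (intro suminf_le)
        fix n
        let ?m = "Suc n"
        have "E (\<lambda>u. ennreal (t N ?m u)) \<le> ennreal (real (card (W T N)) * (Cinc p * (k ?m / real (Suc N)) ^ p))"
          unfolding t_def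
        proof (rule nn_integral_le_sum)
          fix j assume j: "j \<in> W T N"
          show "E (\<lambda>u. ennreal (cmod (path N (j + 1) u ?m - path N j u ?m) ^ p)) \<le> ennreal (Cinc p * (k ?m / real (Suc N)) ^ p)"
            by (rule path_increment[OF j]) (use elim p in auto)
          show "(\<lambda>u. cmod (path N (j + 1) u ?m - path N j u ?m) ^ p) \<in> borel_measurable (mu \<nu>)"
            using measurable_path_component[of ?m] by measurable
        qed (use Cinc_nonneg less_imp_le[OF k_pos] in \<open>auto intro!: mult_nonneg_nonneg\<close>)
        then have "E (\<lambda>u. ennreal (r N ?m * t N ?m u + 0)) \<le> ennreal (r N ?m * (real (card (W T N)) * (Cinc p * (k ?m / real (Suc N)) ^ p)) + 0)"
          using r[of N n] t0 Cinc_nonneg less_imp_le[OF k_pos]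
          by (intro nn_integral_le_linear) (auto intro!: mult_nonneg_nonneg)
        also have "r N ?m * (real (card (W T N)) * (Cinc p * (k ?m / real (Suc N)) ^ p)) + 0 = 2 * real T * Cinc p / (real ?m)\<^sup>2"
        proof -
          have "real (Suc N) ^ p = real (Suc N) ^ (p - 1) * real (Suc N)" using p by (simp add: power_eq_if[of _ p])
          then show ?thesis using k_pos[of ?m]
            unfolding card_W r_def power_divide by (simp add: field_simps del: of_nat_Suc)
        qed
        finally show "E (\<lambda>u. ennreal (r N ?m * t N ?m u + 0)) \<le> ennreal (2 * real T * Cinc p / (real ?m)\<^sup>2)" .
      qed auto
      also have "\<dots> = ennreal (2 * real T * Cinc p * ?S)"
        by (rule suminf_inverse_squares(1)) (use Cinc_nonneg in auto)
      finally show ?case .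
    qed
    show "0 \<le> 2 * real T * Cinc p * ?S" using Cinc_nonneg[of p] suminf_inverse_squares(2)[of 0] by simp
  qed
  then show ?thesis
  proof eventually_elim
    case (elim w)
    then obtain K where K: "0 < K" "eventually (\<lambda>N. q N (pr N w) \<le> ennreal K) U" by blast
    from K(2) have "eventually (\<lambda>N. \<forall>n\<ge>1. t N n (pr N w) \<le> K * (real n)\<^sup>2 * k n ^ p / real (Suc N) ^ (p - 1)) U"
    proof eventually_elim
      case (elim N)
      show ?case
      proof (intro allI impI)
        fix n :: nat assume "1 \<le> n"
        then obtain m where n: "n = Suc m" by (cases n) auto
        have "ennreal (r N n * t N n (pr N w) + 0) \<le> q N (pr N w)"
          unfolding q_def n by (rule ennreal_suminf_term_le)
        also note elim
        finally have "r N n * t N n (pr N w) \<le> K" using K(1) by simp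
        then show "t N n (pr N w) \<le> K * (real n)\<^sup>2 * k n ^ p / real (Suc N) ^ (p - 1)"
          using k_pos[of n] n by (simp add: r_def field_simps del: of_nat_Suc)
      qed
    qed
    then show ?case unfolding t_def by blast
  qed
qed

lemma AE_start:
  "AE w in L. \<exists>K. eventually (\<lambda>N. \<forall>n\<ge>1. (cmod (path N 0 (pr N w) n))\<^sup>2 \<le> K * (real n)\<^sup>2) U"
proof -
  define q where "q N u = (\<Sum>n. ennreal (1 / (real (Suc n))\<^sup>2) * ennreal ((cmod (path N 0 u (Suc n)))\<^sup>2))" for N u
  let ?S = "\<Sum>n. 1 / (real (Suc n))\<^sup>2"
  have [measurable]: "(\<lambda>u. path N 0 u (Suc n)) \<in> borel_measurable (mu \<nu>)" for N n
    by (rule measurable_path_component) simp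
  have "AE w in L. \<exists>K>0. eventually (\<lambda>N. q N (pr N w) \<le> ennreal K) U"
  proof (rule AE_bounded)
    show "q N \<in> borel_measurable (mu \<nu>)" for N unfolding q_def by measurable
    show "eventually (\<lambda>N. E (\<lambda>u. q N u) \<le> ennreal (Mom 2 * ?S)) U"
    proof (intro always_eventually allI)
      fix N
      have m: "(\<lambda>u. ennreal ((cmod (u (Suc n)))\<^sup>2)) \<in> borel_measurable (mu \<nu>)" for n
        using measurable_mu_component[of "Suc n"] by measurable
      have "E (\<lambda>u. q N u) = (\<Sum>n. E (\<lambda>u. ennreal (1 / (real (Suc n))\<^sup>2) * ennreal ((cmod (path N 0 u (Suc n)))\<^sup>2)))"
        unfolding q_def by (rule nn_integral_suminf) measurable
      also have "\<dots> = (\<Sum>n. ennreal (Mom 2 / (real (Suc n))\<^sup>2))"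
      proof (rule suminf_cong)
        fix n
        have "E (\<lambda>u. ennreal ((cmod (path N 0 u (Suc n)))\<^sup>2)) = E (\<lambda>u. ennreal ((cmod (u (Suc n)))\<^sup>2))"
          by (rule nn_integral_path[OF m])
        also have "\<dots> = ennreal (Mom 2)" using nn_integral_stage[of "Suc n" 0 0 2] by simp
        finally show "E (\<lambda>u. ennreal (1 / (real (Suc n))\<^sup>2) * ennreal ((cmod (path N 0 u (Suc n)))\<^sup>2)) = ennreal (Mom 2 / (real (Suc n))\<^sup>2)"
          using Mom_nonneg[of 2] by (subst nn_integral_cmult) (simp_all add: ennreal_mult[symmetric] del: of_nat_Suc)
      qed
      also have "\<dots> = ennreal (Mom 2 * ?S)" by (rule suminf_inverse_squares(1)[OF Mom_nonneg])
      finally show "E (\<lambda>u. q N u) \<le> ennreal (Mom 2 * ?S)" by simp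
    qed
    show "0 \<le> Mom 2 * ?S" using Mom_nonneg[of 2] suminf_inverse_squares(2)[of 0] by simp
  qed
  then show ?thesis
  proof eventually_elim
    case (elim w)
    then obtain K where K: "0 < K" "eventually (\<lambda>N. q N (pr N w) \<le> ennreal K) U" by blast
    from K(2) have "eventually (\<lambda>N. \<forall>n\<ge>1. (cmod (path N 0 (pr N w) n))\<^sup>2 \<le> K * (real n)\<^sup>2) U"
    proof eventually_elim
      case (elim N)
      show ?case
      proof (intro allI impI)
        fix n :: nat assume "1 \<le> n"
        then obtain m where n: "n = Suc m" by (cases n) auto
        have "ennreal (1 / (real n)\<^sup>2) * ennreal ((cmod (path N 0 (pr N w) n))\<^sup>2) \<le> q N (pr N w)"
          unfolding q_def n by (rule ennreal_suminf_term_le)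
        also note elim
        finally have "1 / (real n)\<^sup>2 * (cmod (path N 0 (pr N w) n))\<^sup>2 \<le> K"
          using K(1) by (simp add: ennreal_mult[symmetric])
        then show "(cmod (path N 0 (pr N w) n))\<^sup>2 \<le> K * (real n)\<^sup>2"
          using n by (simp add: field_simps del: of_nat_Suc)
      qed
    qed
    then show ?case by blast
  qed
qed

text \<open>The window has order N + 1 steps with mean residual of order (N + 1)^(-2), so N + 1
  times the residual sum is bounded in mean. \<open>AE_bounded\<close> then gives a bound K/(N + 1)
  for almost every sample point.\<close>

lemma AE_residual:
  assumes n: "1 \<le> n"
  shows "AE w in L. ((\<lambda>N. \<Sum>j\<in>W T N. cmod (path_res N j (pr N w) n)) \<longlongrightarrow> 0) U"
proof -
  define s where "s N j u = cmod (path_res N j u n)" for N j u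
  have sm[measurable]: "s N j \<in> borel_measurable (mu \<nu>)" for N j
  proof -
    have [measurable]: "(\<lambda>u. path N j u n) \<in> borel_measurable (mu \<nu>)" for j
      by (rule measurable_path_component[OF n])
    have [measurable]: "(\<lambda>u. B (path N j u) n) \<in> borel_measurable (mu \<nu>)"
      using measurable_compose[OF measurable_path measurable_sabraB[OF n]] .
    show ?thesis unfolding s_def by measurable
  qed
  have s0: "0 \<le> s N j u" for N j u by (simp add: s_def)
  have "AE w in L. \<exists>K>0. eventually (\<lambda>N. ennreal (real (Suc N) * (\<Sum>j\<in>W T N. s N j (pr N w)) + 0) \<le> ennreal K) U"
  proof (rule AE_bounded)
    show "eventually (\<lambda>N. E (\<lambda>u. ennreal (real (Suc N) * (\<Sum>j\<in>W T N. s N j u) + 0)) \<le> ennreal (2 * real T * Dres n)) U"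
      using ev_ge[of T] ev_ge[of n]
    proof eventually_elim
      case (elim N)
      have "E (\<lambda>u. ennreal (\<Sum>j\<in>W T N. s N j u)) \<le> ennreal (real (card (W T N)) * (Dres n * (1 / real (Suc N))\<^sup>2))"
      proof (rule nn_integral_le_sum)
        fix j assume j: "j \<in> W T N"
        show "E (\<lambda>u. ennreal (s N j u)) \<le> ennreal (Dres n * (1 / real (Suc N))\<^sup>2)"
          unfolding s_def by (rule path_residual[OF j]) (use elim n in auto)
      qed (use Dres_nonneg s0 in auto)
      then have "E (\<lambda>u. ennreal (real (Suc N) * (\<Sum>j\<in>W T N. s N j u) + 0)) \<le> ennreal (real (Suc N) * (real (card (W T N)) * (Dres n * (1 / real (Suc N))\<^sup>2)) + 0)"
        using Dres_nonneg s0 by (intro nn_integral_le_linear) (auto intro!: sum_nonneg)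
      also have "real (Suc N) * (real (card (W T N)) * (Dres n * (1 / real (Suc N))\<^sup>2)) + 0 = 2 * real T * Dres n"
        unfolding card_W by (simp add: power2_eq_square field_simps del: of_nat_Suc)
      finally show ?case .
    qed
  qed (use Dres_nonneg in auto)
  then show ?thesis
  proof eventually_elim
    case (elim w)
    then obtain K where K: "0 < K" "eventually (\<lambda>N. ennreal (real (Suc N) * (\<Sum>j\<in>W T N. s N j (pr N w)) + 0) \<le> ennreal K) U" by blast
    have "((\<lambda>N. \<Sum>j\<in>W T N. s N j (pr N w)) \<longlongrightarrow> 0) U"
    proof (rule Lim_null_comparison)
      show "eventually (\<lambda>N. norm (\<Sum>j\<in>W T N. s N j (pr N w)) \<le> K * (1 / real (Suc N))) U"
        using K(2)
      proof eventually_elim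
        case (elim N)
        then have "real (Suc N) * (\<Sum>j\<in>W T N. s N j (pr N w)) \<le> K" using K(1) by simp
        moreover have "0 \<le> (\<Sum>j\<in>W T N. s N j (pr N w))" by (intro sum_nonneg s0)
        ultimately show ?case by (simp add: field_simps del: of_nat_Suc)
      qed
      have "((\<lambda>N. 1 / real (Suc N)) \<longlongrightarrow> 0) U"
        by (rule tendsto_mono[OF U_seq LIMSEQ_Suc[OF lim_const_over_n]])
      from tendsto_mult[OF tendsto_const this, of K] show "((\<lambda>N. K * (1 / real (Suc N))) \<longlongrightarrow> 0) U" by simp
    qed
    then show ?case unfolding s_def .
  qed
qed

lemma AE_path_limit: "AE w in L. path_limit U k0 lam a b (\<lambda>N j. path N j (pr N w))"
proof -
  \<comment> \<open>T, p and n range over countable sets, so the exceptional null sets can be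
    united.\<close>
  have "AE w in L. \<forall>T. \<forall>p\<in>{2..}. \<exists>K. eventually (\<lambda>N. \<forall>n\<ge>1.
        (\<Sum>j\<in>W T N. cmod (path N (j + 1) (pr N w) n - path N j (pr N w) n) ^ p)
          \<le> K * (real n)\<^sup>2 * k n ^ p / real (Suc N) ^ (p - 1)) U"
    using AE_increments by (simp add: AE_all_countable AE_ball_countable)
  moreover have "AE w in L. \<forall>T. \<forall>n\<in>{1..}. ((\<lambda>N. \<Sum>j\<in>W T N. cmod (path_res N j (pr N w) n)) \<longlongrightarrow> 0) U"
    using AE_residual by (simp add: AE_all_countable AE_ball_countable)
  ultimately show ?thesis
    using AE_start
  proof eventually_elim
    case (elim w)
    show ?case
      by unfold_locales (use elim U U_seq k0 lam in \<open>auto simp: W_def\<close>)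
  qed
qed

text \<open>Measurability of the set where \<open>path_limit\<close> holds is left open; a
  measurable subset of full measure is fixed instead, so that the process can be set to 0 off it and
  remain measurable.\<close>

lemma good_set:
  "\<exists>G\<in>sets L. (AE w in L. w \<in> G) \<and> (\<forall>w\<in>G. path_limit U k0 lam a b (\<lambda>N j. path N j (pr N w)))"
proof -
  obtain Z where Z: "{w\<in>space L. \<not> path_limit U k0 lam a b (\<lambda>N j. path N j (pr N w))} \<subseteq> Z"
    "emeasure L Z = 0" "Z \<in> sets L"
    using AE_E[OF AE_path_limit] by blast
  have "AE w in L. w \<in> space L - Z"
    using AE_not_in[of Z L] AE_space[of L] Z by (auto simp: null_sets_def)
  then show ?thesis using Z by (intro bexI[of _ "space L - Z"]) auto
qed

definition G :: "'w set" where
  "G = (SOME G. G \<in> sets L \<and> (AE w in L. w \<in> G) \<and> (\<forall>w\<in>G. path_limit U k0 lam a b (\<lambda>N j. path N j (pr N w))))"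

lemma G: "G \<in> sets L" "AE w in L. w \<in> G" "\<And>w. w \<in> G \<Longrightarrow> path_limit U k0 lam a b (\<lambda>N j. path N j (pr N w))"
proof -
  have "G \<in> sets L \<and> (AE w in L. w \<in> G) \<and> (\<forall>w\<in>G. path_limit U k0 lam a b (\<lambda>N j. path N j (pr N w)))"
    unfolding G_def by (rule someI_ex) (use good_set in blast)
  then show "G \<in> sets L" "AE w in L. w \<in> G" "\<And>w. w \<in> G \<Longrightarrow> path_limit U k0 lam a b (\<lambda>N j. path N j (pr N w))"
    by blast+
qed

section \<open>The limit process, its marginals and its stationarity\<close>

definition limit_path :: "'w \<Rightarrow> real \<Rightarrow> nat \<Rightarrow> complex" where
  "limit_path w = path_limit.X U (\<lambda>N j. path N j (pr N w))"

text \<open>Elements of \<open>space (mu \<nu>)\<close> are extensional on \<open>{1..}\<close>.\<close>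
definition v :: "real \<Rightarrow> 'w \<Rightarrow> nat \<Rightarrow> complex" where
  "v t w = (\<lambda>n\<in>{1..}. if w \<in> G then limit_path w t n else 0)"

lemma v_eq: "w \<in> G \<Longrightarrow> 1 \<le> n \<Longrightarrow> v t w n = limit_path w t n"
  by (simp add: v_def)

lemma v_solves: "AE w in L. solves_inviscid k0 lam a b (\<lambda>t. v t w) \<and>
    (\<forall>\<gamma> \<alpha>. 0 \<le> \<gamma> \<and> \<gamma> < 1 \<and> \<alpha> > 0 \<longrightarrow> loc_holder_H k0 lam \<gamma> (-1 - \<alpha>) (\<lambda>t. v t w))"
  using G(2)
proof eventually_elim
  case (elim w)
  have c: "v t w n = limit_path w t n" if "1 \<le> n" for t n using v_eq[OF elim that] .
  have "solves_inviscid k0 lam a b (\<lambda>t. v t w) \<longleftrightarrow> solves_inviscid k0 lam a b (limit_path w)"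
    by (rule solves_inviscid_cong) (rule c)
  moreover have "loc_holder_H k0 lam \<gamma> \<beta> (\<lambda>t. v t w) \<longleftrightarrow> loc_holder_H k0 lam \<gamma> \<beta> (limit_path w)" for \<gamma> \<beta>
    by (rule loc_holder_H_cong) (rule c)
  ultimately show ?case
    using path_limit.X_solves[OF G(3)[OF elim]] path_limit.X_loc_holder[OF G(3)[OF elim]]
    by (simp add: limit_path_def)
qed

text \<open>The index is written as a sum of two ticks so that a time shift by h becomes a shift by
  one integer, the same for all t.\<close>

lemma v_tendsto:
  assumes w: "w \<in> G" and n: "1 \<le> n"
  shows "((\<lambda>N. path N (tick t N + tick h N) (pr N w) n) \<longlongrightarrow> v (t + h) w n) U"
proof -
  have "path_limit.approx U (\<lambda>N. tick t N + tick h N) (t + h)"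
  \<comment> \<open>Each of the two floors is off by at most 1, hence the 2.\<close>
  proof (rule path_limit.approx_bounded_dist[OF G(3)[OF w], of _ _ 2], intro always_eventually allI)
    fix N
    have "\<bar>real_of_int (tick t N) - t * real (Suc N)\<bar> \<le> 1" "\<bar>real_of_int (tick h N) - h * real (Suc N)\<bar> \<le> 1"
      by linarith+
    then show "\<bar>real_of_int (tick t N + tick h N) - (t + h) * real (Suc N)\<bar> \<le> 2"
      unfolding of_int_add distrib_right by linarith
  qed
  from path_limit.X_tendsto[OF G(3)[OF w] n this]
  show ?thesis unfolding v_eq[OF w n] limit_path_def .
qed

lemma v_tendsto0:
  assumes w: "w \<in> G" and n: "1 \<le> n"
  shows "((\<lambda>N. path N (tick t N) (pr N w) n) \<longlongrightarrow> v t w n) U"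
  using v_tendsto[OF w n, of t 0] by simp

lemma measurable_v_component:
  assumes n: "1 \<le> n"
  shows "(\<lambda>w. v t w n) \<in> borel_measurable L"
proof (rule measurable_complex_partI)
  fix s
  have "(\<lambda>w. if w \<in> G then part s (v t w n) else part s 0) \<in> borel_measurable L"
  proof (rule limit_measurable[OF _ G(1)])
    show "(\<lambda>u. part s (path N (tick t N) u n)) \<in> borel_measurable (mu \<nu>)" for N
      by (intro part_measurable measurable_path_component n)
    show "((\<lambda>N. part s (path N (tick t N) (pr N w) n)) \<longlongrightarrow> part s (v t w n)) U" if "w \<in> G" for w
      by (intro tendsto_part v_tendsto0 that n)
  qed
  also have "(\<lambda>w. if w \<in> G then part s (v t w n) else part s 0) = (\<lambda>w. part s (v t w n))"
    using n by (auto simp: v_def fun_eq_iff)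
  finally show "(\<lambda>w. part s (v t w n)) \<in> borel_measurable L" .
qed

lemma measurable_v: "v t \<in> measurable L (mu \<nu>)"
  by (rule measurable_muI, erule measurable_v_component) (simp add: v_def)

lemma space_v: "v t w \<in> space (mu \<nu>)"
  by (simp add: space_mu v_def)

text \<open>By \<open>law_limit\<close> a half-space event of the limit is approximated by discrete
  events with thresholds raised by 1/(k + 1). Their probabilities under invariance are those of
  \<open>mu \<nu>\<close> for every N, and continuity from above for \<open>mu \<nu>\<close> lowers
  the thresholds again.\<close>

lemma distr_v: "distr L (mu \<nu>) (v t) = mu \<nu>"
proof (rule mu_eqI[OF \<nu>])
  show "prob_space (distr L (mu \<nu>) (v t))" by (rule L.prob_space_distr[OF measurable_v])
  show "sets (distr L (mu \<nu>) (v t)) = sets (mu \<nu>)" by simp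
  fix F :: "(nat \<times> bool) set" and c :: "nat \<times> bool \<Rightarrow> real"
  assume F: "finite F" and F1: "F \<subseteq> {1..} \<times> UNIV"
  interpret mu: prob_space "mu \<nu>" by (rule prob_space_mu[OF \<nu>])
  have n1: "1 \<le> fst i" if "i \<in> F" for i using F1 that by auto
  have gm: "(\<lambda>u. part (snd i) (u (fst i))) \<in> borel_measurable (mu \<nu>)" if "i \<in> F" for i
    by (intro part_measurable measurable_mu_component n1 that)
  let ?B = "\<lambda>c. {u\<in>space (mu \<nu>). \<forall>i\<in>F. part (snd i) (u (fst i)) \<le> c i}"
  have B: "?B c \<in> sets (mu \<nu>)" for c using F gm by measurable
  have "(\<lambda>k. Lim U (\<lambda>N. measure (mu \<nu>) {u\<in>space (mu \<nu>). \<forall>i\<in>F. part (snd i) (path N (tick t N) u (fst i)) \<le> c i + 1 / real (Suc k)}))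
     \<longlonglongrightarrow> measure L {w\<in>space L. \<forall>i\<in>F. part (snd i) (v t w (fst i)) \<le> c i}"
  proof (rule law_limit[OF F])
    show "(\<lambda>u. part (snd i) (path N (tick t N) u (fst i))) \<in> borel_measurable (mu \<nu>)" if "i \<in> F" for i N
      by (intro part_measurable measurable_path_component n1 that)
    show "(\<lambda>w. part (snd i) (v t w (fst i))) \<in> borel_measurable L" if "i \<in> F" for i
      by (intro part_measurable measurable_v_component n1 that)
    show "AE w in L. \<forall>i\<in>F. ((\<lambda>N. part (snd i) (path N (tick t N) (pr N w) (fst i))) \<longlongrightarrow> part (snd i) (v t w (fst i))) U"
      using G(2) by eventually_elim (intro ballI tendsto_part v_tendsto0 n1)
  qed
  moreover have "Lim U (\<lambda>N. measure (mu \<nu>) {u\<in>space (mu \<nu>). \<forall>i\<in>F. part (snd i) (path N (tick t N) u (fst i)) \<le> c i + 1 / real (Suc k)})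
     = measure (mu \<nu>) (?B (\<lambda>i. c i + 1 / real (Suc k)))" for k
  proof -
    have "measure (mu \<nu>) {u\<in>space (mu \<nu>). \<forall>i\<in>F. part (snd i) (path N (tick t N) u (fst i)) \<le> c i + 1 / real (Suc k)}
        = measure (mu \<nu>) (?B (\<lambda>i. c i + 1 / real (Suc k)))" for N
      by (rule measure_path[OF F, where g = "\<lambda>i u. part (snd i) (u (fst i))"]) (rule gm)
    then show ?thesis by (simp only:) (intro tendsto_Lim tendsto_const U_bot)
  qed
  moreover have "(\<lambda>k. measure (mu \<nu>) (?B (\<lambda>i. c i + 1 / real (Suc k)))) \<longlonglongrightarrow> measure (mu \<nu>) (\<Inter>k. ?B (\<lambda>i. c i + 1 / real (Suc k)))"
  proof (rule mu.finite_Lim_measure_decseq)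
    show "decseq (\<lambda>k. ?B (\<lambda>i. c i + 1 / real (Suc k)))"
      unfolding decseq_Suc_iff
    proof (intro allI subsetI)
      fix k u assume u: "u \<in> ?B (\<lambda>i. c i + 1 / real (Suc (Suc k)))"
      have "1 / real (Suc (Suc k)) \<le> 1 / real (Suc k)" by (simp add: frac_le)
      then have "c i + 1 / real (Suc (Suc k)) \<le> c i + 1 / real (Suc k)" for i by simp
      then show "u \<in> ?B (\<lambda>i. c i + 1 / real (Suc k))" using u by (blast intro: order_trans)
    qed
  qed (rule image_subsetI, rule B)
  moreover have "(\<Inter>k. ?B (\<lambda>i. c i + 1 / real (Suc k))) = ?B c"
  proof (intro set_eqI iffI)
    fix u assume u: "u \<in> (\<Inter>k. ?B (\<lambda>i. c i + 1 / real (Suc k)))"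
    have "part (snd i) (u (fst i)) \<le> c i" if "i \<in> F" for i
    proof (rule LIMSEQ_le_const)
      have "(\<lambda>k. c i + 1 / real (Suc k)) \<longlonglongrightarrow> c i + 0"
        by (intro tendsto_add tendsto_const LIMSEQ_Suc[OF lim_const_over_n])
      then show "(\<lambda>k. c i + 1 / real (Suc k)) \<longlonglongrightarrow> c i" by simp
    qed (use u that in auto)
    with u show "u \<in> ?B c" by auto
  qed (auto intro: add_increasing2)
  ultimately have "measure L {w\<in>space L. \<forall>i\<in>F. part (snd i) (v t w (fst i)) \<le> c i} = measure (mu \<nu>) (?B c)"
    by (simp only:) (rule LIMSEQ_unique)
  also have "{w\<in>space L. \<forall>i\<in>F. part (snd i) (v t w (fst i)) \<le> c i} = v t -` ?B c \<inter> space L"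
    using space_v by auto
  finally show "measure (mu \<nu>) (?B c) = measure (distr L (mu \<nu>) (v t)) (?B c)"
    by (simp only: measure_distr[OF measurable_v B])
qed

lemma eventually_window: "eventually (\<lambda>N. 0 \<le> tick t N + tick h N + (int (Suc N))\<^sup>2) U"
proof -
  \<comment> \<open>Once N + 1 exceeds |t| + |h| + 2, its square outweighs both products and the
    loss of at most 1 in each floor.\<close>
  obtain m :: nat where m: "\<bar>t\<bar> + \<bar>h\<bar> + 2 \<le> real m" using real_arch_simple by blast
  show ?thesis
    using ev_ge[of m]
  proof eventually_elim
    case (elim N)
    define M where "M = real (Suc N)"
    have M: "1 \<le> M" "\<bar>t\<bar> + \<bar>h\<bar> + 2 \<le> M" using m elim by (simp_all add: M_def)
    then have "\<bar>t\<bar> * M + \<bar>h\<bar> * M + 2 * M \<le> M * M"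
      using mult_right_mono[of "\<bar>t\<bar> + \<bar>h\<bar> + 2" M M] by (simp add: distrib_right)
    moreover have "- (\<bar>t\<bar> * M) \<le> t * M" "- (\<bar>h\<bar> * M) \<le> h * M"
      using mult_right_mono[of "- \<bar>t\<bar>" t M] mult_right_mono[of "- \<bar>h\<bar>" h M] M by simp_all
    moreover have "t * M - 1 \<le> real_of_int \<lfloor>t * M\<rfloor>" "h * M - 1 \<le> real_of_int \<lfloor>h * M\<rfloor>" by linarith+
    ultimately have "0 \<le> real_of_int \<lfloor>t * M\<rfloor> + real_of_int \<lfloor>h * M\<rfloor> + M * M"
      using M(1) by linarith
    also have "\<dots> = real_of_int (tick t N + tick h N + (int (Suc N))\<^sup>2)"
      by (simp add: power2_eq_square M_def)
    finally show ?case unfolding of_int_0_le_iff .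
  qed
qed

text \<open>At each slack 1/(k + 1) the shifted and the original discrete events have equal
  probabilities for U-almost all N, so the two limit probabilities are limits of one and the same
  sequence in k.\<close>

lemma distr_v_shift:
  assumes Js: "finite Js"
  shows "distr L (PiM Js (\<lambda>_. mu \<nu>)) (\<lambda>w. \<lambda>t\<in>Js. v (t + h) w) = distr L (PiM Js (\<lambda>_. mu \<nu>)) (\<lambda>w. \<lambda>t\<in>Js. v t w)"
proof (rule PiM_mu_eqI[OF \<nu>, where J = Js])
  let ?P = "PiM Js (\<lambda>_. mu \<nu>)"
  have m: "(\<lambda>w. \<lambda>t\<in>Js. v (t + h) w) \<in> measurable L ?P" for h
    by (intro measurable_restrict measurable_v)
  have m0: "(\<lambda>w. \<lambda>t\<in>Js. v t w) \<in> measurable L ?P" by (intro measurable_restrict measurable_v)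
  show "prob_space (distr L ?P (\<lambda>w. \<lambda>t\<in>Js. v (t + h) w))" "prob_space (distr L ?P (\<lambda>w. \<lambda>t\<in>Js. v t w))"
    by (intro L.prob_space_distr m m0)+
  fix F :: "(real \<times> nat \<times> bool) set" and c :: "real \<times> nat \<times> bool \<Rightarrow> real"
  assume F: "finite F" and FJ: "F \<subseteq> Js \<times> {1..} \<times> UNIV"
  have n1: "1 \<le> fst (snd i)" "fst i \<in> Js" if "i \<in> F" for i using FJ that by auto
  let ?S = "{x\<in>space ?P. \<forall>i\<in>F. part (snd (snd i)) (x (fst i) (fst (snd i))) \<le> c i}"
  have S: "?S \<in> sets ?P"
  proof -
    have "(\<lambda>x. part (snd (snd i)) (x (fst i) (fst (snd i)))) \<in> borel_measurable ?P" if "i \<in> F" for i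
    proof (rule part_measurable)
      have "(\<lambda>x. x (fst i)) \<in> measurable ?P (mu \<nu>)"
        by (rule measurable_component_singleton) (rule n1(2)[OF that])
      from measurable_compose[OF this measurable_mu_component[OF n1(1)[OF that]]]
      show "(\<lambda>x. x (fst i) (fst (snd i))) \<in> borel_measurable ?P" .
    qed
    with F show ?thesis by measurable
  qed
  let ?L = "\<lambda>h k N. measure (mu \<nu>) {u\<in>space (mu \<nu>). \<forall>i\<in>F. part (snd (snd i)) (path N (tick (fst i) N + tick h N) u (fst (snd i))) \<le> c i + 1 / real (Suc k)}"
  have lim: "(\<lambda>k. Lim U (?L h k)) \<longlonglongrightarrow> measure L {w\<in>space L. \<forall>i\<in>F. part (snd (snd i)) (v (fst i + h) w (fst (snd i))) \<le> c i}" for h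
  proof (rule law_limit[OF F])
    show "(\<lambda>u. part (snd (snd i)) (path N (tick (fst i) N + tick h N) u (fst (snd i)))) \<in> borel_measurable (mu \<nu>)" if "i \<in> F" for i N
      by (intro part_measurable measurable_path_component n1 that)
    show "(\<lambda>w. part (snd (snd i)) (v (fst i + h) w (fst (snd i)))) \<in> borel_measurable L" if "i \<in> F" for i
      by (intro part_measurable measurable_v_component n1 that)
    show "AE w in L. \<forall>i\<in>F. ((\<lambda>N. part (snd (snd i)) (path N (tick (fst i) N + tick h N) (pr N w) (fst (snd i))))
       \<longlongrightarrow> part (snd (snd i)) (v (fst i + h) w (fst (snd i)))) U"
      using G(2) by eventually_elim (intro ballI tendsto_part v_tendsto n1)
  qed
  have "Lim U (?L h k) = Lim U (?L 0 k)" for k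
  proof (rule Lim_eventually_cong)
    have "eventually (\<lambda>N. \<forall>i\<in>F. 0 \<le> tick (fst i) N + tick h N + (int (Suc N))\<^sup>2) U"
      by (intro eventually_ball_finite F ballI eventually_window)
    moreover have "eventually (\<lambda>N. \<forall>i\<in>F. 0 \<le> tick (fst i) N + tick 0 N + (int (Suc N))\<^sup>2) U"
      by (intro eventually_ball_finite F ballI eventually_window)
    ultimately show "eventually (\<lambda>N. ?L h k N = ?L 0 k N) U"
    proof eventually_elim
      case (elim N)
      have "?L h k N = measure (mu \<nu>) {u\<in>space (mu \<nu>). \<forall>i\<in>F. part (snd (snd i)) (path N (tick (fst i) N) u (fst (snd i))) \<le> c i + 1 / real (Suc k)}"
        by (rule measure_path_shift[OF F, where g = "\<lambda>i u. part (snd (snd i)) (u (fst (snd i)))"])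
          (use elim in \<open>auto intro!: part_measurable measurable_mu_component dest: n1\<close>)
      then show ?case by simp
    qed
  qed
  then have "measure L {w\<in>space L. \<forall>i\<in>F. part (snd (snd i)) (v (fst i + h) w (fst (snd i))) \<le> c i}
     = measure L {w\<in>space L. \<forall>i\<in>F. part (snd (snd i)) (v (fst i + 0) w (fst (snd i))) \<le> c i}"
    using lim[of h] lim[of 0] by (simp only:) (rule LIMSEQ_unique)
  moreover have "{w\<in>space L. \<forall>i\<in>F. part (snd (snd i)) (v (fst i + h) w (fst (snd i))) \<le> c i}
     = (\<lambda>w. \<lambda>t\<in>Js. v (t + h) w) -` ?S \<inter> space L" for h
    using n1(2) measurable_space[OF m] by (auto simp: restrict_def split: if_splits)
  ultimately have "measure L ((\<lambda>w. \<lambda>t\<in>Js. v (t + h) w) -` ?S \<inter> space L) = measure L ((\<lambda>w. \<lambda>t\<in>Js. v (t + 0) w) -` ?S \<inter> space L)"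
    by (simp only:)
  then have "measure (distr L ?P (\<lambda>w. \<lambda>t\<in>Js. v (t + h) w)) ?S = measure (distr L ?P (\<lambda>w. \<lambda>t\<in>Js. v t w)) ?S"
    by (simp only: measure_distr[OF m S] measure_distr[OF m0 S] add_0_right)
  then show "measure (distr L ?P (\<lambda>w. \<lambda>t\<in>Js. v (t + h) w)) {x\<in>space (distr L ?P (\<lambda>w. \<lambda>t\<in>Js. v (t + h) w)). \<forall>i\<in>F. part (snd (snd i)) (x (fst i) (fst (snd i))) \<le> c i}
    = measure (distr L ?P (\<lambda>w. \<lambda>t\<in>Js. v t w)) {x\<in>space (distr L ?P (\<lambda>w. \<lambda>t\<in>Js. v (t + h) w)). \<forall>i\<in>F. part (snd (snd i)) (x (fst i) (fst (snd i))) \<le> c i}"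
    by (simp only: space_distr)
qed simp_all

lemma mu_stationary_v: "mu_stationary L \<nu> v"
  unfolding mu_stationary_def using measurable_v distr_v distr_v_shift by blast

end

theorem theorem4p2:
  fixes k0 lam a b \<nu> :: real
  assumes "k0 > 0" and "lam > 1" and "\<nu> > 0"
  shows "\<exists>(M :: (real \<Rightarrow> nat \<Rightarrow> complex) measure) (v :: real \<Rightarrow> (real \<Rightarrow> nat \<Rightarrow> complex) \<Rightarrow> nat \<Rightarrow> complex).
           prob_space M \<and> mu_stationary M \<nu> v \<and>
           (AE \<omega> in M. solves_inviscid k0 lam a b (\<lambda>t. v t \<omega>) \<and>
              (\<forall>\<gamma> \<alpha>. 0 \<le> \<gamma> \<and> \<gamma> < 1 \<and> \<alpha> > 0 \<longrightarrow>
                 loc_holder_H k0 lam \<gamma> (-1 - \<alpha>) (\<lambda>t. v t \<omega>)))"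
proof -
  obtain U :: "nat filter" where U: "ultra U" "U \<le> sequentially"
    using ultra_exists[of sequentially] by auto
  \<comment> \<open>The sample space consists of sequences of initial data; they are stored on the integer points of the reals.\<close>
  interpret shell_loeb k0 lam a b \<nu> U "\<lambda>N (w :: real \<Rightarrow> nat \<Rightarrow> complex). w (real N)"
  proof (intro shell_loeb.intro shell_scheme.intro loeb.intro assms U)
    show "prob_space (mu \<nu>)" for N :: nat by (rule prob_space_mu[OF assms(3)])
    show "\<exists>w. \<forall>N. w (real N) = f N" for f :: "nat \<Rightarrow> nat \<Rightarrow> complex"
      by (rule exI[of _ "\<lambda>x. f (nat \<lfloor>x\<rfloor>)"]) simp
  qed
  show ?thesis
    using prob_space_L mu_stationary_v v_solves by blast
qed

end
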